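(* Let $K$ be in $\mathrm{Hen}$, i.e. a Henselian valued field of characteristic zero. Let $f:X\to K$ be an $L_{\mathrm{Hen}}(A)$-definable function for some set of parameters $A$. Then there exists an $L_{\mathrm{Hen}}(A)$-definable function $g:X\to S$ with $S$ auxiliary such that $$f(x)=t(x,g(x))$$ for each $x\in X$, where $t$ is an $L_{\mathrm{Hen}}^{*}(A)$-term.
   Context: **Valued fields.** $\mathrm{Hen}$ is the collection of all Henselian valued fields of characteristic zero (mixed characteristic as well as equal characteristic zero are allowed). For $K$ in $\mathrm{Hen}$, write $\mathrm{ord}:K^\times\to\Gamma_K$ for the valuation ($\mathrm{ord}(0)=+\infty$) and $M_K$ for the maximal ideal of the valuation ring. For integers $n>0$, $nM_K=\{nm\mid m\in M_K\}$, $RV_n(K)=(K^\times/(1+nM_K))\cup\{0\}$ and $rv_n:K\to RV_n(K)$ is the quotient map on $K^\times$ extended by $0\mapsto0$. **Language $L_{\mathrm{Hen}}$.** It has main sort the valued field with the ring language $(+,-,\cdot,0,1)$, auxiliary sorts $RV_n$ ($n>0$), function symbols $rv_n$ from the main sort to $RV_n$, and on the auxiliary sorts the inclusion language: for polynomial expressions $f,g$ formed with $+,\cdot$ in variables running over some sorts $RV_{n_i}$, a relation $f(a)\subset g(a)$, where $f(a)$ stands for the set $\{x\in K\mid\exists y\ (f(y)=x\wedge\bigwedge_i rv_{n_i}(y_i)=a_i)\}$ (similarly $g(a)$) and $\subset$ is inclusion of subsets of $K$. $L(A)$ denotes $L$ with constants for the elements of $A$ (elements of any sorts). A set is auxiliary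 if it is a definable subset of a finite Cartesian product of sorts $RV_n$. **Henselian functions and $L^*_{\mathrm{Hen}}$.** For integers $m\ge0$, $n>0$, the function $h_{m,n}:K^{m+1}\times RV_n(K)\to K$ is defined as follows. Given $(a_0,\dots,a_m,x_0)$ with $x_0\neq0$, put $f(y)=\sum_{i=0}^m a_iy^i$. If there exist $i_0>0$ and $x\in K$ with $rv_n(x)=x_0$, $\mathrm{ord}(a_{i_0}x^{i_0})=\min_{0\le i\le m}\mathrm{ord}(a_ix^i)$, $\mathrm{ord}(f(x))>\mathrm{ord}(n^2a_{i_0}x^{i_0})$ and $\mathrm{ord}(f'(x))\le\mathrm{ord}(na_{i_0}x^{i_0-1})$, then there is a unique $b\in K$ with $f(b)=0$ and $rv_n(b)=x_0$, and $h_{m,n}(a_0,\dots,a_m,x_0):=b$. In all other cases $h_{m,n}(a_0,\dots,a_m,x_0):=0$. $L_{\mathrm{Hen}}^{*}$ is $L_{\mathrm{Hen}}$ together with function symbols for all $h_{m,n}$.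
   Formalization: The Henselian valued field K is required to be non-trivially valued; for the trivial valuation the claim fails, e.g. K = Q, A empty, f(x) = 2^x on the natural numbers, which no term t(x, g(x)) can express. *)

theory Defs
  imports "HOL-Computational_Algebra.Polynomial" "HOL-Library.Extended"
begin

text \<open>A valued field is a type \<open>'k\<close> of class \<^class>\<open>field_char_0\<close> with a map
  \<open>ord :: 'k \<Rightarrow> 'g extended\<close>, where \<open>'g\<close> is the value group and \<open>Pinf\<close> is the value of zero;
  the element \<open>Minf\<close> of \<open>'g extended\<close> is never a value. The trivial valuation is excluded: for it
  every field is Henselian and \<open>RV\<^sub>n\<close> is the field itself, so that definable closure need not be
  contained in the algebraic closure and values of definable functions need not be given by terms.\<close>

definition valued_field :: "('k::field_char_0 \<Rightarrow> 'g::linordered_ab_group_add extended) \<Rightarrow> bool" where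
  "valued_field ord \<longleftrightarrow>
     ord 0 = Pinf \<and>
     (\<forall>x. x \<noteq> 0 \<longrightarrow> (\<exists>\<gamma>. ord x = Fin \<gamma>)) \<and>
     (\<forall>\<gamma>. \<exists>x. ord x = Fin \<gamma>) \<and>
     (\<forall>x y. ord (x * y) = ord x + ord y) \<and>
     (\<forall>x y. min (ord x) (ord y) \<le> ord (x + y)) \<and>
     (\<exists>x. x \<noteq> 0 \<and> ord x \<noteq> Fin 0)"

definition val_ring :: "('k::field_char_0 \<Rightarrow> 'g::linordered_ab_group_add extended) \<Rightarrow> 'k set" where
  "val_ring ord = {x. ord x \<ge> Fin 0}"

definition max_ideal :: "('k::field_char_0 \<Rightarrow> 'g::linordered_ab_group_add extended) \<Rightarrow> 'k set" where
  "max_ideal ord = {x. ord x > Fin 0}"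

definition henselian_field :: "('k::field_char_0 \<Rightarrow> 'g::linordered_ab_group_add extended) \<Rightarrow> bool" where
  "henselian_field ord \<longleftrightarrow>
     valued_field ord \<and>
     (\<forall>p a. lead_coeff p = 1 \<and> (\<forall>i. coeff p i \<in> val_ring ord) \<and> a \<in> val_ring ord \<and>
        poly p a \<in> max_ideal ord \<and> poly (pderiv p) a \<notin> max_ideal ord \<longrightarrow>
        (\<exists>b \<in> val_ring ord. poly p b = 0 \<and> b - a \<in> max_ideal ord))"

text \<open>The coset \<open>x (1 + n M)\<close>. For \<open>x = 0\<close> this set is \<open>{0}\<close>, which serves as the additional
  element \<open>0\<close> of \<open>RV\<^sub>n\<close>, so \<open>RV\<^sub>n\<close> is the range of \<open>rv ord n\<close>.\<close>

definition rv :: "('k::field_char_0 \<Rightarrow> 'g::linordered_ab_group_add extended) \<Rightarrow> nat \<Rightarrow> 'k \<Rightarrow> 'k set" where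
  "rv ord n x = (\<lambda>m. x * (1 + of_nat n * m)) ` max_ideal ord"

text \<open>The argument tuple \<open>(a\<^sub>0, \<dots>, a\<^sub>m)\<close> of \<open>h(m,n)\<close> is a list of length \<open>m + 1\<close>.\<close>

definition hensel_condition ::
    "('k::field_char_0 \<Rightarrow> 'g::linordered_ab_group_add extended) \<Rightarrow> nat \<Rightarrow> nat \<Rightarrow> 'k list \<Rightarrow> 'k set \<Rightarrow> bool" where
  "hensel_condition ord m n as \<xi> \<longleftrightarrow>
     (\<exists>i\<^sub>0 x. 0 < i\<^sub>0 \<and> i\<^sub>0 \<le> m \<and> rv ord n x = \<xi> \<and>
        ord (as ! i\<^sub>0 * x ^ i\<^sub>0) = (MIN i\<in>{0..m}. ord (as ! i * x ^ i)) \<and>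
        ord (poly (Poly as) x) > ord (of_nat (n ^ 2) * as ! i\<^sub>0 * x ^ i\<^sub>0) \<and>
        ord (poly (pderiv (Poly as)) x) \<le> ord (of_nat n * as ! i\<^sub>0 * x ^ (i\<^sub>0 - 1)))"

definition hfun ::
    "('k::field_char_0 \<Rightarrow> 'g::linordered_ab_group_add extended) \<Rightarrow> nat \<Rightarrow> nat \<Rightarrow> 'k list \<Rightarrow> 'k set \<Rightarrow> 'k" where
  "hfun ord m n as \<xi> =
     (if \<xi> \<noteq> rv ord n 0 \<and> hensel_condition ord m n as \<xi>
      then THE b. poly (Poly as) b = 0 \<and> rv ord n b = \<xi>
      else 0)"

datatype srt = VF | RVs nat

fun valid_sort :: "srt \<Rightarrow> bool" where
  "valid_sort VF \<longleftrightarrow> True"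
| "valid_sort (RVs n) \<longleftrightarrow> n > 0"

text \<open>The index in \<open>RVElem n \<xi>\<close> keeps the sorts \<open>RV\<^sub>n\<close> disjoint even where the quotients coincide.\<close>

datatype 'k elem = Fld (fld: 'k) | RVElem nat (cls: "'k set")

fun sort_of :: "'k elem \<Rightarrow> srt" where
  "sort_of (Fld x) = VF"
| "sort_of (RVElem n \<xi>) = RVs n"

fun dom_sort :: "('k::field_char_0 \<Rightarrow> 'g::linordered_ab_group_add extended) \<Rightarrow> srt \<Rightarrow> 'k elem set" where
  "dom_sort ord VF = range Fld"
| "dom_sort ord (RVs n) = range (\<lambda>x. RVElem n (rv ord n x))"

definition all_elems :: "('k::field_char_0 \<Rightarrow> 'g::linordered_ab_group_add extended) \<Rightarrow> 'k elem set" where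
  "all_elems ord = (\<Union>s\<in>Collect valid_sort. dom_sort ord s)"

definition dom_prod ::
    "('k::field_char_0 \<Rightarrow> 'g::linordered_ab_group_add extended) \<Rightarrow> srt list \<Rightarrow> 'k elem list set" where
  "dom_prod ord ss = listset (map (dom_sort ord) ss)"

text \<open>Variables are de Bruijn indices into a context, which is the list of the sorts of the free
  variables; an assignment is a list of elements. Terms may use the function symbols \<open>Hen m n\<close>
  for \<open>h(m,n)\<close>; those that do not are the terms of the smaller language.\<close>

datatype 'k trm =
    Var nat
  | Cst "'k elem"
  | Zero
  | One
  | Add "'k trm" "'k trm"
  | Sub "'k trm" "'k trm"
  | Mul "'k trm" "'k trm"
  | Rv nat "'k trm"
  | Hen nat nat "'k trm list" "'k trm"

inductive has_sort :: "'k elem set \<Rightarrow> srt list \<Rightarrow> 'k trm \<Rightarrow> srt \<Rightarrow> bool"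
  for A :: "'k elem set" and \<Gamma> :: "srt list" where
  "i < length \<Gamma> \<Longrightarrow> has_sort A \<Gamma> (Var i) (\<Gamma> ! i)"
| "c \<in> A \<Longrightarrow> has_sort A \<Gamma> (Cst c) (sort_of c)"
| "has_sort A \<Gamma> Zero VF"
| "has_sort A \<Gamma> One VF"
| "has_sort A \<Gamma> s VF \<Longrightarrow> has_sort A \<Gamma> t VF \<Longrightarrow> has_sort A \<Gamma> (Add s t) VF"
| "has_sort A \<Gamma> s VF \<Longrightarrow> has_sort A \<Gamma> t VF \<Longrightarrow> has_sort A \<Gamma> (Sub s t) VF"
| "has_sort A \<Gamma> s VF \<Longrightarrow> has_sort A \<Gamma> t VF \<Longrightarrow> has_sort A \<Gamma> (Mul s t) VF"
| "n > 0 \<Longrightarrow> has_sort A \<Gamma> t VF \<Longrightarrow> has_sort A \<Gamma> (Rv n t) (RVs n)"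
| "n > 0 \<Longrightarrow> length ts = m + 1 \<Longrightarrow> (\<forall>t\<in>set ts. has_sort A \<Gamma> t VF) \<Longrightarrow> has_sort A \<Gamma> s (RVs n) \<Longrightarrow>
     has_sort A \<Gamma> (Hen m n ts s) VF"

fun hen_free :: "'k trm \<Rightarrow> bool" where
  "hen_free (Hen m n ts s) \<longleftrightarrow> False"
| "hen_free (Add s t) \<longleftrightarrow> hen_free s \<and> hen_free t"
| "hen_free (Sub s t) \<longleftrightarrow> hen_free s \<and> hen_free t"
| "hen_free (Mul s t) \<longleftrightarrow> hen_free s \<and> hen_free t"
| "hen_free (Rv n t) \<longleftrightarrow> hen_free t"
| "hen_free _ \<longleftrightarrow> True"

definition Hen_star_term :: "'k elem set \<Rightarrow> srt list \<Rightarrow> 'k trm \<Rightarrow> srt \<Rightarrow> bool" where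
  "Hen_star_term A \<Gamma> t s \<longleftrightarrow> has_sort A \<Gamma> t s"

definition Hen_term :: "'k elem set \<Rightarrow> srt list \<Rightarrow> 'k trm \<Rightarrow> srt \<Rightarrow> bool" where
  "Hen_term A \<Gamma> t s \<longleftrightarrow> has_sort A \<Gamma> t s \<and> hen_free t"

fun trm_val ::
    "('k::field_char_0 \<Rightarrow> 'g::linordered_ab_group_add extended) \<Rightarrow> 'k elem list \<Rightarrow> 'k trm \<Rightarrow> 'k elem" where
  "trm_val ord e (Var i) = e ! i"
| "trm_val ord e (Cst c) = c"
| "trm_val ord e Zero = Fld 0"
| "trm_val ord e One = Fld 1"
| "trm_val ord e (Add s t) = Fld (fld (trm_val ord e s) + fld (trm_val ord e t))"
| "trm_val ord e (Sub s t) = Fld (fld (trm_val ord e s) - fld (trm_val ord e t))"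
| "trm_val ord e (Mul s t) = Fld (fld (trm_val ord e s) * fld (trm_val ord e t))"
| "trm_val ord e (Rv n t) = RVElem n (rv ord n (fld (trm_val ord e t)))"
| "trm_val ord e (Hen m n ts s) =
     Fld (hfun ord m n (map (\<lambda>t. fld (trm_val ord e t)) ts) (cls (trm_val ord e s)))"

text \<open>\<open>Incl p q ts\<close> is the relation \<open>p(a) \<subset> q(a)\<close> of the inclusion language at the tuple \<open>a\<close> of values
  of the terms \<open>ts\<close>, which are of sorts \<open>RV\<^sub>n\<close> with possibly different \<open>n\<close>. The variable \<open>PVar i\<close> of
  a polynomial expression ranges over the lifts to the field of the \<open>i\<close>-th entry of \<open>a\<close>.\<close>

datatype pexp = PVar nat | PAdd pexp pexp | PMul pexp pexp

fun pvars :: "pexp \<Rightarrow> nat set" where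
  "pvars (PVar i) = {i}"
| "pvars (PAdd p q) = pvars p \<union> pvars q"
| "pvars (PMul p q) = pvars p \<union> pvars q"

fun pval :: "'k::field_char_0 list \<Rightarrow> pexp \<Rightarrow> 'k" where
  "pval y (PVar i) = y ! i"
| "pval y (PAdd p q) = pval y p + pval y q"
| "pval y (PMul p q) = pval y p * pval y q"

fun lifts :: "('k::field_char_0 \<Rightarrow> 'g::linordered_ab_group_add extended) \<Rightarrow> 'k \<Rightarrow> 'k elem \<Rightarrow> bool" where
  "lifts ord y (RVElem n \<xi>) \<longleftrightarrow> rv ord n y = \<xi>"
| "lifts ord y (Fld x) \<longleftrightarrow> False"

definition pset ::
    "('k::field_char_0 \<Rightarrow> 'g::linordered_ab_group_add extended) \<Rightarrow> pexp \<Rightarrow> 'k elem list \<Rightarrow> 'k set" where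
  "pset ord p a = {x. \<exists>y. pval y p = x \<and> list_all2 (lifts ord) y a}"

datatype 'k fm =
    Eq "'k trm" "'k trm"
  | Incl pexp pexp "'k trm list"
  | Neg "'k fm"
  | Conj "'k fm" "'k fm"
  | Exi srt "'k fm"

fun Hen_formula :: "'k elem set \<Rightarrow> srt list \<Rightarrow> 'k fm \<Rightarrow> bool" where
  "Hen_formula A \<Gamma> (Eq s t) \<longleftrightarrow> (\<exists>\<sigma>. Hen_term A \<Gamma> s \<sigma> \<and> Hen_term A \<Gamma> t \<sigma>)"
| "Hen_formula A \<Gamma> (Incl p q ts) \<longleftrightarrow>
     (\<forall>t\<in>set ts. \<exists>n>0. Hen_term A \<Gamma> t (RVs n)) \<and> pvars p \<union> pvars q \<subseteq> {..<length ts}"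
| "Hen_formula A \<Gamma> (Neg \<phi>) \<longleftrightarrow> Hen_formula A \<Gamma> \<phi>"
| "Hen_formula A \<Gamma> (Conj \<phi> \<psi>) \<longleftrightarrow> Hen_formula A \<Gamma> \<phi> \<and> Hen_formula A \<Gamma> \<psi>"
| "Hen_formula A \<Gamma> (Exi \<sigma> \<phi>) \<longleftrightarrow> valid_sort \<sigma> \<and> Hen_formula A (\<sigma> # \<Gamma>) \<phi>"

fun sat ::
    "('k::field_char_0 \<Rightarrow> 'g::linordered_ab_group_add extended) \<Rightarrow> 'k elem list \<Rightarrow> 'k fm \<Rightarrow> bool" where
  "sat ord e (Eq s t) \<longleftrightarrow> trm_val ord e s = trm_val ord e t"
| "sat ord e (Incl p q ts) \<longleftrightarrow>
     pset ord p (map (trm_val ord e) ts) \<subseteq> pset ord q (map (trm_val ord e) ts)"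
| "sat ord e (Neg \<phi>) \<longleftrightarrow> \<not> sat ord e \<phi>"
| "sat ord e (Conj \<phi> \<psi>) \<longleftrightarrow> sat ord e \<phi> \<and> sat ord e \<psi>"
| "sat ord e (Exi \<sigma> \<phi>) \<longleftrightarrow> (\<exists>x\<in>dom_sort ord \<sigma>. sat ord (x # e) \<phi>)"

text \<open>\<open>definable ord A ss X\<close>: \<open>X\<close> is a subset, definable with parameters from \<open>A\<close>, of the product of
  the sorts \<open>ss\<close>.\<close>

definition definable ::
    "('k::field_char_0 \<Rightarrow> 'g::linordered_ab_group_add extended) \<Rightarrow> 'k elem set \<Rightarrow> srt list \<Rightarrow>
     'k elem list set \<Rightarrow> bool" where
  "definable ord A ss X \<longleftrightarrow>
     list_all valid_sort ss \<and>
     (\<exists>\<phi>. Hen_formula A ss \<phi> \<and> X = {x \<in> dom_prod ord ss. sat ord x \<phi>})"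

definition definable_fun ::
    "('k::field_char_0 \<Rightarrow> 'g::linordered_ab_group_add extended) \<Rightarrow> 'k elem set \<Rightarrow>
     srt list \<Rightarrow> 'k elem list set \<Rightarrow> srt list \<Rightarrow> 'k elem list set \<Rightarrow>
     ('k elem list \<Rightarrow> 'k elem list) \<Rightarrow> bool" where
  "definable_fun ord A ss X ts Y f \<longleftrightarrow>
     definable ord A ss X \<and> definable ord A ts Y \<and> f ` X \<subseteq> Y \<and>
     definable ord A (ss @ ts) {x @ f x | x. x \<in> X}"

definition auxiliary ::
    "('k::field_char_0 \<Rightarrow> 'g::linordered_ab_group_add extended) \<Rightarrow> 'k elem set \<Rightarrow> nat list \<Rightarrow>
     'k elem list set \<Rightarrow> bool" where
  "auxiliary ord A ns S \<longleftrightarrow> definable ord A (map RVs ns) S"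

end

theory Submission
  imports Defs
begin

text \<open>If no derivative of a polynomial \<open>q\<close> has a root closer to \<open>y\<close> than \<open>c\<close>, then Hensel's lemma
  applied to the derivatives shows that the Taylor expansion of \<open>q\<close> at \<open>c\<close> has only bounded
  cancellation at \<open>y\<close>, so that \<open>rv n (q y)\<close> is determined by the leading terms of \<open>y - c\<close> and of the
  Taylor coefficients. By induction on the degree, roots, and hence arbitrary points, can be moved
  from one specialisation of a polynomial with parameters to another whose parameters have the same
  leading terms. Hence a formula depends on its valued field variables only through leading terms of
  finitely many polynomials. In particular, the value \<open>f x\<close> of a definable function is a root of a
  nonzero polynomial over terms in \<open>x\<close>, since otherwise its fibre would be open.

  To express a root \<open>b\<close> of \<open>q\<close> by a term, start with \<open>c = 0\<close> and repeatedly replace \<open>c\<close> by the root near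
  \<open>b\<close> that Hensel's lemma provides for the derivative of least order to which it applies. Each step
  is an application of a Hensel function to \<open>rv n (b - c)\<close>, an auxiliary parameter definable from
  \<open>x\<close>, and moves \<open>c\<close> strictly closer to \<open>b\<close>. As only roots of derivatives occur, the number of steps is bounded
  in terms of the degree.\<close>

section \<open>Valued fields and Hensel's lemma\<close>

text \<open>The residue characteristic may be positive. Integers such as \<open>i\<close> and
  \<open>i!\<close>, which arise when a polynomial is differentiated or expanded, then need not be
  units, and Hensel's condition costs a square at every derivative. This is the origin of the
  constants \<open>nu d j\<close> and of classes modulo \<open>1 + n \<M>\<close> with large n:
  precision is spent at each step and has to be provided in advance, as a function of the degree
  alone. Uniformity is not obtained by compactness but by treating polynomials as functions of the
  assignment \<open>e\<close> with a common degree bound. A second obstacle is that one term must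
  serve all x, although the construction distinguishes cases. Terms have no case distinction, but
  \<open>hfun\<close> vanishes at the class of zero: a zero auxiliary argument switches a root off,
  and the cases can be added up. For this the roots must be definable functions of x, which the
  uniqueness in Hensel's lemma provides.\<close>

locale henselian =
  fixes ord :: "'k::field_char_0 \<Rightarrow> 'g::linordered_ab_group_add extended"
  assumes hens: "henselian_field ord"
begin

abbreviation \<O> :: "'k set" where "\<O> \<equiv> val_ring ord"
abbreviation \<M> :: "'k set" where "\<M> \<equiv> max_ideal ord"

section \<open>Divisibility as an order on the field\<close>

text \<open>This is \<open>ord x \<le> ord y\<close> phrased as divisibility, so that estimates
  become computations in the field instead of in the extended value group. Larger in this order
  means closer to zero.\<close>

definition vle :: "'k \<Rightarrow> 'k \<Rightarrow> bool" (infix "\<preceq>" 50) where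
  "x \<preceq> y \<longleftrightarrow> (\<exists>u\<in>\<O>. y = x * u)"

text \<open>At 0 this differs from the strict order of values: \<open>0 \<prec> 0\<close> holds.
  With this convention \<open>rv_eq_iff\<close> needs no case distinction; where strictness matters,
  nonvanishing is stated separately.\<close>

definition vlt :: "'k \<Rightarrow> 'k \<Rightarrow> bool" (infix "\<prec>" 50) where
  "x \<prec> y \<longleftrightarrow> (\<exists>u\<in>\<M>. y = x * u)"

lemma vf: "valued_field ord"
  using hens by (simp add: henselian_field_def)

lemma ord_zero [simp]: "ord 0 = Pinf"
  using vf by (simp add: valued_field_def)

lemma ord_nonzero: "x \<noteq> 0 \<Longrightarrow> \<exists>\<gamma>. ord x = Fin \<gamma>"
  using vf by (simp add: valued_field_def)

lemma ord_mult: "ord (x * y) = ord x + ord y"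
  using vf by (simp add: valued_field_def)

lemma ord_add: "min (ord x) (ord y) \<le> ord (x + y)"
  using vf by (simp add: valued_field_def)

lemma ord_one [simp]: "ord 1 = Fin 0"
proof -
  obtain \<gamma> where g: "ord 1 = Fin \<gamma>" using ord_nonzero[of 1] by auto
  have "ord (1 * 1) = ord 1 + ord 1" by (rule ord_mult)
  with g show ?thesis by simp
qed

lemma ord_minus [simp]: "ord (- x) = ord x"
proof -
  obtain \<gamma> where g: "ord (-1) = Fin \<gamma>" using ord_nonzero[of "-1"] by auto
  have "ord ((-1) * (-1)) = ord (-1) + ord (-1)" by (rule ord_mult)
  with g have "\<gamma> + \<gamma> = 0" by simp
  then have "\<gamma> = 0" by (simp add: add_eq_0_iff) 
  with g have "ord (-1) = Fin 0" by simp
  moreover have "ord (- x) = ord (-1) + ord x" using ord_mult[of "-1" x] by simp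
  ultimately show ?thesis by (cases "ord x") auto
qed

lemma O_0 [simp]: "0 \<in> \<O>" and O_1 [simp]: "1 \<in> \<O>"
  and M_0 [simp]: "0 \<in> \<M>" and M_1 [simp]: "1 \<notin> \<M>"
  by (simp_all add: val_ring_def max_ideal_def)

lemma O_uminus: "x \<in> \<O> \<Longrightarrow> - x \<in> \<O>" and M_uminus: "x \<in> \<M> \<Longrightarrow> - x \<in> \<M>"
  by (simp_all add: val_ring_def max_ideal_def)

lemma O_add: "x \<in> \<O> \<Longrightarrow> y \<in> \<O> \<Longrightarrow> x + y \<in> \<O>"
  using ord_add[of x y] by (auto simp: val_ring_def min_def split: if_splits)

lemma M_add: "x \<in> \<M> \<Longrightarrow> y \<in> \<M> \<Longrightarrow> x + y \<in> \<M>"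
  using ord_add[of x y] by (auto simp: max_ideal_def min_def split: if_splits)

lemma O_diff: "x \<in> \<O> \<Longrightarrow> y \<in> \<O> \<Longrightarrow> x - y \<in> \<O>"
  using O_add[of x "- y"] O_uminus by simp

lemma M_diff: "x \<in> \<M> \<Longrightarrow> y \<in> \<M> \<Longrightarrow> x - y \<in> \<M>"
  using M_add[of x "- y"] M_uminus by simp

lemma O_mult: "x \<in> \<O> \<Longrightarrow> y \<in> \<O> \<Longrightarrow> x * y \<in> \<O>"
  by (cases "ord x"; cases "ord y") (auto simp: val_ring_def ord_mult)

lemma M_mult: "x \<in> \<M> \<Longrightarrow> y \<in> \<O> \<Longrightarrow> x * y \<in> \<M>"
  by (cases "ord x"; cases "ord y") (auto simp: val_ring_def max_ideal_def ord_mult add_pos_nonneg)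

lemma M_mult': "x \<in> \<O> \<Longrightarrow> y \<in> \<M> \<Longrightarrow> x * y \<in> \<M>"
  using M_mult[of y x] by (simp add: mult.commute)

lemma M_O: "x \<in> \<M> \<Longrightarrow> x \<in> \<O>"
  by (auto simp: val_ring_def max_ideal_def)

lemma O_power: "x \<in> \<O> \<Longrightarrow> x ^ n \<in> \<O>"
  by (induction n) (auto intro: O_mult)

lemma O_sum: "(\<And>i. i \<in> I \<Longrightarrow> f i \<in> \<O>) \<Longrightarrow> sum f I \<in> \<O>"
  by (induction I rule: infinite_finite_induct) (auto intro: O_add)

lemma M_sum: "(\<And>i. i \<in> I \<Longrightarrow> f i \<in> \<M>) \<Longrightarrow> sum f I \<in> \<M>"
  by (induction I rule: infinite_finite_induct) (auto intro: M_add)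

lemma O_of_nat: "of_nat n \<in> \<O>"
  by (induction n) (auto intro: O_add)

lemma O_or_inverse: "x \<in> \<O> \<or> inverse x \<in> \<M>"
proof (cases "x = 0")
  case False
  then obtain g h where gh: "ord x = Fin g" "ord (inverse x) = Fin h"
    using ord_nonzero[of x] ord_nonzero[of "inverse x"] by auto
  have "ord (x * inverse x) = ord x + ord (inverse x)" by (rule ord_mult)
  with False gh have "g + h = 0" by simp
  then have "h = - g" by (simp add: eq_neg_iff_add_eq_0 add.commute)
  with gh show ?thesis by (auto simp: val_ring_def max_ideal_def)
qed simp

lemma O_inverse: "x \<in> \<O> \<Longrightarrow> x \<notin> \<M> \<Longrightarrow> inverse x \<in> \<O>"
  using O_or_inverse[of "inverse x"] by (metis inverse_inverse_eq)

lemma unit_1_plus: "m \<in> \<M> \<Longrightarrow> 1 + m \<in> \<O> \<and> inverse (1 + m) \<in> \<O> \<and> 1 + m \<noteq> 0"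
proof -
  assume m: "m \<in> \<M>"
  then have 1: "1 + m \<in> \<O>" by (intro O_add M_O O_1)
  have "1 + m \<notin> \<M>" using M_diff[of "1 + m" m] m by (metis M_1 add_diff_cancel_right')
  with 1 O_inverse[of "1 + m"] show ?thesis by auto
qed

lemma vle_refl [simp]: "x \<preceq> x"
  unfolding vle_def by (rule bexI[of _ 1]) auto

lemma vle_trans: "x \<preceq> y \<Longrightarrow> y \<preceq> z \<Longrightarrow> x \<preceq> z"
  unfolding vle_def by (metis O_mult mult.assoc)

lemma vle_vlt_trans: "x \<preceq> y \<Longrightarrow> y \<prec> z \<Longrightarrow> x \<prec> z"
  unfolding vle_def vlt_def by (metis M_mult' mult.assoc)

lemma vlt_vle_trans: "x \<prec> y \<Longrightarrow> y \<preceq> z \<Longrightarrow> x \<prec> z"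
  unfolding vle_def vlt_def by (metis M_mult mult.assoc)

lemma vlt_vle: "x \<prec> y \<Longrightarrow> x \<preceq> y"
  unfolding vle_def vlt_def using M_O by blast

lemma vle_total: "x \<preceq> y \<or> y \<prec> x"
proof (cases "x = 0 \<or> y = 0")
  case True
  then show ?thesis unfolding vle_def vlt_def by (auto intro: bexI[of _ 0])
next
  case False
  then have "y = x * (y / x)" "x = y * inverse (y / x)" by auto
  then show ?thesis using O_or_inverse[of "y / x"] unfolding vle_def vlt_def by blast
qed

lemma vlt_irrefl: "x \<prec> x \<Longrightarrow> x = 0"
  unfolding vlt_def by auto

lemma vle_zero [simp]: "x \<preceq> 0" and vlt_zero [simp]: "x \<prec> 0"
  unfolding vle_def vlt_def by (metis O_0 mult_zero_right, metis M_0 mult_zero_right)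

lemma zero_vle [simp]: "0 \<preceq> x \<longleftrightarrow> x = 0" and zero_vlt [simp]: "0 \<prec> x \<longleftrightarrow> x = 0"
  unfolding vle_def vlt_def by (metis O_0 mult_zero_left, metis M_0 mult_zero_left)

lemma vle_mult: "a \<preceq> b \<Longrightarrow> c \<preceq> d \<Longrightarrow> a * c \<preceq> b * d"
  unfolding vle_def
proof (elim bexE)
  fix u v assume "u \<in> \<O>" "v \<in> \<O>" "b = a * u" "d = c * v"
  then show "\<exists>u\<in>\<O>. b * d = a * c * u" by (intro bexI[of _ "u * v"] O_mult) auto
qed

lemma vlt_mult: "a \<prec> b \<Longrightarrow> c \<preceq> d \<Longrightarrow> a * c \<prec> b * d"
  unfolding vle_def vlt_def
proof (elim bexE)
  fix u v assume "u \<in> \<M>" "v \<in> \<O>" "b = a * u" "d = c * v"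
  then show "\<exists>u\<in>\<M>. b * d = a * c * u" by (intro bexI[of _ "u * v"] M_mult) auto
qed

lemma vle_cancel: "c \<noteq> 0 \<Longrightarrow> c * a \<preceq> c * b \<longleftrightarrow> a \<preceq> b"
  unfolding vle_def by auto

lemma vlt_cancel: "c \<noteq> 0 \<Longrightarrow> c * a \<prec> c * b \<longleftrightarrow> a \<prec> b"
  unfolding vlt_def by auto

lemma vle_O: "u \<in> \<O> \<Longrightarrow> a \<preceq> a * u"
  unfolding vle_def by auto

lemma vle_O': "u \<in> \<O> \<Longrightarrow> a \<preceq> u * a"
  unfolding vle_def by (auto simp: mult.commute)

lemma vle_add: "a \<preceq> b \<Longrightarrow> a \<preceq> c \<Longrightarrow> a \<preceq> b + c"
  unfolding vle_def by (metis O_add distrib_left)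

lemma vle_uminus: "a \<preceq> b \<Longrightarrow> a \<preceq> - b"
  unfolding vle_def by (metis O_uminus mult_minus_right)

lemma vle_sum: "(\<And>i. i \<in> I \<Longrightarrow> a \<preceq> f i) \<Longrightarrow> a \<preceq> sum f I"
  by (induction I rule: infinite_finite_induct) (auto intro: vle_add)

lemma vlt_add: "a \<prec> b \<Longrightarrow> a \<prec> c \<Longrightarrow> a \<prec> b + c"
  unfolding vlt_def by (metis M_add distrib_left)

lemma vlt_uminus: "a \<prec> b \<Longrightarrow> a \<prec> - b"
  unfolding vlt_def by (metis M_uminus mult_minus_right)

lemma vlt_sum: "(\<And>i. i \<in> I \<Longrightarrow> a \<prec> f i) \<Longrightarrow> a \<prec> sum f I"
  by (induction I rule: infinite_finite_induct) (auto intro: vlt_add)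

lemma ord_le_iff: "ord x \<le> ord y \<longleftrightarrow> x \<preceq> y"
proof (cases "x = 0")
  case True
  then show ?thesis using ord_nonzero[of y] by (cases "y = 0") auto
next
  case False
  then have y: "ord y = ord x + ord (y / x)" using ord_mult[of x "y / x"] by simp
  obtain g where g: "ord x = Fin g" using False ord_nonzero by blast
  have "x \<preceq> y \<longleftrightarrow> y / x \<in> \<O>" using False unfolding vle_def by (auto intro!: bexI[of _ "y / x"])
  also have "\<dots> \<longleftrightarrow> ord x \<le> ord y" using g y by (cases "ord (y / x)") (auto simp: val_ring_def)
  finally show ?thesis by simp
qed

lemma ord_less_iff: "ord x < ord y \<longleftrightarrow> x \<noteq> 0 \<and> x \<prec> y"
proof -
  have "ord x < ord y \<longleftrightarrow> \<not> y \<preceq> x" using ord_le_iff[of y x] by (simp add: not_le[symmetric])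
  also have "\<dots> \<longleftrightarrow> x \<noteq> 0 \<and> x \<prec> y"
  proof
    assume n: "\<not> y \<preceq> x"
    then have "x \<noteq> 0" by auto
    with n show "x \<noteq> 0 \<and> x \<prec> y" using vle_total[of y x] by blast
  next
    assume x: "x \<noteq> 0 \<and> x \<prec> y"
    show "\<not> y \<preceq> x"
    proof
      assume "y \<preceq> x"
      then have "y = 0" using x vle_vlt_trans vlt_irrefl by blast
      with \<open>y \<preceq> x\<close> x show False by simp
    qed
  qed
  finally show ?thesis .
qed

section \<open>Leading-term classes\<close>

text \<open>The elements \<open>1 + n m\<close> with \<open>m\<close> in \<open>\<M>\<close> are
  units whose inverses have the same form, so two cosets coincide as soon as one contains a
  representative of the other. From here on an equality of classes is an estimate on a
  difference.\<close>

lemma rv_eq_iff: "rv ord n x = rv ord n y \<longleftrightarrow> of_nat n * x \<prec> y - x"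
proof
  assume "rv ord n x = rv ord n y"
  moreover have "y \<in> rv ord n y" unfolding rv_def by (rule image_eqI[of _ _ 0]) auto
  ultimately obtain m where "m \<in> \<M>" "y = x * (1 + of_nat n * m)" unfolding rv_def by auto
  then show "of_nat n * x \<prec> y - x" unfolding vlt_def by (intro bexI[of _ m]) (auto simp: algebra_simps)
next
  assume "of_nat n * x \<prec> y - x"
  then obtain m where m: "m \<in> \<M>" "y - x = of_nat n * x * m" unfolding vlt_def by auto
  then have y: "y = x * (1 + of_nat n * m)" by (simp add: algebra_simps)
  have "of_nat n * m \<in> \<M>" using m O_of_nat by (auto intro: M_mult')
  then have u: "1 + of_nat n * m \<noteq> 0" "inverse (1 + of_nat n * m) \<in> \<O>" "1 + of_nat n * m \<in> \<O>"
    using unit_1_plus by auto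
  show "rv ord n x = rv ord n y"
  proof (rule set_eqI, rule iffI)
    fix w assume "w \<in> rv ord n y"
    then obtain m' where m': "m' \<in> \<M>" "w = y * (1 + of_nat n * m')" unfolding rv_def by auto
    have "w = x * (1 + of_nat n * (m + (1 + of_nat n * m) * m'))"
      using m' y by (simp add: algebra_simps)
    moreover have "m + (1 + of_nat n * m) * m' \<in> \<M>" using m m' u by (intro M_add M_mult') auto
    ultimately show "w \<in> rv ord n x" unfolding rv_def by auto
  next
    fix w assume "w \<in> rv ord n x"
    then obtain m' where m': "m' \<in> \<M>" "w = x * (1 + of_nat n * m')" unfolding rv_def by auto
    have "(1 + of_nat n * m) * (1 + of_nat n * ((m' - m) * inverse (1 + of_nat n * m))) =
       1 + of_nat n * m'" using u(1) by (simp add: divide_simps) (simp add: algebra_simps)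
    then have "w = y * (1 + of_nat n * ((m' - m) * inverse (1 + of_nat n * m)))"
      using m' y by (simp add: mult.assoc)
    moreover have "(m' - m) * inverse (1 + of_nat n * m) \<in> \<M>" using m m' u by (intro M_diff M_mult) auto
    ultimately show "w \<in> rv ord n y" unfolding rv_def by blast
  qed
qed

lemma rv_eq_0_iff [simp]: "rv ord n x = rv ord n 0 \<longleftrightarrow> x = 0" "rv ord n 0 = rv ord n x \<longleftrightarrow> x = 0"
  using rv_eq_iff[of n 0 x] by auto

lemma rv_mult: "rv ord n x = rv ord n x' \<Longrightarrow> rv ord n y = rv ord n y' \<Longrightarrow>
    rv ord n (x * y) = rv ord n (x' * y')"
proof -
  assume "rv ord n x = rv ord n x'" "rv ord n y = rv ord n y'"
  then obtain a b where a: "a \<in> \<M>" "x' - x = of_nat n * x * a" and b: "b \<in> \<M>" "y' - y = of_nat n * y * b"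
    unfolding rv_eq_iff vlt_def by auto
  have "x' = x + of_nat n * x * a" "y' = y + of_nat n * y * b" using a b by (auto simp: algebra_simps)
  then have "x' * y' - x * y = of_nat n * (x * y) * (a + b + of_nat n * a * b)"
    by (simp add: algebra_simps)
  moreover have "a + b + of_nat n * a * b \<in> \<M>" using a b O_of_nat
    by (intro M_add) (auto intro: M_mult' M_mult O_mult M_O)
  ultimately show ?thesis unfolding rv_eq_iff vlt_def by auto
qed

lemma rv_power: "rv ord n x = rv ord n x' \<Longrightarrow> rv ord n (x ^ i) = rv ord n (x' ^ i)"
proof (induction i)
  case (Suc i)
  then show ?case unfolding power_Suc by (intro rv_mult)
qed simp

text \<open>Its use is to strip a factor of known class: the factorials in
  \<open>taylor_coeff\<close> and the powers of a leading coefficient left by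
  pseudo-division.\<close>

lemma rv_mult_cancel: "a \<noteq> 0 \<Longrightarrow> rv ord n a = rv ord n a' \<Longrightarrow> rv ord n (a * x) = rv ord n (a' * x') \<Longrightarrow>
   rv ord n x = rv ord n x'"
proof -
  assume a: "a \<noteq> 0" and 1: "rv ord n a = rv ord n a'" and 2: "rv ord n (a * x) = rv ord n (a' * x')"
  have a': "a' \<noteq> 0" using a 1 by (metis rv_eq_0_iff(1))
  have "rv ord n (a * x') = rv ord n (a' * x')" using 1 by (rule rv_mult) simp
  with 2 have "rv ord n (a * x) = rv ord n (a * x')" by simp
  then have "a * (of_nat n * x) \<prec> a * (x' - x)" unfolding rv_eq_iff by (simp add: algebra_simps)
  then show ?thesis using a by (simp add: vlt_cancel rv_eq_iff)
qed

lemma rv_dvd: "n dvd N \<Longrightarrow> rv ord N x = rv ord N y \<Longrightarrow> rv ord n x = rv ord n y"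
proof -
  assume "n dvd N" "rv ord N x = rv ord N y"
  then obtain k where "N = n * k" by auto
  moreover have "of_nat n * x \<preceq> of_nat n * x * of_nat k" by (rule vle_O) (rule O_of_nat)
  ultimately show ?thesis using \<open>rv ord N x = rv ord N y\<close> unfolding rv_eq_iff
    by (auto intro: vle_vlt_trans simp: mult_ac)
qed

text \<open>Nontriviality of the valuation enters here and acts through
  \<open>rv_locally_constant\<close>: small nonzero elements are what keeps points from being
  open.\<close>

lemma nontrivial: "\<exists>\<pi>\<in>\<M>. \<pi> \<noteq> 0"
proof -
  obtain x where x: "x \<noteq> 0" "ord x \<noteq> Fin 0" using vf by (auto simp: valued_field_def)
  show ?thesis
  proof (cases "x \<in> \<O>")
    case True
    then have "x \<in> \<M>" using x by (auto simp: val_ring_def max_ideal_def)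
    then show ?thesis using x by auto
  next
    case False
    then show ?thesis using O_or_inverse[of x] x by (auto intro: bexI[of _ "inverse x"])
  qed
qed

section \<open>Integral polynomials, Taylor expansion, Hensel's lemma with a non-unit
  derivative\<close>

definition ipoly :: "'k poly \<Rightarrow> bool" where
  "ipoly p \<longleftrightarrow> (\<forall>i. coeff p i \<in> \<O>)"

lemma ipoly_poly: "ipoly p \<Longrightarrow> x \<in> \<O> \<Longrightarrow> poly p x \<in> \<O>"
  unfolding poly_altdef by (intro O_sum O_mult O_power) (auto simp: ipoly_def)

lemma ipoly_0 [simp]: "ipoly 0"
  by (simp add: ipoly_def)

lemma ipoly_add: "ipoly p \<Longrightarrow> ipoly q \<Longrightarrow> ipoly (p + q)"
  by (auto simp: ipoly_def intro: O_add)

lemma ipoly_smult: "c \<in> \<O> \<Longrightarrow> ipoly p \<Longrightarrow> ipoly (smult c p)"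
  by (auto simp: ipoly_def intro: O_mult)

lemma ipoly_mult: "ipoly p \<Longrightarrow> ipoly q \<Longrightarrow> ipoly (p * q)"
  by (auto simp: ipoly_def coeff_mult intro!: O_sum O_mult)

lemma ipoly_pCons: "ipoly (pCons a p) \<longleftrightarrow> a \<in> \<O> \<and> ipoly p"
  unfolding ipoly_def
  by (metis coeff_pCons_0 coeff_pCons_Suc nat.exhaust)

lemma ipoly_pderiv: "ipoly p \<Longrightarrow> ipoly (pderiv p)"
  by (auto simp: ipoly_def coeff_pderiv simp del: of_nat_Suc intro!: O_mult O_of_nat)

lemma ipoly_higher_pderiv: "ipoly p \<Longrightarrow> ipoly ((pderiv ^^ k) p)"
  by (induction k) (auto intro: ipoly_pderiv)

lemma ipoly_monom: "c \<in> \<O> \<Longrightarrow> ipoly (monom c i)"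
  by (auto simp: ipoly_def)

lemma ipoly_sum: "(\<And>i. i \<in> I \<Longrightarrow> ipoly (f i)) \<Longrightarrow> ipoly (sum f I)"
  by (induction I rule: infinite_finite_induct) (auto intro: ipoly_add)

lemma ipoly_pcompose: "ipoly p \<Longrightarrow> ipoly q \<Longrightarrow> ipoly (pcompose p q)"
  by (induction p) (auto simp: pcompose_pCons ipoly_pCons intro!: ipoly_add ipoly_mult)

lemma poly_altdef_le: "degree p \<le> d \<Longrightarrow> poly p x = (\<Sum>i\<le>d. coeff p i * x ^ i)"
  for p :: "'k poly"
  unfolding poly_altdef by (rule sum.mono_neutral_left) (auto simp: coeff_eq_0)

text \<open>Translation commutes with differentiation, and the constant coefficient of a translate
  is a value. The factorial stays on the left since it need not be a unit of the valuation
  ring.\<close>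

lemma taylor_coeff: "fact i * coeff (pcompose p [:c, 1:]) i = poly ((pderiv ^^ i) p) c"
  for p :: "'k poly"
proof -
  have "(pderiv ^^ i) (pcompose p [:c, 1:]) = pcompose ((pderiv ^^ i) p) [:c, 1:]"
    by (induction i) (auto simp: pderiv_pcompose pderiv_pCons)
  then have "coeff ((pderiv ^^ i) (pcompose p [:c, 1:])) 0 = poly ((pderiv ^^ i) p) c"
    by (simp add: poly_pcompose flip: poly_0_coeff_0)
  then show ?thesis by (simp add: coeff_higher_pderiv pochhammer_fact)
qed

lemma taylor2:
  assumes g: "ipoly g" and a: "a \<in> \<O>" and b: "b \<in> \<O>"
  shows "\<exists>k\<in>\<O>. poly g b = poly g a + (b - a) * poly (pderiv g) a + (b - a)\<^sup>2 * k"
proof -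
  let ?h = "pcompose g [:a, 1:]"
  have h: "ipoly ?h" using g a by (intro ipoly_pcompose) (auto simp: ipoly_pCons)
  obtain c0 c1 r where r: "?h = pCons c0 (pCons c1 r)" by (metis pCons_cases)
  have "ipoly r" using h unfolding r by (simp add: ipoly_pCons)
  then have k: "poly r (b - a) \<in> \<O>" using a b by (intro ipoly_poly O_diff)
  have "poly g b = poly ?h (b - a)" by (simp add: poly_pcompose)
  also have "\<dots> = c0 + (b - a) * c1 + (b - a)\<^sup>2 * poly r (b - a)"
    unfolding r by (simp add: algebra_simps power2_eq_square)
  also have "c0 = poly g a" using taylor_coeff[of 0 g a] r by simp
  also have "c1 = poly (pderiv g) a" using taylor_coeff[of 1 g a] r by simp
  finally show ?thesis using k by blast
qed

lemma taylor1:
  assumes g: "ipoly g" and a: "a \<in> \<O>" and b: "b \<in> \<O>"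
  shows "\<exists>k\<in>\<O>. poly g b = poly g a + (b - a) * k"
proof -
  obtain k where k: "k \<in> \<O>" "poly g b = poly g a + (b - a) * poly (pderiv g) a + (b - a)\<^sup>2 * k"
    using taylor2[OF assms] by auto
  then have "poly g b = poly g a + (b - a) * (poly (pderiv g) a + (b - a) * k)"
    by (simp add: algebra_simps power2_eq_square)
  moreover have "poly (pderiv g) a + (b - a) * k \<in> \<O>"
    using k g a b by (intro O_add O_mult O_diff ipoly_poly ipoly_pderiv)
  ultimately show ?thesis by blast
qed

text \<open>Writing \<open>g (u + \<delta> \<mu> T) = \<delta>\<^sup>2 \<mu> (1 + T + \<mu> T\<^sup>2 (\<dots>))\<close> and passing to the reversed polynomial
  makes the last factor monic with a simple residual root at \<open>-1\<close>.\<close>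

lemma newton_root:
  assumes g: "ipoly g" and u: "u \<in> \<O>" and d: "poly (pderiv g) u \<noteq> 0"
    and m: "\<mu> \<in> \<M>" "poly g u = (poly (pderiv g) u)\<^sup>2 * \<mu>"
  shows "\<exists>w\<in>\<O>. poly g (u + poly (pderiv g) u * \<mu> * w) = 0"
proof -
  define \<delta> where "\<delta> = poly (pderiv g) u"
  let ?h = "pcompose g [:u, 1:]"
  have h: "ipoly ?h" using g u by (intro ipoly_pcompose) (auto simp: ipoly_pCons)
  obtain c0 c1 r where r: "?h = pCons c0 (pCons c1 r)" by (metis pCons_cases)
  have ir: "ipoly r" using h unfolding r by (simp add: ipoly_pCons)
  have c0: "c0 = \<delta>\<^sup>2 * \<mu>" using taylor_coeff[of 0 g u] r m by (simp add: \<delta>_def)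
  have c1: "c1 = \<delta>" using taylor_coeff[of 1 g u] r by (simp add: \<delta>_def)
  have \<delta>: "\<delta> \<in> \<O>" unfolding \<delta>_def using g u by (intro ipoly_poly ipoly_pderiv)
  define e where "e = degree r"
  \<comment> \<open>\<open>R\<close> is \<open>T^e r(\<delta> \<mu> / T)\<close>, the reversed
    higher part of the expansion, so that \<open>P\<close> is
    \<open>T^(e+2) (1 + 1/T + \<mu> T^(-2) r(\<delta> \<mu> / T))\<close>.\<close>
  define R where "R = (\<Sum>i\<le>e. monom (coeff r i * \<delta> ^ i * \<mu> ^ i) (e - i))"
  define P where "P = monom 1 (e + 1) * [:1, 1:] + smult \<mu> R"
  have iR: "ipoly R" unfolding R_def
    using ir \<delta> m by (intro ipoly_sum ipoly_monom O_mult O_power) (auto simp: ipoly_def M_O)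
  have dR: "degree R \<le> e" unfolding R_def by (intro degree_sum_le) (auto intro: order_trans[OF degree_monom_le])
  have mon: "monom 1 (e + 1) * [:1, 1:] = monom (1::'k) (e+2) + monom 1 (e+1)"
    by (rule poly_eqI) (auto simp: coeff_monom_mult coeff_pCons split: nat.splits)
  have deg: "degree P = e + 2"
  proof (rule antisym)
    show "degree P \<le> e + 2" unfolding P_def mon using dR
      by (intro degree_add_le) (auto intro: order_trans[OF degree_monom_le] order_trans[OF degree_smult_le])
    have "coeff P (e + 2) = 1" unfolding P_def mon using dR by (simp add: coeff_eq_0)
    then show "e + 2 \<le> degree P" by (intro le_degree) simp
  qed
  have lead: "lead_coeff P = 1" unfolding deg unfolding P_def mon using dR by (simp add: coeff_eq_0)
  have iP: "ipoly P" unfolding P_def using iR m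
    by (intro ipoly_add ipoly_mult ipoly_monom ipoly_smult) (auto simp: ipoly_pCons M_O)
  have O1: "-1 \<in> \<O>" using O_uminus[OF O_1] .
  have P1: "poly P (-1) \<in> \<M>" unfolding P_def using m iR O1 by (auto intro!: M_mult ipoly_poly)
  have dP: "poly (pderiv P) (-1) = (-1) ^ (e+1) + \<mu> * poly (pderiv R) (-1)"
    unfolding P_def by (simp add: pderiv_add pderiv_mult pderiv_smult pderiv_pCons poly_monom)
  have "poly (pderiv P) (-1) \<notin> \<M>"
  proof
    assume "poly (pderiv P) (-1) \<in> \<M>"
    moreover have "\<mu> * poly (pderiv R) (-1) \<in> \<M>" using m iR O1 by (intro M_mult ipoly_poly ipoly_pderiv)
    ultimately have "(-1) ^ (e+1) \<in> \<M>" unfolding dP using M_diff by fastforce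
    then show False using M_uminus[of "-1"] by (cases "even (e+1)") auto
  qed
  with lead iP P1 O1 obtain s where s: "s \<in> \<O>" "poly P s = 0" "s - (-1) \<in> \<M>"
    using hens unfolding henselian_field_def ipoly_def by blast
  have "1 + - (s + 1) \<in> \<O> \<and> inverse (1 + - (s + 1)) \<in> \<O> \<and> 1 + - (s + 1) \<noteq> 0"
    using s by (intro unit_1_plus M_uminus) simp
  then have s0: "s \<noteq> 0" "inverse s \<in> \<O>" using O_uminus[of "inverse (-s)"] by auto
  have Rs: "poly R s = s ^ e * poly r (\<delta> * \<mu> * inverse s)"
  proof -
    have "poly R s = (\<Sum>i\<le>e. s ^ e * (coeff r i * (\<delta> * \<mu> * inverse s) ^ i))"
      unfolding R_def poly_sum poly_monom
      by (rule sum.cong) (use s0 in \<open>auto simp: power_mult_distrib power_inverse power_diff field_simps\<close>)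
    then show ?thesis by (simp add: poly_altdef e_def sum_distrib_left)
  qed
  have "poly g (u + \<delta> * \<mu> * inverse s) = poly ?h (\<delta> * \<mu> * inverse s)" by (simp add: poly_pcompose)
  also have "\<dots> = \<delta>\<^sup>2 * \<mu> * (1 + inverse s + \<mu> * (inverse s)\<^sup>2 * poly r (\<delta> * \<mu> * inverse s))"
    unfolding r c0 c1 by (simp add: algebra_simps power2_eq_square)
  also have "s ^ (e + 2) * \<dots> = \<delta>\<^sup>2 * \<mu> * poly P s"
    unfolding P_def using s0 by (simp add: Rs poly_monom field_simps power2_eq_square)
  finally have "poly g (u + \<delta> * \<mu> * inverse s) = 0" using s s0 by simp
  then show ?thesis using s0 unfolding \<delta>_def by blast
qed

text \<open>With \<open>\<delta>\<close> the derivative at 1 and \<open>n = \<delta> w\<close>, the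
  value \<open>n^2 k\<close> at 1 is \<open>\<delta>^2 (w^2 k)\<close>, so the Newton correction
  \<open>\<delta> w^2 k v\<close> equals \<open>n (w k v)\<close> and lies in \<open>n \<M>\<close>.
  For uniqueness, the second-order expansion between two such roots is their difference times
  \<open>\<delta> (1 + m)\<close> with \<open>m\<close> in \<open>\<M>\<close>, a nonzero
  factor.\<close>

lemma hensel_root:
  assumes g: "ipoly g" and d: "poly (pderiv g) 1 \<preceq> of_nat n" and n: "n > 0"
    and m: "of_nat n ^ 2 \<prec> poly g 1"
  shows "\<exists>!v. poly g v = 0 \<and> of_nat n \<prec> v - 1"
proof (rule ex_ex1I)
  define \<delta> where "\<delta> = poly (pderiv g) 1"
  obtain w where w: "w \<in> \<O>" "of_nat n = \<delta> * w" using d unfolding vle_def \<delta>_def by auto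
  have \<delta>0: "\<delta> \<noteq> 0" using w n by auto
  obtain k where k: "k \<in> \<M>" "poly g 1 = of_nat n ^ 2 * k" using m unfolding vlt_def by auto
  have "poly g 1 = \<delta>\<^sup>2 * (w\<^sup>2 * k)" using k w by (simp add: power_mult_distrib)
  moreover have "w\<^sup>2 * k \<in> \<M>" using w k by (intro M_mult' O_power)
  ultimately obtain v where v: "v \<in> \<O>" "poly g (1 + \<delta> * (w\<^sup>2 * k) * v) = 0"
    using newton_root[OF g, of 1 "w\<^sup>2 * k"] \<delta>0 unfolding \<delta>_def by auto
  have "\<delta> * (w\<^sup>2 * k) * v = of_nat n * (w * k * v)" using w by (simp add: power2_eq_square)
  moreover have "w * k * v \<in> \<M>" using w k v by (intro M_mult M_mult')
  ultimately show "\<exists>v. poly g v = 0 \<and> of_nat n \<prec> v - 1"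
    using v(2) unfolding vlt_def by (metis add_diff_cancel_left')
  fix v1 v2 assume v: "poly g v1 = 0 \<and> of_nat n \<prec> v1 - 1" "poly g v2 = 0 \<and> of_nat n \<prec> v2 - 1"
  obtain m1 m2 where m1: "m1 \<in> \<M>" "v1 - 1 = of_nat n * m1" and m2: "m2 \<in> \<M>" "v2 - 1 = of_nat n * m2"
    using v unfolding vlt_def by auto
  have vm: "v1 = 1 + of_nat n * m1" "v2 = 1 + of_nat n * m2" using m1 m2 by (auto simp: algebra_simps)
  moreover have "m1 \<in> \<O>" "m2 \<in> \<O>" using m1 m2 M_O by auto
  ultimately have vO: "v1 \<in> \<O>" "v2 \<in> \<O>" by (auto intro!: O_add O_mult O_of_nat)
  obtain l where l: "l \<in> \<O>" "poly g v2 = poly g v1 + (v2 - v1) * poly (pderiv g) v1 + (v2 - v1)\<^sup>2 * l"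
    using taylor2[OF g vO] by auto
  obtain l' where l': "l' \<in> \<O>" "poly (pderiv g) v1 = \<delta> + (v1 - 1) * l'"
    using taylor1[OF ipoly_pderiv[OF g], of 1 v1] vO unfolding \<delta>_def by auto
  have "0 = (v2 - v1) * (poly (pderiv g) v1 + (v2 - v1) * l)"
    using l v by (simp add: algebra_simps power2_eq_square)
  also have "poly (pderiv g) v1 + (v2 - v1) * l = \<delta> * (1 + w * (m1 * l' + (m2 - m1) * l))"
    unfolding l'(2) unfolding vm using w by (simp add: algebra_simps)
  finally have 0: "(v2 - v1) * (\<delta> * (1 + w * (m1 * l' + (m2 - m1) * l))) = 0" by simp
  have "w * (m1 * l' + (m2 - m1) * l) \<in> \<M>"
    using w m1 m2 l l' by (intro M_mult' M_add M_mult M_diff)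
  then have "1 + w * (m1 * l' + (m2 - m1) * l) \<noteq> 0" using unit_1_plus by blast
  then show "v1 = v2" using 0 \<delta>0 by simp
qed

end

section \<open>Absence of cancellation\<close>

context henselian
begin

section \<open>Content of polynomials, minimal terms, Hensel's condition for some derivative\<close>

definition mpoly :: "'k poly \<Rightarrow> bool" where
  "mpoly p \<longleftrightarrow> (\<forall>i. coeff p i \<in> \<M>)"

lemma mpoly_pcompose: "mpoly p \<Longrightarrow> ipoly q \<Longrightarrow> mpoly (pcompose p q)"
proof (induction p)
  case (pCons a p)
  have a: "a \<in> \<M>" using pCons.prems unfolding mpoly_def by (metis coeff_pCons_0)
  have "mpoly p" using pCons.prems unfolding mpoly_def by (metis coeff_pCons_Suc)
  with pCons have h: "mpoly (pcompose p q)" by simp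
  show ?case unfolding pcompose_pCons mpoly_def
  proof
    fix i
    have "coeff (q * pcompose p q) i \<in> \<M>" unfolding coeff_mult using h pCons.prems
      by (intro M_sum M_mult') (auto simp: mpoly_def ipoly_def)
    then show "coeff ([:a:] + q * pcompose p q) i \<in> \<M>" using a
      by (auto intro!: M_add simp: coeff_pCons split: nat.split)
  qed
qed (simp add: mpoly_def)

text \<open>The translations by 1 and by -1 are inverse to each other, and both preserve the
  polynomials with all coefficients in \<open>\<M>\<close>.\<close>

lemma unit_coeff_shift:
  assumes "coeff g l \<notin> \<M>"
  shows "\<exists>m. coeff (pcompose g [:1, 1:]) m \<notin> \<M>"
proof (rule ccontr)
  assume "\<not> ?thesis"
  then have "mpoly (pcompose g [:1, 1:])" by (simp add: mpoly_def)
  then have "mpoly (pcompose (pcompose g [:1, 1:]) [:-1, 1:])"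
    by (rule mpoly_pcompose) (auto simp: ipoly_pCons intro: O_uminus)
  also have "pcompose (pcompose g [:1, 1:]) [:-1, 1:] = g"
    by (simp add: pcompose_assoc[symmetric] pcompose_pCons)
  finally show False using assms by (simp add: mpoly_def)
qed

lemma ex_min:
  assumes "finite I" "I \<noteq> {}"
  shows "\<exists>i\<in>I. \<forall>j\<in>I. f i \<preceq> f j"
  using assms
proof (induction I rule: finite_ne_induct)
  case (insert x F)
  then obtain i where i: "i \<in> F" "\<forall>j\<in>F. f i \<preceq> f j" by blast
  show ?case
  proof (cases "f i \<preceq> f x")
    case True
    then show ?thesis using i by blast
  next
    case False
    then have "f x \<preceq> f i" using vle_total vlt_vle by blast
    then show ?thesis using i vle_trans by (intro bexI[of _ x]) auto
  qed
qed simp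

lemma ex_max:
  assumes "finite I" "I \<noteq> {}"
  shows "\<exists>i\<in>I. \<forall>j\<in>I. f j \<preceq> f i"
  using assms
proof (induction I rule: finite_ne_induct)
  case (insert x F)
  then obtain i where i: "i \<in> F" "\<forall>j\<in>F. f j \<preceq> f i" by blast
  show ?case
  proof (cases "f x \<preceq> f i")
    case True
    then show ?thesis using i by blast
  next
    case False
    then have "f i \<preceq> f x" using vle_total vlt_vle by blast
    then show ?thesis using i vle_trans by (intro bexI[of _ x]) auto
  qed
qed simp

lemma vle_of_nat_dvd: "m dvd n \<Longrightarrow> of_nat m \<preceq> of_nat n"
  by (elim dvdE) (simp add: vle_O O_of_nat)

lemma pochhammer_dvd_fact:
  "k + i \<le> d \<Longrightarrow> pochhammer (Suc i) k dvd (fact d :: nat)"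
proof -
  assume a: "k + i \<le> d"
  have "(fact (i + k) :: nat) = fact i * pochhammer (Suc i) k"
    using pochhammer_product[of i "i + k" "1::nat"] unfolding pochhammer_fact by simp
  moreover have "(fact (i + k) :: nat) dvd fact d" using a by (intro fact_dvd) simp
  ultimately show ?thesis by (metis dvd_mult_right)
qed

text \<open>The bound on the derivative of order \<open>k\<close> of a polynomial of degree at most \<open>d\<close> is
  \<open>nu d (d - k)\<close>: the condition of Hensel's lemma relates consecutive derivatives through a square,
  and the factor \<open>fact d\<close> absorbs the loss of content under differentiation.\<close>

primrec nu :: "nat \<Rightarrow> nat \<Rightarrow> nat" where
  "nu d 0 = fact d"
| "nu d (Suc j) = (nu d j)\<^sup>2 * fact d"

lemma nu_pos [simp]: "nu d j > 0"
  by (induction j) auto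

lemma fact_dvd_nu: "fact d dvd nu d j"
  by (cases j) auto

text \<open>If \<open>m\<close> is the index of a unit Taylor coefficient at 1, the derivative of
  order \<open>m\<close> has a value dividing \<open>d!\<close>, hence within its bound, while order
  0 exceeds its bound. Let \<open>Suc k\<close> be the least order whose value is within its bound.
  The derivative of order \<open>k\<close> then has a small value at 1 and a slope that is not
  small, as Hensel's lemma asks.\<close>

lemma step_normalized:
  assumes g: "ipoly g" and deg: "degree g \<le> d" and l: "coeff g l \<notin> \<M>"
    and big: "\<not> poly g 1 \<preceq> of_nat (nu d d)"
  shows "\<exists>k<d. \<exists>i\<^sub>0>0. coeff ((pderiv ^^ k) g) i\<^sub>0 \<noteq> 0 \<and>
    (\<forall>i. coeff ((pderiv ^^ k) g) i\<^sub>0 \<preceq> coeff ((pderiv ^^ k) g) i) \<and>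
    of_nat (nu d (d - Suc k)) ^ 2 * coeff ((pderiv ^^ k) g) i\<^sub>0 \<prec> poly ((pderiv ^^ k) g) 1 \<and>
    poly (pderiv ((pderiv ^^ k) g)) 1 \<preceq> of_nat (nu d (d - Suc k)) * coeff ((pderiv ^^ k) g) i\<^sub>0"
proof -
  obtain m where m: "coeff (pcompose g [:1, 1:]) m \<notin> \<M>" using unit_coeff_shift[OF l] by blast
  define e where "e = coeff (pcompose g [:1, 1:]) m"
  have "degree (pcompose g [:1, 1:]) = degree g" by (simp add: degree_pcompose)
  then have md: "m \<le> d" using m deg by (metis M_0 le_degree le_trans)
  have "ipoly (pcompose g [:1, 1:])" using g by (intro ipoly_pcompose) (auto simp: ipoly_pCons)
  then have e: "e \<in> \<O>" "inverse e \<in> \<O>" "e \<noteq> 0" using O_inverse m unfolding e_def ipoly_def by auto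
  have em: "poly ((pderiv ^^ m) g) 1 = fact m * e" using taylor_coeff[of m g 1] by (simp add: e_def)
  define P where "P j \<longleftrightarrow> poly ((pderiv ^^ j) g) 1 \<preceq> of_nat (nu d (d - j))" for j
  have Pm: "P m"
  proof -
    have "fact m * e \<preceq> fact m * e * inverse e" using e by (intro vle_O)
    then have "fact m * e \<preceq> fact m" using e by (simp add: mult.assoc)
    moreover have "(fact m :: nat) dvd nu d (d - m)"
      using md fact_dvd dvd_trans fact_dvd_nu by blast
    then have "of_nat (fact m) \<preceq> of_nat (nu d (d - m))" by (rule vle_of_nat_dvd)
    ultimately show ?thesis unfolding P_def em of_nat_fact by (rule vle_trans)
  qed
  define j where "j = (LEAST j. P j)"
  have Pj: "P j" and jm: "j \<le> m" unfolding j_def using Pm by (auto intro: LeastI Least_le)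
  have "\<not> P 0" using big by (simp add: P_def)
  then obtain k where k: "j = Suc k" using Pj by (cases j) auto
  then have nPk: "\<not> P k" using not_less_Least[of k P] unfolding j_def[symmetric] by simp
  have kd: "k < d" and km: "k < m" using k jm md by auto
  let ?G = "(pderiv ^^ k) g"
  have iG: "ipoly ?G" using g by (rule ipoly_higher_pderiv)
  \<comment> \<open>The Taylor coefficient of index \<open>m\<close> is a combination, with binomial
    coefficients, of the coefficients of index at least \<open>m\<close>. The index found here
    exceeds \<open>k\<close>, so after \<open>k\<close> differentiations it still sits at a positive
    position.\<close>
  have "\<exists>i\<ge>m. coeff g i \<notin> \<M>"
  proof (rule ccontr)
    assume n: "\<not> ?thesis"
    have "poly ((pderiv ^^ m) g) 1 = (\<Sum>i\<le>d. coeff ((pderiv ^^ m) g) i * 1 ^ i)"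
      using deg by (intro poly_altdef_le) (simp add: degree_higher_pderiv)
    also have "\<dots> = (\<Sum>i\<le>d. fact m * (of_nat ((i + m) choose m) * coeff g (i + m)))"
      by (intro sum.cong)
        (simp_all add: coeff_higher_pderiv binomial_gbinomial gbinomial_pochhammer' add_ac)
    also have "\<dots> = fact m * (\<Sum>i\<le>d. of_nat ((i + m) choose m) * coeff g (i + m))"
      by (simp add: sum_distrib_left)
    finally have "e = (\<Sum>i\<le>d. of_nat ((i + m) choose m) * coeff g (i + m))" unfolding em by simp
    also have "\<dots> \<in> \<M>" using n by (intro M_sum M_mult' O_of_nat) auto
    finally show False using m by (simp add: e_def)
  qed
  then obtain i where i: "i \<ge> m" "coeff g i \<notin> \<M>" by blast
  have id: "i \<le> d" using i deg by (metis M_0 le_degree le_trans)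
  have cG: "coeff ?G (i - k) \<preceq> fact d"
  proof -
    define P where "P = (of_nat (pochhammer (Suc (i - k)) k) :: 'k)"
    have "P * coeff g i \<preceq> P * coeff g i * inverse (coeff g i)"
      using i g O_inverse by (intro vle_O) (auto simp: ipoly_def)
    moreover have "coeff g i \<noteq> 0" using i by auto
    ultimately have "P * coeff g i \<preceq> P" by (simp add: mult.assoc)
    also have "P \<preceq> of_nat (fact d)"
      unfolding P_def using i km id by (intro vle_of_nat_dvd pochhammer_dvd_fact) auto
    finally (vle_trans) have "P * coeff g i \<preceq> fact d" by simp
    moreover have "coeff ?G (i - k) = P * coeff g i"
      using i km by (simp add: P_def coeff_higher_pderiv pochhammer_of_nat[symmetric])
    ultimately show ?thesis by simp
  qed
  \<comment> \<open>Only positive indices compete, as Hensel's condition prescribes. That the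
    constant coefficient does not undercut the minimum is derived below from the smallness of the
    value at 1.\<close>
  obtain i0 where i0: "i0 \<in> {1..d}" "\<forall>j\<in>{1..d}. coeff ?G i0 \<preceq> coeff ?G j"
    using ex_min[of "{1..d}" "coeff ?G"] kd by auto
  have "coeff ?G i0 \<preceq> coeff ?G (i - k)" using i km id i0 by (intro i0(2)[rule_format]) auto
  with cG have c0: "coeff ?G i0 \<preceq> fact d" using vle_trans by blast
  then have nz: "coeff ?G i0 \<noteq> 0" by auto
  define n where "n = nu d (d - Suc k)"
  have dk: "d - k = Suc (d - Suc k)" using kd by simp
  \<comment> \<open>By its recursion \<open>nu d (d - k)\<close> is \<open>n^2 * fact d\<close>; the
    factorial pays for \<open>coeff ?G i0\<close>, of which only divisibility of
    \<open>fact d\<close> is known.\<close>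
  have "of_nat (nu d (d - k)) \<prec> poly ?G 1" using nPk vle_total unfolding P_def by blast
  then have s: "of_nat n ^ 2 * fact d \<prec> poly ?G 1" by (simp add: dk n_def)
  have "of_nat n ^ 2 * coeff ?G i0 \<preceq> of_nat n ^ 2 * fact d" using c0 by (intro vle_mult) auto
  with s have 1: "of_nat n ^ 2 * coeff ?G i0 \<prec> poly ?G 1" using vle_vlt_trans by blast
  have high: "coeff ?G i0 \<preceq> coeff ?G i" if "i > 0" for i
  proof (cases "i \<le> d")
    case True
    then show ?thesis using i0 that by auto
  next
    case False
    then have "coeff ?G i = 0" using deg by (intro coeff_eq_0) (simp add: degree_higher_pderiv)
    then show ?thesis by simp
  qed
  have all: "coeff ?G i0 \<preceq> coeff ?G i" for i
  proof (cases "i = 0")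
    case True
    have "poly ?G 1 = (\<Sum>i\<le>d. coeff ?G i * 1 ^ i)"
      using deg by (intro poly_altdef_le) (simp add: degree_higher_pderiv)
    also have "\<dots> = coeff ?G 0 + (\<Sum>i\<in>{1..d}. coeff ?G i)"
      by (simp add: sum.atLeast_Suc_atMost atMost_atLeast0)
    finally have "coeff ?G 0 = poly ?G 1 + - (\<Sum>i\<in>{1..d}. coeff ?G i)" by simp
    moreover have "coeff ?G i0 \<preceq> of_nat n ^ 2 * coeff ?G i0" by (intro vle_O' O_power O_of_nat)
    then have "coeff ?G i0 \<preceq> poly ?G 1" using 1 vle_vlt_trans vlt_vle by blast
    then have "coeff ?G i0 \<preceq> poly ?G 1 + - (\<Sum>i\<in>{1..d}. coeff ?G i)"
      using i0 by (intro vle_add vle_uminus vle_sum) auto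
    ultimately show ?thesis using True by metis
  qed (use high in auto)
  have "poly (pderiv ?G) 1 \<preceq> of_nat n" using Pj unfolding P_def k n_def by simp
  also have "of_nat n \<preceq> of_nat n * coeff ?G i0" using iG by (intro vle_O) (simp add: ipoly_def)
  finally (vle_trans) have 2: "poly (pderiv ?G) 1 \<preceq> of_nat n * coeff ?G i0" .
  show ?thesis using 1 2 all nz kd i0 unfolding n_def by (intro exI[of _ k] conjI exI[of _ i0]) auto
qed

text \<open>The hypothesis in \<open>hfun\<close> for the class of \<open>z\<close>, tested at the
  representative \<open>z\<close> itself. Nonvanishing of \<open>z\<close> and of the coefficient
  makes up for \<open>\<prec>\<close> being true at 0.\<close>

definition hcond :: "nat \<Rightarrow> 'k poly \<Rightarrow> 'k \<Rightarrow> bool" where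
  "hcond n f z \<longleftrightarrow> z \<noteq> 0 \<and> (\<exists>i>0. coeff f i \<noteq> 0 \<and> (\<forall>j. coeff f i * z ^ i \<preceq> coeff f j * z ^ j) \<and>
     of_nat n ^ 2 * coeff f i * z ^ i \<prec> poly f z \<and>
     poly (pderiv f) z \<preceq> of_nat n * coeff f i * z ^ (i - 1))"

text \<open>Substituting \<open>z T\<close> and dividing by the minimal term makes the polynomial
  integral and moves the approximate root to 1, where \<open>hensel_root\<close> applies. The set
  \<open>1 + n \<M>\<close> corresponds to the class of \<open>z\<close>.\<close>

lemma hcond_root:
  assumes n: "n > 0" and h: "hcond n f z"
  shows "\<exists>!b. poly f b = 0 \<and> rv ord n b = rv ord n z"
proof -
  obtain i where z: "z \<noteq> 0" and i: "i > 0" "coeff f i \<noteq> 0"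
    and mn: "\<And>j. coeff f i * z ^ i \<preceq> coeff f j * z ^ j"
    and f: "of_nat n ^ 2 * coeff f i * z ^ i \<prec> poly f z"
    and f': "poly (pderiv f) z \<preceq> of_nat n * coeff f i * z ^ (i - 1)"
    using h unfolding hcond_def by blast
  define a where "a = coeff f i * z ^ i"
  have a: "a \<noteq> 0" using i z by (simp add: a_def)
  define F where "F = smult (1 / a) (pcompose f [:0, z:])"
  have "ipoly F" unfolding ipoly_def
  proof
    fix j
    obtain u where u: "u \<in> \<O>" "coeff f j * z ^ j = a * u" using mn[of j] unfolding a_def vle_def by auto
    have "coeff F j = u" using u a by (simp add: F_def coeff_pcompose_linear field_simps)
    with u show "coeff F j \<in> \<O>" by simp
  qed
  moreover have "a * poly (pderiv F) 1 \<preceq> a * of_nat n"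
  proof -
    have "a * poly (pderiv F) 1 = z * poly (pderiv f) z" using a
      by (simp add: F_def pderiv_smult pderiv_pcompose pderiv_pCons poly_pcompose)
    also have "\<dots> \<preceq> z * (of_nat n * coeff f i * z ^ (i - 1))" using f' by (intro vle_mult) auto
    also have "\<dots> = a * of_nat n" using i(1) by (cases i) (auto simp: a_def)
    finally show ?thesis .
  qed
  then have "poly (pderiv F) 1 \<preceq> of_nat n" using a by (simp add: vle_cancel)
  moreover have "a * of_nat n ^ 2 \<prec> a * poly F 1"
    using f a by (simp add: F_def a_def poly_pcompose mult_ac)
  then have "of_nat n ^ 2 \<prec> poly F 1" using a by (simp add: vlt_cancel)
  ultimately have ex: "\<exists>!v. poly F v = 0 \<and> of_nat n \<prec> v - 1" using n hensel_root by blast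
  have iff: "poly f b = 0 \<and> rv ord n b = rv ord n z \<longleftrightarrow> poly F (b / z) = 0 \<and> of_nat n \<prec> b / z - 1" for b
  proof -
    have "rv ord n b = rv ord n z \<longleftrightarrow> z * of_nat n \<prec> z * (b / z - 1)"
      using z rv_eq_iff[of n z b] by (auto simp: algebra_simps)
    also have "\<dots> \<longleftrightarrow> of_nat n \<prec> b / z - 1" using z by (rule vlt_cancel)
    finally show ?thesis using z a by (simp add: F_def poly_pcompose)
  qed
  from ex obtain v where v: "poly F v = 0 \<and> of_nat n \<prec> v - 1"
    "\<And>w. poly F w = 0 \<and> of_nat n \<prec> w - 1 \<Longrightarrow> w = v" by blast
  show ?thesis
  proof (rule ex1I[of _ "v * z"])
    show "poly f (v * z) = 0 \<and> rv ord n (v * z) = rv ord n z" using v(1) z unfolding iff by simp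
    fix b assume "poly f b = 0 \<and> rv ord n b = rv ord n z"
    then have "b / z = v" unfolding iff by (rule v(2))
    then show "b = v * z" using z by auto
  qed
qed

lemma higher_pderiv_pcompose_linear:
  "(pderiv ^^ k) (pcompose p [:c, z:]) = smult (z ^ k) (pcompose ((pderiv ^^ k) p) [:c, z:])"
  for p :: "'k poly"
  by (induction k) (auto simp: pderiv_smult pderiv_pcompose pderiv_pCons mult.commute)

text \<open>The contrapositive of \<open>step_normalized\<close>, after scaling \<open>z\<close> to
  1 and dividing by a Taylor term of minimal value. When Hensel's lemma applies to no derivative,
  the sum of the Taylor terms can be smaller than any one of them by at most the factor
  \<open>nu d d\<close>.\<close>

lemma nc_dichotomy:
  assumes q: "q \<noteq> 0" and deg: "degree q \<le> d" and z: "z \<noteq> 0"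
    and nh: "\<And>k. k < d \<Longrightarrow> \<not> hcond (nu d (d - Suc k)) (pcompose ((pderiv ^^ k) q) [:c, 1:]) z"
  shows "poly q (c + z) \<preceq> of_nat (nu d d) * coeff (pcompose q [:c, 1:]) i * z ^ i"
proof -
  define f where "f k = pcompose ((pderiv ^^ k) q) [:c, 1:]" for k
  define a where "a = coeff (pcompose q [:c, 1:])"
  have dq: "degree (pcompose q [:c, 1:]) = degree q" by (simp add: degree_pcompose)
  have a0: "a i = 0" if "i > d" for i
    unfolding a_def using deg that dq by (intro coeff_eq_0) simp
  obtain l where l: "l \<in> {..d}" "\<forall>j\<in>{..d}. a l * z ^ l \<preceq> a j * z ^ j"
    using ex_min[of "{..d}" "\<lambda>l. a l * z ^ l"] by blast
  have lall: "a l * z ^ l \<preceq> a j * z ^ j" for j using l a0[of j] by (cases "j \<le> d") auto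
  define s where "s = a l * z ^ l"
  have s: "s \<noteq> 0"
  proof
    assume s0: "s = 0"
    have "a j = 0" for j using lall[of j] z s0 by (simp add: s_def)
    then have "pcompose q [:c, 1:] = 0" unfolding a_def by (intro poly_eqI) simp
    then show False using q by (simp add: pcompose_eq_0_iff)
  qed
  define g where "g = smult (1 / s) (pcompose q [:c, z:])"
  have comp: "pcompose p [:c, z:] = pcompose (pcompose p [:c, 1:]) [:0, z:]" for p :: "'k poly"
    by (simp add: pcompose_assoc[symmetric] pcompose_pCons)
  have cg: "coeff g j = a j * z ^ j / s" for j
    by (simp add: g_def comp[of q] coeff_pcompose_linear a_def)
  have ig: "ipoly g" unfolding ipoly_def
  proof
    fix j
    obtain u where u: "u \<in> \<O>" "a j * z ^ j = s * u" using lall[of j] unfolding s_def vle_def by auto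
    then show "coeff g j \<in> \<O>" using s by (simp add: cg)
  qed
  have "coeff g l = 1" using s by (simp add: cg s_def)
  then have unit: "coeff g l \<notin> \<M>" by simp
  have dg: "degree g \<le> d" unfolding g_def using deg
    by (intro order_trans[OF degree_smult_le]) (use degree_pcompose_le[of q "[:c, z:]"] in \<open>auto split: if_splits\<close>)
  have "poly g 1 \<preceq> of_nat (nu d d)"
  proof (rule ccontr)
    assume "\<not> ?thesis"
    from step_normalized[OF ig dg unit this] obtain k i0 where k: "k < d" "i0 > 0"
      and 1: "coeff ((pderiv ^^ k) g) i0 \<noteq> 0"
      and 2: "\<And>i. coeff ((pderiv ^^ k) g) i0 \<preceq> coeff ((pderiv ^^ k) g) i"
      and 3: "of_nat (nu d (d - Suc k)) ^ 2 * coeff ((pderiv ^^ k) g) i0 \<prec> poly ((pderiv ^^ k) g) 1"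
      and 4: "poly (pderiv ((pderiv ^^ k) g)) 1 \<preceq> of_nat (nu d (d - Suc k)) * coeff ((pderiv ^^ k) g) i0"
      by blast
    define t where "t = z ^ k / s"
    have t: "t \<noteq> 0" using z s by (simp add: t_def)
    define n where "n = nu d (d - Suc k)"
    have G: "(pderiv ^^ k) g = smult t (pcompose (f k) [:0, z:])"
      unfolding g_def higher_pderiv_smult higher_pderiv_pcompose_linear comp f_def t_def by simp
    have Gc: "coeff ((pderiv ^^ k) g) i = t * (coeff (f k) i * z ^ i)" for i
      by (simp add: G coeff_pcompose_linear)
    have G1: "poly ((pderiv ^^ k) g) 1 = t * poly (f k) z" by (simp add: G poly_pcompose)
    have G2: "poly (pderiv ((pderiv ^^ k) g)) 1 = t * (z * poly (pderiv (f k)) z)"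
      by (simp add: G pderiv_smult pderiv_pcompose pderiv_pCons poly_pcompose)
    have "hcond n (f k) z" unfolding hcond_def
    proof (intro conjI exI[of _ i0] allI)
      show "coeff (f k) i0 \<noteq> 0" using 1 unfolding Gc by auto
      fix j show "coeff (f k) i0 * z ^ i0 \<preceq> coeff (f k) j * z ^ j"
        using 2[of j] t unfolding Gc by (simp add: vle_cancel)
    next
      have "t * (of_nat n ^ 2 * coeff (f k) i0 * z ^ i0) \<prec> t * poly (f k) z"
        using 3 unfolding Gc G1 n_def by (simp add: mult_ac)
      then show "of_nat n ^ 2 * coeff (f k) i0 * z ^ i0 \<prec> poly (f k) z" using t by (simp add: vlt_cancel)
    next
      have "t * (z * poly (pderiv (f k)) z) \<preceq> t * (z * (of_nat n * coeff (f k) i0 * z ^ (i0 - 1)))"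
        using 4 k unfolding Gc G2 n_def by (cases i0) (simp_all add: mult_ac)
      then show "poly (pderiv (f k)) z \<preceq> of_nat n * coeff (f k) i0 * z ^ (i0 - 1)"
        using t z by (simp add: vle_cancel)
    qed (use z k in auto)
    then show False using nh[OF k(1)] unfolding n_def f_def by blast
  qed
  then have "s * poly g 1 \<preceq> s * of_nat (nu d d)" by (intro vle_mult) auto
  also have "s * poly g 1 = poly q (c + z)" using s by (simp add: g_def poly_pcompose)
  also have "s * of_nat (nu d d) \<preceq> (a i * z ^ i) * of_nat (nu d d)"
    using vle_mult[OF lall[of i] vle_refl] unfolding s_def .
  finally (vle_trans) show ?thesis by (simp add: a_def mult_ac)
qed

lemma rv_eq_vle: "rv ord n x = rv ord n y \<Longrightarrow> x \<preceq> y"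
proof -
  assume "rv ord n x = rv ord n y"
  then have "of_nat n * x \<prec> y - x" by (simp add: rv_eq_iff)
  then have "x \<preceq> y - x" using vle_O'[OF O_of_nat, of x n] vle_vlt_trans vlt_vle by blast
  then have "x \<preceq> y - x + x" by (intro vle_add) auto
  then show ?thesis by simp
qed

text \<open>If Hensel's condition held for a derivative, its root \<open>c + b\<close> would satisfy
  \<open>rv b = rv (y - c)\<close> and so lie strictly closer to \<open>y\<close> than
  \<open>c\<close> does, against the choice of \<open>c\<close>.\<close>

lemma no_cancellation:
  assumes deg: "degree q \<le> d" and y: "y \<noteq> c"
    and closest: "\<And>k r. k < d \<Longrightarrow> (pderiv ^^ k) q \<noteq> 0 \<Longrightarrow> poly ((pderiv ^^ k) q) r = 0 \<Longrightarrow> y - r \<preceq> y - c"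
  shows "poly q y \<preceq> of_nat (nu d d) * coeff (pcompose q [:c, 1:]) i * (y - c) ^ i"
proof (cases "q = 0")
  case False
  have z: "y - c \<noteq> 0" using y by simp
  have "\<not> hcond (nu d (d - Suc k)) (pcompose ((pderiv ^^ k) q) [:c, 1:]) (y - c)" if k: "k < d" for k
  proof
    let ?f = "pcompose ((pderiv ^^ k) q) [:c, 1:]" and ?n = "nu d (d - Suc k)"
    assume h: "hcond ?n ?f (y - c)"
    then obtain b where b: "poly ?f b = 0" "rv ord ?n b = rv ord ?n (y - c)"
      using hcond_root[OF nu_pos] by blast
    have "?f \<noteq> 0" using h by (auto simp: hcond_def)
    then have "(pderiv ^^ k) q \<noteq> 0" by auto
    moreover have "poly ((pderiv ^^ k) q) (c + b) = 0" using b by (simp add: poly_pcompose)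
    ultimately have "y - (c + b) \<preceq> y - c" using closest[OF k] by blast
    moreover have "of_nat ?n * (y - c) \<prec> b - (y - c)" using b(2)[symmetric] by (simp add: rv_eq_iff)
    then have "y - c \<prec> b - (y - c)" using vle_O'[OF O_of_nat] vle_vlt_trans by blast
    then have "y - c \<prec> - (b - (y - c))" by (rule vlt_uminus)
    then have "y - c \<prec> y - (c + b)" by (simp add: algebra_simps)
    ultimately have "y - c \<prec> y - c" using vlt_vle_trans by blast
    then show False using z vlt_irrefl by blast
  qed
  then show ?thesis using nc_dichotomy[OF False deg z, of c i] by simp
qed simp

text \<open>Passing to other coefficients and another argument in the same classes moves each term
  by an element of \<open>n \<mu> \<M>\<close> times that term; by \<open>nc\<close> this lies in
  \<open>n \<M>\<close> times the value.\<close>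

lemma rv_poly:
  assumes a: "\<And>i. rv ord (n * \<mu>) (coeff f i) = rv ord (n * \<mu>) (coeff f' i)"
    and z: "rv ord (n * \<mu>) z = rv ord (n * \<mu>) z'"
    and nc: "\<And>i. poly f z \<preceq> of_nat \<mu> * coeff f i * z ^ i"
  shows "rv ord n (poly f z) = rv ord n (poly f' z')"
proof -
  define d where "d = max (degree f) (degree f')"
  have "poly f' z' - poly f z = (\<Sum>i\<le>d. coeff f' i * z' ^ i - coeff f i * z ^ i)"
    by (simp add: poly_altdef_le[of f d] poly_altdef_le[of f' d] d_def sum_subtractf)
  moreover have "of_nat n * poly f z \<prec> (\<Sum>i\<le>d. coeff f' i * z' ^ i - coeff f i * z ^ i)"
  proof (rule vlt_sum)
    fix i
    have "rv ord (n * \<mu>) (coeff f i * z ^ i) = rv ord (n * \<mu>) (coeff f' i * z' ^ i)"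
      by (intro rv_mult rv_power a z)
    then have "of_nat (n * \<mu>) * (coeff f i * z ^ i) \<prec> coeff f' i * z' ^ i - coeff f i * z ^ i"
      by (simp add: rv_eq_iff)
    moreover have "of_nat n * poly f z \<preceq> of_nat n * (of_nat \<mu> * coeff f i * z ^ i)"
      using nc by (intro vle_mult) auto
    ultimately show "of_nat n * poly f z \<prec> coeff f' i * z' ^ i - coeff f i * z ^ i"
      by (auto intro: vle_vlt_trans simp: mult_ac)
  qed
  ultimately show ?thesis by (simp add: rv_eq_iff)
qed

lemma pderiv_altdef:
  fixes f :: "'k poly"
  assumes "degree f \<le> D"
  shows "z * poly (pderiv f) z = (\<Sum>i\<le>D. of_nat i * coeff f i * z ^ i)"
proof -
  have c: "coeff (pCons 0 (pderiv f)) i = of_nat i * coeff f i" for i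
    by (cases i) (auto simp: coeff_pderiv)
  have "z * poly (pderiv f) z = poly (pCons 0 (pderiv f)) z" by simp
  also have "\<dots> = (\<Sum>i\<le>D. coeff (pCons 0 (pderiv f)) i * z ^ i)"
  proof (rule poly_altdef_le, rule degree_le, intro allI impI)
    fix i assume "D < i"
    then show "coeff (pCons 0 (pderiv f)) i = 0" unfolding c using assms by (simp add: coeff_eq_0)
  qed
  finally show ?thesis unfolding c .
qed

text \<open>Here \<open>f'\<close> is a perturbation of \<open>f\<close>, not its derivative. A root
  \<open>z\<close> of \<open>f\<close> is an approximate root of \<open>f'\<close>, since every term
  moves by less than \<open>N^2\<close> times itself; bounded cancellation in
  \<open>pderiv f\<close> keeps the slope of \<open>f'\<close> at \<open>z\<close> large, and
  Hensel's lemma corrects \<open>z\<close>. The square of \<open>N\<close> is the one in Hensel's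
  condition.\<close>

lemma perturb_root:
  assumes f: "poly f z = 0" "z \<noteq> 0" "f \<noteq> 0" "degree f \<le> D" "degree f' \<le> D" and pos: "\<mu> > 0" "n > 0"
    and nc: "\<And>i. poly (pderiv f) z \<preceq> of_nat \<mu> * coeff (pderiv f) i * z ^ i"
    and N: "N = n * (\<mu> * fact D)"
    and rv: "\<And>i. rv ord (N ^ 2) (coeff f i) = rv ord (N ^ 2) (coeff f' i)"
  shows "\<exists>z'. poly f' z' = 0 \<and> rv ord n z' = rv ord n z"
proof -
  define a where "a = (\<lambda>i. coeff f i * z ^ i)"
  define a' where "a' = (\<lambda>i. coeff f' i * z ^ i)"
  have aa: "a i \<preceq> a' i" "a' i \<preceq> a i" for i
    unfolding a_def a'_def using rv_eq_vle[OF rv[of i]] rv_eq_vle[OF rv[of i, symmetric]]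
    by (auto intro: vle_mult)
  have diff: "of_nat N ^ 2 * a i \<prec> a' i - a i" for i
  proof -
    have "of_nat (N ^ 2) * coeff f i * z ^ i \<prec> (coeff f' i - coeff f i) * z ^ i"
      using rv[of i] unfolding rv_eq_iff by (intro vlt_mult) auto
    then show ?thesis unfolding a_def a'_def by (simp add: algebra_simps)
  qed
  have D0: "D > 0"
  proof (rule ccontr)
    assume "\<not> D > 0"
    then have "degree f = 0" using f by simp
    then obtain c where "f = [:c:]" by (metis degree_eq_zeroE)
    then show False using f by auto
  qed
  have hi: "a i = 0" if "i > D" for i using f that by (simp add: a_def coeff_eq_0)
  \<comment> \<open>A minimal term can be found at a positive index because \<open>z\<close> is a
    root: the constant term is minus the sum of the others.\<close>
  obtain i1 where i1: "i1 \<in> {1..D}" "\<forall>j\<in>{1..D}. a i1 \<preceq> a j" using ex_min[of "{1..D}" a] D0 by auto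
  define A where "A = a i1"
  have mn: "A \<preceq> a j" for j
  proof (cases "j = 0")
    case True
    have "poly f z = a 0 + (\<Sum>i\<in>{1..D}. a i)" unfolding poly_altdef_le[OF f(4)] a_def
      by (simp add: sum.atLeast_Suc_atMost atMost_atLeast0)
    then have "a 0 = - (\<Sum>i\<in>{1..D}. a i)" using f by (simp add: eq_neg_iff_add_eq_0)
    then show ?thesis using i1 unfolding True A_def by (auto intro!: vle_uminus vle_sum)
  next
    case False
    then show ?thesis using i1 hi[of j] unfolding A_def by (cases "j \<le> D") auto
  qed
  have A: "A \<noteq> 0"
  proof
    assume "A = 0"
    then have "coeff f j = 0" for j using mn[of j] f by (simp add: a_def)
    then show False using f by (metis leading_coeff_0_iff)
  qed
  have AA: "a' i1 \<preceq> A" "A \<preceq> a' i1" using aa unfolding A_def by auto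
  have A': "a' i1 \<noteq> 0" using A AA by auto
  have Npos: "N > 0" using N pos by simp
  have NA: "of_nat N * A \<preceq> of_nat N ^ 2 * a j" for j
  proof -
    have "of_nat N * A \<preceq> of_nat N * (of_nat N * a j)"
      by (intro vle_mult vle_refl vle_trans[OF mn[of j] vle_O'[OF O_of_nat]])
    then show ?thesis by (simp add: power2_eq_square mult_ac)
  qed
  have fz: "of_nat N ^ 2 * A \<prec> poly f' z"
  proof -
    have "poly f' z = poly f' z - poly f z" using f by simp
    also have "\<dots> = (\<Sum>i\<le>D. a' i - a i)"
      unfolding poly_altdef_le[OF f(4)] poly_altdef_le[OF f(5)] a_def a'_def by (simp add: sum_subtractf)
    finally have e: "poly f' z = (\<Sum>i\<le>D. a' i - a i)" .
    have "of_nat N ^ 2 * A \<prec> a' i - a i" for i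
      using vle_vlt_trans[OF vle_mult[OF vle_refl mn] diff] .
    then show ?thesis unfolding e by (intro vlt_sum)
  qed
  \<comment> \<open>Bounded cancellation is applied at the index of the minimal term.
    Differentiation contributes the factor \<open>i1\<close>, and \<open>\<mu> * i1\<close> divides
    \<open>N\<close> thanks to the factor \<open>fact D\<close>.\<close>
  have d1: "z * poly (pderiv f) z \<preceq> of_nat N * A"
  proof -
    obtain i where i: "i1 = Suc i" using i1 by (cases i1) auto
    have "z * poly (pderiv f) z \<preceq> z * (of_nat \<mu> * coeff (pderiv f) i * z ^ i)"
      using nc by (intro vle_mult) auto
    also have "\<dots> = of_nat (\<mu> * i1) * A" unfolding A_def a_def i coeff_pderiv by (simp add: algebra_simps)
    also have "\<dots> \<preceq> of_nat N * A"
    proof (intro vle_mult vle_of_nat_dvd)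
      have "i1 dvd fact D" using i1 by (intro dvd_fact) auto
      then show "\<mu> * i1 dvd N" unfolding N by auto
    qed auto
    finally (vle_trans) show ?thesis .
  qed
  have d2: "z * poly (pderiv f') z \<preceq> of_nat N * A"
  proof (rule ccontr)
    assume "\<not> ?thesis"
    then have 1: "of_nat N * A \<prec> z * poly (pderiv f') z" using vle_total by blast
    have "z * poly (pderiv f') z - z * poly (pderiv f) z = (\<Sum>i\<le>D. of_nat i * (a' i - a i))"
      unfolding pderiv_altdef[OF f(4)] pderiv_altdef[OF f(5)] a_def a'_def
      by (simp add: sum_subtractf algebra_simps)
    moreover have "of_nat N * A \<prec> (\<Sum>i\<le>D. of_nat i * (a' i - a i))"
    proof (rule vlt_sum)
      fix i
      have "of_nat N * A \<prec> a' i - a i" using vle_vlt_trans[OF NA diff] .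
      then show "of_nat N * A \<prec> of_nat i * (a' i - a i)" using vle_O'[OF O_of_nat] vlt_vle_trans by blast
    qed
    ultimately have "of_nat N * A \<prec> z * poly (pderiv f') z - z * poly (pderiv f) z" by simp
    then have "of_nat N * A \<prec> z * poly (pderiv f') z + - (z * poly (pderiv f') z - z * poly (pderiv f) z)"
      using 1 by (intro vlt_add vlt_uminus)
    then have "of_nat N * A \<prec> z * poly (pderiv f) z" by simp
    then have "of_nat N * A \<prec> of_nat N * A" using d1 vlt_vle_trans by blast
    then show False using vlt_irrefl A Npos by fastforce
  qed
  have "hcond N f' z" unfolding hcond_def
  proof (intro conjI exI[of _ i1] allI)
    show "z \<noteq> 0" by fact
    show "0 < i1" using i1 by simp
    show "coeff f' i1 \<noteq> 0" using A' by (auto simp: a'_def)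
    fix j show "coeff f' i1 * z ^ i1 \<preceq> coeff f' j * z ^ j"
      using vle_trans[OF AA(1) vle_trans[OF mn[of j] aa(1)[of j]]] unfolding a'_def .
  next
    show "of_nat N ^ 2 * coeff f' i1 * z ^ i1 \<prec> poly f' z"
      using vle_vlt_trans[OF vle_mult[OF vle_refl AA(1)] fz] by (simp add: a'_def mult_ac)
  next
    have "z * poly (pderiv f') z \<preceq> of_nat N * a' i1"
      using vle_trans[OF d2 vle_mult[OF vle_refl AA(2)]] .
    also have "\<dots> = z * (of_nat N * coeff f' i1 * z ^ (i1 - 1))" using i1 by (cases i1) (auto simp: a'_def)
    finally show "poly (pderiv f') z \<preceq> of_nat N * coeff f' i1 * z ^ (i1 - 1)" using f by (simp add: vle_cancel)
  qed
  then obtain b where b: "poly f' b = 0" "rv ord N b = rv ord N z" using hcond_root[OF Npos] by blast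
  moreover from b(2) have "rv ord n b = rv ord n z" by (rule rv_dvd[rotated]) (simp add: N)
  ultimately show ?thesis by blast
qed

end

section \<open>Transfer of roots and points\<close>

text \<open>The members are coefficients depending on an assignment. Three instances are used: the
  functions given by terms of the smaller language, the definable functions \<open>DF\<close>, and
  the definable functions given by terms with auxiliary arguments \<open>LF\<close>.\<close>

locale fring =
  fixes R :: "('e \<Rightarrow> 'k::field_char_0) set"
  assumes zero: "(\<lambda>_. 0) \<in> R" and one: "(\<lambda>_. 1) \<in> R"
    and add: "f \<in> R \<Longrightarrow> g \<in> R \<Longrightarrow> (\<lambda>e. f e + g e) \<in> R"
    and diff: "f \<in> R \<Longrightarrow> g \<in> R \<Longrightarrow> (\<lambda>e. f e - g e) \<in> R"
    and mult: "f \<in> R \<Longrightarrow> g \<in> R \<Longrightarrow> (\<lambda>e. f e * g e) \<in> R"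
begin

lemma of_nat: "(\<lambda>_. of_nat n) \<in> R"
  by (induction n) (auto intro: zero one add)

lemma power: "f \<in> R \<Longrightarrow> (\<lambda>e. f e ^ n) \<in> R"
  by (induction n) (auto intro: one mult)

lemma sum: "(\<And>i. i \<in> I \<Longrightarrow> f i \<in> R) \<Longrightarrow> (\<lambda>e. \<Sum>i\<in>I. f i e) \<in> R"
  by (induction I rule: infinite_finite_induct) (auto intro: zero add)

text \<open>The common degree bound makes statements about all derivatives or all coefficients
  finite, uniformly in the assignment.\<close>

definition fpoly :: "('e \<Rightarrow> 'k poly) \<Rightarrow> bool" where
  "fpoly p \<longleftrightarrow> (\<forall>i. (\<lambda>e. coeff (p e) i) \<in> R) \<and> (\<exists>d. \<forall>e. degree (p e) \<le> d)"

lemma fpoly_coeff: "fpoly p \<Longrightarrow> (\<lambda>e. coeff (p e) i) \<in> R"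
  by (simp add: fpoly_def)

lemma fpoly_degree: "fpoly p \<Longrightarrow> \<exists>d. \<forall>e. degree (p e) \<le> d"
  by (simp add: fpoly_def)

lemma fpolyI: "(\<And>i. (\<lambda>e. coeff (p e) i) \<in> R) \<Longrightarrow> (\<And>e. degree (p e) \<le> d) \<Longrightarrow> fpoly p"
  unfolding fpoly_def by blast

lemma fpoly_monom:
  assumes "c \<in> R"
  shows "fpoly (\<lambda>e. monom (c e) n)"
proof (rule fpolyI)
  show "(\<lambda>e. coeff (monom (c e) n) i) \<in> R" for i using assms zero by (cases "n = i") auto
qed (rule degree_monom_le)

lemma fpoly_const: "c \<in> R \<Longrightarrow> fpoly (\<lambda>e. [:c e:])"
  using fpoly_monom[of c 0] by (simp add: monom_0)

lemma fpoly_add: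
  assumes p: "fpoly p" and q: "fpoly q"
  shows "fpoly (\<lambda>e. p e + q e)"
proof -
  obtain d d' where "\<And>e. degree (p e) \<le> d" "\<And>e. degree (q e) \<le> d'"
    using fpoly_degree[OF p] fpoly_degree[OF q] by blast
  then have "degree (p e + q e) \<le> max d d'" for e by (intro degree_add_le) (auto intro: max.coboundedI1 max.coboundedI2)
  then show ?thesis using p q by (intro fpolyI) (auto intro: add fpoly_coeff)
qed

lemma fpoly_diff:
  assumes p: "fpoly p" and q: "fpoly q"
  shows "fpoly (\<lambda>e. p e - q e)"
proof -
  obtain d d' where "\<And>e. degree (p e) \<le> d" "\<And>e. degree (q e) \<le> d'"
    using fpoly_degree[OF p] fpoly_degree[OF q] by blast
  then have "degree (p e - q e) \<le> max d d'" for e by (intro degree_diff_le) (auto intro: max.coboundedI1 max.coboundedI2)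
  then show ?thesis using p q by (intro fpolyI) (auto intro: diff fpoly_coeff)
qed

lemma fpoly_mult:
  assumes p: "fpoly p" and q: "fpoly q"
  shows "fpoly (\<lambda>e. p e * q e)"
proof -
  obtain d d' where "\<And>e. degree (p e) \<le> d" "\<And>e. degree (q e) \<le> d'"
    using fpoly_degree[OF p] fpoly_degree[OF q] by blast
  then have "degree (p e * q e) \<le> d + d'" for e by (intro order_trans[OF degree_mult_le] add_mono)
  then show ?thesis using p q unfolding coeff_mult
    by (intro fpolyI) (auto simp: coeff_mult intro!: sum mult fpoly_coeff)
qed

lemma fpoly_power: "fpoly p \<Longrightarrow> fpoly (\<lambda>e. p e ^ n)"
  using fpoly_const[OF one] by (induction n) (auto intro: fpoly_mult simp: one_pCons)

lemma fpoly_sum: "(\<And>i. i \<in> I \<Longrightarrow> fpoly (p i)) \<Longrightarrow> fpoly (\<lambda>e. \<Sum>i\<in>I. p i e)"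
  using fpoly_const[OF zero] by (induction I rule: infinite_finite_induct) (auto intro: fpoly_add)

lemma fpoly_pderiv:
  assumes p: "fpoly p"
  shows "fpoly (\<lambda>e. pderiv (p e))"
proof -
  obtain d where "\<And>e. degree (p e) \<le> d" using fpoly_degree[OF p] by blast
  then have "degree (pderiv (p e)) \<le> d" for e using diff_le_self le_trans by (metis degree_pderiv)
  then show ?thesis using p
    by (intro fpolyI) (auto simp: coeff_pderiv simp del: of_nat_Suc intro!: mult of_nat fpoly_coeff)
qed

lemma fpoly_higher_pderiv: "fpoly p \<Longrightarrow> fpoly (\<lambda>e. (pderiv ^^ k) (p e))"
  by (induction k) (auto intro: fpoly_pderiv)

lemma fpoly_pcompose:
  assumes p: "fpoly p" and q: "fpoly q"
  shows "fpoly (\<lambda>e. pcompose (p e) (q e))"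
proof -
  obtain d where d: "\<And>e. degree (p e) \<le> d" using fpoly_degree[OF p] by blast
  have "pcompose (p e) (q e) = (\<Sum>i\<le>d. [:coeff (p e) i:] * q e ^ i)" for e
  proof -
    have "pcompose (p e) (q e) = pcompose (\<Sum>i\<le>d. monom (coeff (p e) i) i) (q e)"
      using poly_as_sum_of_monoms'[OF d] by simp
    also have "\<dots> = (\<Sum>i\<le>d. pcompose (monom (coeff (p e) i) i) (q e))" by (rule pcompose_sum)
    also have "\<dots> = (\<Sum>i\<le>d. [:coeff (p e) i:] * q e ^ i)"
      by (intro sum.cong) (auto simp: pcompose_altdef map_poly_monom poly_monom)
    finally show ?thesis .
  qed
  then show ?thesis using p q by (simp only:) (intro fpoly_sum fpoly_mult fpoly_const fpoly_power fpoly_coeff)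
qed

lemma fpoly_poly:
  assumes p: "fpoly p" and c: "c \<in> R"
  shows "(\<lambda>e. poly (p e) (c e)) \<in> R"
proof -
  have "(\<lambda>e. coeff (pcompose (p e) [:c e:]) 0) \<in> R"
    using p c by (intro fpoly_coeff fpoly_pcompose fpoly_const)
  then show ?thesis by simp
qed

lemma fpoly_linear: "c \<in> R \<Longrightarrow> fpoly (\<lambda>e. [:c e, 1:])"
  using fpoly_add[OF fpoly_const[of c] fpoly_monom[OF one, of 1]] by (simp add: monom_Suc monom_0)

text \<open>There is no division in \<open>R\<close>, so removing a leading term costs a factor
  \<open>coeff (q e) (Suc d)\<close>. This coefficient may vanish at some \<open>e\<close>; the
  identity at roots of \<open>q\<close> persists there and is exploited only where it does not
  vanish.\<close>

lemma pseudo_remainder: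
  assumes q: "fpoly q" and dq: "\<And>e. degree (q e) \<le> Suc d" and p: "fpoly p"
  shows "\<exists>r j. fpoly r \<and> (\<forall>e. degree (r e) \<le> d) \<and>
     (\<forall>e c. poly (q e) c = 0 \<longrightarrow> poly (r e) c = coeff (q e) (Suc d) ^ j * poly (p e) c)"
proof -
  obtain m where "\<And>e. degree (p e) \<le> m" using fpoly_degree[OF p] by blast
  then show ?thesis using p
  proof (induction m arbitrary: p)
    case 0
    then show ?case by (intro exI[of _ p] exI[of _ 0]) auto
  next
    case (Suc m)
    show ?case
    proof (cases "Suc m \<le> d")
      case True
      then show ?thesis using Suc.prems by (intro exI[of _ p] exI[of _ 0]) (auto intro: order_trans)
    next
      case False
      define p' where "p' e = [:coeff (q e) (Suc d):] * p e - monom (coeff (p e) (Suc m)) (m - d) * q e" for e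
      have "fpoly p'" unfolding p'_def using q Suc.prems(2)
        by (intro fpoly_diff fpoly_mult fpoly_const fpoly_monom fpoly_coeff)
      moreover have "degree (p' e) \<le> m" for e
      proof (rule degree_le, intro allI impI)
        fix i assume i: "m < i"
        show "coeff (p' e) i = 0"
        proof (cases "i = Suc m")
          case True
          then show ?thesis using False by (simp add: p'_def coeff_monom_mult Suc_diff_le)
        next
          case ne: False
          then have "coeff (p e) i = 0" using Suc.prems(1)[of e] i by (intro coeff_eq_0) simp
          moreover have "coeff (q e) (i - (m - d)) = 0" using dq[of e] i False ne by (intro coeff_eq_0) simp
          ultimately show ?thesis by (simp add: p'_def coeff_monom_mult)
        qed
      qed
      ultimately obtain r j where r: "fpoly r" "\<And>e. degree (r e) \<le> d"
        "\<And>e c. poly (q e) c = 0 \<Longrightarrow> poly (r e) c = coeff (q e) (Suc d) ^ j * poly (p' e) c"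
        using Suc.IH[of p'] by blast
      have "poly (r e) c = coeff (q e) (Suc d) ^ Suc j * poly (p e) c" if "poly (q e) c = 0" for e c
        using r(3)[OF that] that by (simp add: p'_def)
      with r show ?thesis by blast
    qed
  qed
qed

end

context henselian
begin

section \<open>Transfer between assignments with equal leading terms\<close>

definition sim :: "('e \<Rightarrow> 'k) set \<Rightarrow> nat \<Rightarrow> 'e \<Rightarrow> 'e \<Rightarrow> bool" where
  "sim Q N e e' \<longleftrightarrow> (\<forall>q\<in>Q. rv ord N (q e) = rv ord N (q e'))"

lemma sim_mono: "sim Q N e e' \<Longrightarrow> Q' \<subseteq> Q \<Longrightarrow> N' dvd N \<Longrightarrow> sim Q' N' e e'"
  unfolding sim_def using rv_dvd by blast

text \<open>\<open>Q\<close> and \<open>N\<close> are fixed before the assignments, so finitely many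
  leading terms over \<open>R\<close> decide which points exist. \<open>S\<close> and
  \<open>T\<close> are separate because a nonzero polynomial is required at \<open>e\<close> only;
  at \<open>e'\<close> merely a zero is produced.\<close>

definition transfers ::
    "('e \<Rightarrow> 'k) set \<Rightarrow> ('e \<Rightarrow> 'k \<Rightarrow> bool) \<Rightarrow> ('e \<Rightarrow> 'k \<Rightarrow> bool) \<Rightarrow> ('e \<Rightarrow> 'k poly) set \<Rightarrow> nat \<Rightarrow> bool" where
  "transfers R S T ps n \<longleftrightarrow> (\<exists>Q N. finite Q \<and> Q \<subseteq> R \<and> N > 0 \<and> (\<forall>e e'. sim Q N e e' \<longrightarrow>
     (\<forall>c. S e c \<longrightarrow> (\<exists>c'. T e' c' \<and> (\<forall>p\<in>ps. rv ord n (poly (p e) c) = rv ord n (poly (p e') c'))))))"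

lemma transfersE:
  assumes "transfers R S T ps n"
  obtains Q N where "finite Q" "Q \<subseteq> R" "N > 0"
    "\<And>e e' c. sim Q N e e' \<Longrightarrow> S e c \<Longrightarrow>
      \<exists>c'. T e' c' \<and> (\<forall>p\<in>ps. rv ord n (poly (p e) c) = rv ord n (poly (p e') c'))"
  using assms unfolding transfers_def 
  by (elim exE conjE) (rule that; (assumption | (drule spec, drule spec, drule (1) mp, drule spec, drule (1) mp, assumption)))

abbreviation nzroot :: "('e \<Rightarrow> 'k poly) \<Rightarrow> 'e \<Rightarrow> 'k \<Rightarrow> bool" where
  "nzroot q e c \<equiv> q e \<noteq> 0 \<and> poly (q e) c = 0"

abbreviation root_transfer :: "('e \<Rightarrow> 'k) set \<Rightarrow> ('e \<Rightarrow> 'k poly) \<Rightarrow> ('e \<Rightarrow> 'k poly) set \<Rightarrow> nat \<Rightarrow> bool" where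
  "root_transfer R q ps n \<equiv> transfers R (nzroot q) (\<lambda>e c. poly (q e) c = 0) ps n"

text \<open>The candidates for the point of expansion; 0 is included so that a closest one always
  exists.\<close>

definition centers :: "('e \<Rightarrow> 'k poly) set \<Rightarrow> 'e \<Rightarrow> 'k set" where
  "centers D e = insert 0 {c. \<exists>q\<in>D. nzroot q e c}"

lemma finite_centers: "finite D \<Longrightarrow> finite (centers D e)" for D :: "('e \<Rightarrow> 'k poly) set"
proof -
  assume D: "finite D"
  have "{c. \<exists>q\<in>D. nzroot q e c} = (\<Union>q\<in>D. {c. nzroot q e c})" by auto
  moreover have "finite {c. nzroot q e c}" for q :: "'e \<Rightarrow> 'k poly"
    by (cases "q e = 0") (auto simp: poly_roots_finite)
  ultimately show ?thesis using D by (simp add: centers_def)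
qed

text \<open>The conditions for all members of \<open>D\<close> are collected and their precisions
  multiplied. The centre 0 is moved to itself, because the values \<open>poly (p e) 0\<close> are
  functions in \<open>R\<close>.\<close>

lemma transfers_centers:
  assumes R: "fring R" and D: "finite D" and E: "finite E" "\<And>p. p \<in> E \<Longrightarrow> fring.fpoly R p"
    and rt: "\<And>q. q \<in> D \<Longrightarrow> root_transfer R q E n"
    and n: "n > 0"
  shows "transfers R (\<lambda>e c. c \<in> centers D e) (\<lambda>_ _. True) E n"
proof -
  interpret fring R by (rule R)
  have "\<forall>q\<in>D. \<exists>Q N. finite Q \<and> Q \<subseteq> R \<and> N > 0 \<and> (\<forall>e e'. sim Q N e e' \<longrightarrow>
     (\<forall>c. nzroot q e c \<longrightarrow> (\<exists>c'. poly (q e') c' = 0 \<and> (\<forall>p\<in>E. rv ord n (poly (p e) c) = rv ord n (poly (p e') c')))))"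
    using rt unfolding transfers_def by blast
  then obtain Qf Nf where f: "\<And>q. q \<in> D \<Longrightarrow> finite (Qf q) \<and> Qf q \<subseteq> R \<and> Nf q > (0::nat) \<and>
    (\<forall>e e'. sim (Qf q) (Nf q) e e' \<longrightarrow>
     (\<forall>c. nzroot q e c \<longrightarrow> (\<exists>c'. poly (q e') c' = 0 \<and> (\<forall>p\<in>E. rv ord n (poly (p e) c) = rv ord n (poly (p e') c')))))"
    by metis
  define Q where "Q = (\<Union>q\<in>D. Qf q) \<union> (\<lambda>p e. poly (p e) 0) ` E"
  define N where "N = n * (\<Prod>q\<in>D. Nf q)"
  show ?thesis unfolding transfers_def
  proof (intro exI[of _ Q] exI[of _ N] conjI allI impI)
    show "finite Q" using D E f by (auto simp: Q_def)
    show "Q \<subseteq> R" using f E fpoly_poly[OF _ zero] by (fastforce simp: Q_def)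
    show "N > 0" unfolding N_def using f n by (intro mult_pos_pos prod_pos) auto
    fix e e' c assume s: "sim Q N e e'" and c: "c \<in> centers D e"
    show "\<exists>c'. True \<and> (\<forall>p\<in>E. rv ord n (poly (p e) c) = rv ord n (poly (p e') c'))"
    proof (cases "\<exists>q\<in>D. nzroot q e c")
      case True
      then obtain q where q: "q \<in> D" "nzroot q e c" by blast
      have "sim (Qf q) (Nf q) e e'" using s q D by (elim sim_mono) (auto simp: Q_def N_def intro: dvd_prodI dvd_mult)
      then show ?thesis using f[OF q(1)] q by blast
    next
      case False
      then have "c = 0" using c by (auto simp: centers_def)
      have "sim ((\<lambda>p e. poly (p e) 0) ` E) n e e'" using s by (elim sim_mono) (auto simp: Q_def N_def)
      then show ?thesis using \<open>c = 0\<close> by (auto simp: sim_def)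
    qed
  qed
qed

lemma ex_closest_center:
  assumes "finite D"
  shows "\<exists>c\<in>centers D e. \<forall>r\<in>centers D e. y - r \<preceq> y - c"
proof -
  have "centers D e \<noteq> {}" by (auto simp: centers_def)
  with ex_max[OF finite_centers[OF assms, of e] this, of "\<lambda>r. y - r"] show ?thesis by simp
qed

text \<open>Taylor coefficients are derivatives divided by factorials, and the same factorial
  cancels on both sides. Hence it suffices to transfer the classes of the values of
  derivatives.\<close>

lemma rv_shift_coeff:
  assumes "\<And>i. i \<le> D \<Longrightarrow> rv ord N (poly ((pderiv ^^ i) p) c) = rv ord N (poly ((pderiv ^^ i) p') c')"
    and "degree p \<le> D" "degree p' \<le> D"
  shows "rv ord N (coeff (pcompose p [:c, 1:]) i) = rv ord N (coeff (pcompose p' [:c', 1:]) i)"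
proof (cases "i \<le> D")
  case True
  then have "rv ord N (fact i * coeff (pcompose p [:c, 1:]) i) = rv ord N (fact i * coeff (pcompose p' [:c', 1:]) i)"
    using assms(1) by (simp add: taylor_coeff)
  then show ?thesis by (rule rv_mult_cancel[of "fact i" N "fact i", rotated 2]) auto
next
  case False
  then show ?thesis using assms by (simp add: coeff_eq_0 degree_pcompose)
qed

text \<open>The centre \<open>c0\<close> closest to the root is chosen among roots of polynomials of
  degree at most \<open>d\<close>, which the induction hypothesis transfers. Seen from
  \<open>c0\<close>, cancellation is bounded in \<open>pderiv (q e)\<close> and in the members of
  \<open>rs\<close>, so \<open>perturb_root\<close> moves the root and \<open>rv_poly\<close>
  controls the values. The degree bound on \<open>rs\<close> puts the roots of its members among the
  centres; for \<open>q\<close> only the derivative has to be free of cancellation.\<close>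

lemma root_transfer_step:
  assumes R: "fring R" and q: "fring.fpoly R q" "\<And>e. degree (q e) \<le> Suc d" and n: "n > 0"
    and rs: "finite rs" "\<And>r. r \<in> rs \<Longrightarrow> fring.fpoly R r" "\<And>r e. r \<in> rs \<Longrightarrow> degree (r e) \<le> d"
    and IH: "\<And>q ps n. fring.fpoly R q \<Longrightarrow> (\<And>e. degree (q e) \<le> d) \<Longrightarrow> finite ps \<Longrightarrow>
      (\<And>p. p \<in> ps \<Longrightarrow> fring.fpoly R p) \<Longrightarrow> n > 0 \<Longrightarrow> root_transfer R q ps n"
  shows "root_transfer R q rs n"
proof -
  interpret fring R by (rule R)
  define E where "E = (\<lambda>(p, i) e. (pderiv ^^ i) (p e)) ` (insert q rs \<times> {..Suc d})"
  define D where "D = {p\<in>E. \<forall>e. degree (p e) \<le> d}"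
  have fE: "finite E" unfolding E_def using rs by auto
  then have fD: "finite D" by (simp add: D_def)
  have pE: "fpoly p" if "p \<in> E" for p using that q rs fpoly_higher_pderiv by (auto simp: E_def)
  define \<mu> where "\<mu> = nu d d"
  \<comment> \<open>\<open>n1\<close> is the precision of the argument that \<open>rv_poly\<close>
    consumes; the square of \<open>N1\<close> is the precision of the coefficients from which
    \<open>perturb_root\<close> delivers it.\<close>
  define n1 where "n1 = n * \<mu>"
  define N1 where "N1 = n1 * (\<mu> * fact (Suc d))"
  have pos: "\<mu> > 0" "n1 > 0" "N1 > 0" using n by (auto simp: \<mu>_def n1_def N1_def simp del: fact_Suc)
  have "transfers R (\<lambda>e c. c \<in> centers D e) (\<lambda>_ _. True) E (N1 ^ 2)"
    using R fD fE pE IH pos by (intro transfers_centers) (auto simp: D_def)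
  then obtain Q N where Q: "finite Q" "Q \<subseteq> R" "N > 0" and
    tr: "\<And>e e' c. sim Q N e e' \<Longrightarrow> c \<in> centers D e \<Longrightarrow>
      \<exists>c'. True \<and> (\<forall>p\<in>E. rv ord (N1 ^ 2) (poly (p e) c) = rv ord (N1 ^ 2) (poly (p e') c'))"
    by (rule transfersE) (rule that; assumption)
  have hi: "(pderiv ^^ k) (pderiv p) = (pderiv ^^ Suc k) p" for k and p :: "'k poly"
    by (simp add: funpow_swap1)
  show ?thesis unfolding transfers_def
  proof (intro exI[of _ Q] exI[of _ N] conjI allI impI Q)
    fix e e' c assume s: "sim Q N e e'" and c: "nzroot q e c"
    obtain c0 where c0: "c0 \<in> centers D e" and cl: "\<And>r. r \<in> centers D e \<Longrightarrow> c - r \<preceq> c - c0"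
      using ex_closest_center[OF fD, of e c] by blast
    obtain c0' where c0': "\<And>p. p \<in> E \<Longrightarrow> rv ord (N1 ^ 2) (poly (p e) c0) = rv ord (N1 ^ 2) (poly (p e') c0')"
      using tr[OF s c0] by blast
    have E_I: "(\<lambda>e. (pderiv ^^ i) (p e)) \<in> E" if "p \<in> insert q rs" "i \<le> Suc d" for p i
      unfolding E_def by (rule image_eqI[of _ _ "(p, i)"]) (use that in auto)
    have near: "c - r \<preceq> c - c0" if "p \<in> E" "\<And>e. degree (p e) \<le> d" "nzroot p e r" for p r
      using that by (intro cl) (auto simp: centers_def D_def)
    have rvE: "rv ord (N1 ^ 2) (poly ((pderiv ^^ i) (p e)) c0) = rv ord (N1 ^ 2) (poly ((pderiv ^^ i) (p e')) c0')"
      if "p \<in> insert q rs" "i \<le> Suc d" for p i using c0'[OF E_I[OF that]] .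
    have degE: "degree (p e) \<le> Suc d" if "p \<in> insert q rs" for p e using that q rs by (auto intro: le_SucI)
    have rvc: "rv ord (N1 ^ 2) (coeff (pcompose (p e) [:c0, 1:]) i) = rv ord (N1 ^ 2) (coeff (pcompose (p e') [:c0', 1:]) i)"
      if "p \<in> insert q rs" for p i
      by (rule rv_shift_coeff[where D = "Suc d"]) (use rvE degE that in auto)
    show "\<exists>c'. poly (q e') c' = 0 \<and> (\<forall>p\<in>rs. rv ord n (poly (p e) c) = rv ord n (poly (p e') c'))"
    proof (cases "c = c0")
      case True
      \<comment> \<open>A root that is itself a centre moves along with the centre: \<open>q\<close>
        belongs to \<open>E\<close>, and a value in the class of 0 is 0.\<close>
      have "rv ord n (poly (p e) c) = rv ord n (poly (p e') c0')" if "p \<in> insert q rs" for p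
      proof (rule rv_dvd)
        show "n dvd N1 ^ 2" by (simp add: N1_def n1_def power2_eq_square)
        show "rv ord (N1 ^ 2) (poly (p e) c) = rv ord (N1 ^ 2) (poly (p e') c0')"
          using rvE[OF that, of 0] True by simp
      qed
      then show ?thesis using c by (intro exI[of _ c0']) force
    next
      case False
      define z where "z = c - c0"
      have z: "z \<noteq> 0" "c = c0 + z" using False by (auto simp: z_def)
      have closest: "c - r \<preceq> c - c0" if "p \<in> insert q rs" "i \<le> Suc d" "\<And>e. degree ((pderiv ^^ i) (p e)) \<le> d"
        "(pderiv ^^ i) (p e) \<noteq> 0" "poly ((pderiv ^^ i) (p e)) r = 0" for p i r
        using near[OF E_I[OF that(1,2)]] that by blast
      have "\<exists>z'. poly (pcompose (q e') [:c0', 1:]) z' = 0 \<and> rv ord n1 z' = rv ord n1 z"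
      proof (rule perturb_root[where f = "pcompose (q e) [:c0, 1:]" and D = "Suc d" and \<mu> = \<mu> and N = N1])
        show "poly (pcompose (q e) [:c0, 1:]) z = 0" using c z by (simp add: poly_pcompose)
        show "pcompose (q e) [:c0, 1:] \<noteq> 0" using c by (simp add: pcompose_eq_0_iff)
        show "degree (pcompose (q e) [:c0, 1:]) \<le> Suc d" "degree (pcompose (q e') [:c0', 1:]) \<le> Suc d"
          using q by (simp_all add: degree_pcompose)
        show "rv ord (N1\<^sup>2) (coeff (pcompose (q e) [:c0, 1:]) i) = rv ord (N1\<^sup>2) (coeff (pcompose (q e') [:c0', 1:]) i)" for i
          by (rule rvc) simp
        have dq: "degree ((pderiv ^^ Suc k) (q e)) \<le> d" for k e
          using q(2)[of e] unfolding degree_higher_pderiv by simp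
        have "poly (pderiv (q e)) c \<preceq> of_nat (nu d d) * coeff (pcompose (pderiv (q e)) [:c0, 1:]) i * (c - c0) ^ i" for i
        proof (rule no_cancellation)
          show "degree (pderiv (q e)) \<le> d" using q(2)[of e] by (simp add: degree_pderiv)
          fix k r assume "k < d" "(pderiv ^^ k) (pderiv (q e)) \<noteq> 0" "poly ((pderiv ^^ k) (pderiv (q e))) r = 0"
          then show "c - r \<preceq> c - c0" unfolding hi
            by (intro closest[of q "Suc k"]) (use dq in auto)
        qed (rule False)
        then show "poly (pderiv (pcompose (q e) [:c0, 1:])) z \<preceq> of_nat \<mu> * coeff (pderiv (pcompose (q e) [:c0, 1:])) i * z ^ i" for i
          by (simp add: pderiv_pcompose pderiv_pCons poly_pcompose \<mu>_def z_def)
      qed (use pos z in \<open>auto simp: N1_def\<close>)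
      then obtain z' where z': "poly (q e') (c0' + z') = 0" "rv ord n1 z' = rv ord n1 z"
        by (auto simp: poly_pcompose)
      have "rv ord n (poly (r e) c) = rv ord n (poly (r e') (c0' + z'))" if r: "r \<in> rs" for r
      proof -
        have "rv ord n (poly (pcompose (r e) [:c0, 1:]) z) = rv ord n (poly (pcompose (r e') [:c0', 1:]) z')"
        proof (rule rv_poly[where \<mu> = \<mu>])
          fix i
          have "n * \<mu> dvd N1 ^ 2" by (simp add: N1_def n1_def power2_eq_square)
          then show "rv ord (n * \<mu>) (coeff (pcompose (r e) [:c0, 1:]) i) = rv ord (n * \<mu>) (coeff (pcompose (r e') [:c0', 1:]) i)"
            by (rule rv_dvd) (use rvc[of r i] r in simp)
          have "poly (r e) c \<preceq> of_nat (nu d d) * coeff (pcompose (r e) [:c0, 1:]) i * (c - c0) ^ i"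
          proof (rule no_cancellation)
            fix k s assume "k < d" "(pderiv ^^ k) (r e) \<noteq> 0" "poly ((pderiv ^^ k) (r e)) s = 0"
            then show "c - s \<preceq> c - c0"
              by (intro closest[of r k]) (use r rs(3)[OF r] in \<open>auto simp: degree_higher_pderiv intro: le_diff_conv[THEN iffD2] trans_le_add1\<close>)
          qed (use False r rs(3) in auto)
          then show "poly (pcompose (r e) [:c0, 1:]) z \<preceq> of_nat \<mu> * coeff (pcompose (r e) [:c0, 1:]) i * z ^ i"
            using z by (simp add: poly_pcompose \<mu>_def)
        qed (use z' in \<open>simp add: n1_def\<close>)
        then show ?thesis using z by (simp add: poly_pcompose)
      qed
      then show ?thesis using z' by blast
    qed
  qed
qed

text \<open>Induction on the degree bound. Where the coefficient of index \<open>Suc d\<close>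
  vanishes, which its class reveals, \<open>q\<close> has smaller degree. Elsewhere each member of
  \<open>ps\<close> is replaced by its pseudo-remainder modulo \<open>q\<close>, of degree at most
  \<open>d\<close> as \<open>root_transfer_step\<close> demands, and the power of the coefficient is
  cancelled afterwards.\<close>

lemma root_transfer:
  assumes R: "fring R" and "fring.fpoly R q" "\<And>e. degree (q e) \<le> d" "finite ps"
    "\<And>p. p \<in> ps \<Longrightarrow> fring.fpoly R p" "n > 0"
  shows "root_transfer R q ps n"
  using assms(2-)
proof (induction d arbitrary: q ps n)
  case 0
  have "\<not> nzroot q e c" for e c
  proof -
    have "degree (q e) = 0" using 0 by simp
    then obtain a where "q e = [:a:]" by (metis degree_eq_zeroE)
    then show ?thesis by auto
  qed
  then show ?case unfolding transfers_def by (intro exI[of _ "{}"] exI[of _ 1]) auto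
next
  case (Suc d)
  interpret fring R by (rule R)
  define a where "a = (\<lambda>e. coeff (q e) (Suc d))"
  have a: "a \<in> R" unfolding a_def using Suc.prems by (intro fpoly_coeff)
  define q1 where "q1 = (\<lambda>e. q e - monom (a e) (Suc d))"
  have "fpoly q1" unfolding q1_def using Suc.prems a by (intro fpoly_diff fpoly_monom)
  moreover have "degree (q1 e) \<le> d" for e
  proof (rule degree_le, intro allI impI)
    fix i assume "d < i"
    then show "coeff (q1 e) i = 0"
      using Suc.prems(2)[of e] by (cases "i = Suc d") (auto simp: q1_def a_def intro: coeff_eq_0)
  qed
  ultimately have "root_transfer R q1 ps n" using Suc by blast
  then obtain Q1 N1 where Q1: "finite Q1" "Q1 \<subseteq> R" "N1 > 0" and
    tr1: "\<And>e e' c. sim Q1 N1 e e' \<Longrightarrow> nzroot q1 e c \<Longrightarrow>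
      \<exists>c'. poly (q1 e') c' = 0 \<and> (\<forall>p\<in>ps. rv ord n (poly (p e) c) = rv ord n (poly (p e') c'))"
    by (rule transfersE) (rule that; assumption)
  have "\<exists>r j. fpoly r \<and> (\<forall>e. degree (r e) \<le> d) \<and>
     (\<forall>e c. poly (q e) c = 0 \<longrightarrow> poly (r e) c = a e ^ j * poly (p e) c)" if "p \<in> ps" for p
    unfolding a_def using Suc.prems that by (intro pseudo_remainder) auto
  then obtain r j where r: "\<And>p. p \<in> ps \<Longrightarrow> fpoly (r p)" "\<And>p e. p \<in> ps \<Longrightarrow> degree (r p e) \<le> d"
    "\<And>p e c. p \<in> ps \<Longrightarrow> poly (q e) c = 0 \<Longrightarrow> poly (r p e) c = a e ^ j p * poly (p e) c" by metis
  have "root_transfer R q (r ` ps) n"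
    by (rule root_transfer_step[OF R Suc.prems(1,2,5)]) (use Suc r in auto)
  then obtain Q2 N2 where Q2: "finite Q2" "Q2 \<subseteq> R" "N2 > 0" and
    tr2: "\<And>e e' c. sim Q2 N2 e e' \<Longrightarrow> nzroot q e c \<Longrightarrow>
      \<exists>c'. poly (q e') c' = 0 \<and> (\<forall>p\<in>r ` ps. rv ord n (poly (p e) c) = rv ord n (poly (p e') c'))"
    by (rule transfersE) (rule that; assumption)
  define Q where "Q = insert a (Q1 \<union> Q2)"
  define N where "N = n * (N1 * N2)"
  show ?case unfolding transfers_def
  proof (intro exI[of _ Q] exI[of _ N] conjI allI impI)
    show "finite Q" "Q \<subseteq> R" "N > 0" using Q1 Q2 a Suc.prems by (auto simp: Q_def N_def)
    fix e e' c assume s: "sim Q N e e'" and c: "nzroot q e c"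
    have s1: "sim Q1 N1 e e'" by (rule sim_mono[OF s]) (auto simp: Q_def N_def)
    have s2: "sim Q2 N2 e e'" by (rule sim_mono[OF s]) (auto simp: Q_def N_def)
    have s3: "sim {a} n e e'" by (rule sim_mono[OF s]) (auto simp: Q_def N_def)
    have rva: "rv ord n (a e) = rv ord n (a e')" using s3 by (simp add: sim_def)
    show "\<exists>c'. poly (q e') c' = 0 \<and> (\<forall>p\<in>ps. rv ord n (poly (p e) c) = rv ord n (poly (p e') c'))"
    proof (cases "a e = 0")
      case True
      then have "a e' = 0" using rva by (metis rv_eq_0_iff(2))
      then show ?thesis using True tr1[OF s1, of c] c by (simp add: q1_def)
    next
      case False
      obtain c' where c': "poly (q e') c' = 0" "\<And>p. p \<in> ps \<Longrightarrow> rv ord n (poly (r p e) c) = rv ord n (poly (r p e') c')"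
        using tr2[OF s2 c] by blast
      have "rv ord n (poly (p e) c) = rv ord n (poly (p e') c')" if "p \<in> ps" for p
      proof (rule rv_mult_cancel)
        show "a e ^ j p \<noteq> 0" using False by simp
        show "rv ord n (a e ^ j p) = rv ord n (a e' ^ j p)" using rva by (rule rv_power)
        show "rv ord n (a e ^ j p * poly (p e) c) = rv ord n (a e' ^ j p * poly (p e') c')"
          using r(3)[OF that] c c' that by metis
      qed
      then show ?thesis using c' by blast
    qed
  qed
qed

text \<open>With the roots of all derivatives, including order 0, as centres, no root has to be
  corrected: the unchanged difference \<open>y - c0\<close> is attached to the transferred
  centre.\<close>

lemma point_transfer:
  assumes R: "fring R" and ps: "finite ps" "\<And>p. p \<in> ps \<Longrightarrow> fring.fpoly R p" and n: "n > 0"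
  shows "transfers R (\<lambda>_ _. True) (\<lambda>_ _. True) ps n"
proof -
  interpret fring R by (rule R)
  have "\<forall>p\<in>ps. \<exists>d. \<forall>e. degree (p e) \<le> d" using ps fpoly_degree by blast
  then obtain df where df: "\<And>p e. p \<in> ps \<Longrightarrow> degree (p e) \<le> df p" by metis
  define d where "d = (\<Sum>p\<in>ps. df p)"
  have d: "degree (p e) \<le> d" if "p \<in> ps" for p e
    using df[OF that, of e] member_le_sum[OF that, of df] ps unfolding d_def by fastforce
  define E where "E = (\<lambda>(p, i) e. (pderiv ^^ i) (p e)) ` (ps \<times> {..d})"
  have fE: "finite E" unfolding E_def using ps by auto
  have pE: "fpoly p" if "p \<in> E" for p using that ps fpoly_higher_pderiv by (auto simp: E_def)
  have E_I: "(\<lambda>e. (pderiv ^^ i) (p e)) \<in> E" if "p \<in> ps" "i \<le> d" for p i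
    unfolding E_def by (rule image_eqI[of _ _ "(p, i)"]) (use that in auto)
  define \<mu> where "\<mu> = nu d d"
  define N1 where "N1 = n * \<mu>"
  have pos: "N1 > 0" using n by (simp add: N1_def \<mu>_def)
  have "root_transfer R p E N1" if "p \<in> E" for p
    using fpoly_degree[OF pE[OF that]] pE that fE pos root_transfer[OF R] by blast
  then have "transfers R (\<lambda>e c. c \<in> centers E e) (\<lambda>_ _. True) E N1"
    using R fE pE pos by (intro transfers_centers) auto
  then obtain Q N where Q: "finite Q" "Q \<subseteq> R" "N > 0" and
    tr: "\<And>e e' c. sim Q N e e' \<Longrightarrow> c \<in> centers E e \<Longrightarrow>
      \<exists>c'. True \<and> (\<forall>p\<in>E. rv ord N1 (poly (p e) c) = rv ord N1 (poly (p e') c'))"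
    by (rule transfersE) (rule that; assumption)
  show ?thesis unfolding transfers_def
  proof (intro exI[of _ Q] exI[of _ N] conjI allI impI Q)
    fix e e' y assume s: "sim Q N e e'"
    obtain c0 where c0: "c0 \<in> centers E e" and cl: "\<And>r. r \<in> centers E e \<Longrightarrow> y - r \<preceq> y - c0"
      using ex_closest_center[OF fE, of e y] by blast
    obtain c0' where c0': "\<And>p. p \<in> E \<Longrightarrow> rv ord N1 (poly (p e) c0) = rv ord N1 (poly (p e') c0')"
      using tr[OF s c0] by blast
    have "rv ord n (poly (p e) y) = rv ord n (poly (p e') (c0' + (y - c0)))" if p: "p \<in> ps" for p
    proof (cases "y = c0")
      case True
      have "n dvd N1" by (simp add: N1_def)
      from rv_dvd[OF this c0'[OF E_I[OF p, of 0]]] show ?thesis using True by simp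
    next
      case False
      have "rv ord n (poly (pcompose (p e) [:c0, 1:]) (y - c0)) = rv ord n (poly (pcompose (p e') [:c0', 1:]) (y - c0))"
      proof (rule rv_poly[where \<mu> = \<mu>])
        show "rv ord (n * \<mu>) (coeff (pcompose (p e) [:c0, 1:]) i) = rv ord (n * \<mu>) (coeff (pcompose (p e') [:c0', 1:]) i)" for i
          by (rule rv_shift_coeff[where D = d]) (use c0'[OF E_I[OF p]] d[OF p] in \<open>auto simp: N1_def\<close>)
        have "poly (p e) y \<preceq> of_nat (nu d d) * coeff (pcompose (p e) [:c0, 1:]) i * (y - c0) ^ i" for i
        proof (rule no_cancellation)
          fix k r assume "k < d" "(pderiv ^^ k) (p e) \<noteq> 0" "poly ((pderiv ^^ k) (p e)) r = 0"
          then show "y - r \<preceq> y - c0" using E_I[OF p, of k] by (intro cl) (auto simp: centers_def)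
        qed (use False d[OF p] in auto)
        then show "poly (pcompose (p e) [:c0, 1:]) (y - c0) \<preceq> of_nat \<mu> * coeff (pcompose (p e) [:c0, 1:]) i * (y - c0) ^ i" for i
          by (simp add: poly_pcompose \<mu>_def)
      qed simp
      then show ?thesis by (simp add: poly_pcompose)
    qed
    then show "\<exists>c'. True \<and> (\<forall>p\<in>ps. rv ord n (poly (p e) y) = rv ord n (poly (p e') c'))" by blast
  qed
qed

end

section \<open>Elimination of valued field quantifiers\<close>

lemma dom_prod_iff: "e \<in> dom_prod ord ss \<longleftrightarrow> list_all2 (\<lambda>x s. x \<in> dom_sort ord s) e ss"
proof (induction ss arbitrary: e)
  case (Cons s ss)
  then show ?case by (auto simp: dom_prod_def set_Cons_def list_all2_Cons2)
qed (auto simp: dom_prod_def)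

lemma dom_prod_Cons: "x # e \<in> dom_prod ord (s # ss) \<longleftrightarrow> x \<in> dom_sort ord s \<and> e \<in> dom_prod ord ss"
  by (simp add: dom_prod_iff)

lemma dom_prod_length: "e \<in> dom_prod ord ss \<Longrightarrow> length e = length ss"
  by (auto simp: dom_prod_iff dest: list_all2_lengthD)

lemma dom_prod_nth: "e \<in> dom_prod ord ss \<Longrightarrow> i < length ss \<Longrightarrow> e ! i \<in> dom_sort ord (ss ! i)"
  by (auto simp: dom_prod_iff list_all2_conv_all_nth)

inductive_cases has_sort_VarE: "has_sort A \<Gamma> (Var i) s"
inductive_cases has_sort_CstE: "has_sort A \<Gamma> (Cst c) s"
inductive_cases has_sort_ZeroE: "has_sort A \<Gamma> Zero s"
inductive_cases has_sort_OneE: "has_sort A \<Gamma> One s"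
inductive_cases has_sort_AddE: "has_sort A \<Gamma> (Add t u) s"
inductive_cases has_sort_SubE: "has_sort A \<Gamma> (Sub t u) s"
inductive_cases has_sort_MulE: "has_sort A \<Gamma> (Mul t u) s"
inductive_cases has_sort_RvE: "has_sort A \<Gamma> (Rv n t) s"
inductive_cases has_sort_HenE: "has_sort A \<Gamma> (Hen m n ts t) s"

lemmas has_sort_elims = has_sort_VarE has_sort_CstE has_sort_ZeroE has_sort_OneE has_sort_AddE
  has_sort_SubE has_sort_MulE has_sort_RvE has_sort_HenE

lemma has_sort_VF_val:
  "has_sort A \<Gamma> t VF \<Longrightarrow> A \<subseteq> all_elems ord \<Longrightarrow> e \<in> dom_prod ord \<Gamma> \<Longrightarrow>
    trm_val ord e t = Fld (fld (trm_val ord e t))"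
proof (cases t)
  case (Var i)
  assume "has_sort A \<Gamma> t VF" "e \<in> dom_prod ord \<Gamma>"
  then show ?thesis using Var dom_prod_nth[of e ord \<Gamma> i] by (auto elim!: has_sort_VarE)
next
  case (Cst c)
  assume "has_sort A \<Gamma> t VF"
  then show ?thesis using Cst by (cases c) (auto elim!: has_sort_CstE)
qed (auto elim: has_sort_elims)

context henselian
begin

definition term_functions :: "'k elem set \<Rightarrow> srt list \<Rightarrow> ('k elem list \<Rightarrow> 'k) set" where
  "term_functions A \<Gamma> = {\<lambda>e. fld (trm_val ord e t) | t. Hen_term A \<Gamma> t VF}"

lemma term_functionsI: "Hen_term A \<Gamma> t VF \<Longrightarrow> (\<lambda>e. fld (trm_val ord e t)) \<in> term_functions A \<Gamma>"
  by (auto simp: term_functions_def)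

lemma fring_term_functions: "fring (term_functions A \<Gamma>)"
proof
  show "(\<lambda>_. 0) \<in> term_functions A \<Gamma>"
    using term_functionsI[of A \<Gamma> Zero] by (simp add: Hen_term_def has_sort.intros)
  show "(\<lambda>_. 1) \<in> term_functions A \<Gamma>"
    using term_functionsI[of A \<Gamma> One] by (simp add: Hen_term_def has_sort.intros)
  fix f g assume "f \<in> term_functions A \<Gamma>" "g \<in> term_functions A \<Gamma>"
  then obtain s t where st: "Hen_term A \<Gamma> s VF" "f = (\<lambda>e. fld (trm_val ord e s))"
    "Hen_term A \<Gamma> t VF" "g = (\<lambda>e. fld (trm_val ord e t))" unfolding term_functions_def by blast
  show "(\<lambda>e. f e + g e) \<in> term_functions A \<Gamma>"
    using term_functionsI[of A \<Gamma> "Add s t"] st by (simp add: Hen_term_def has_sort.intros)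
  show "(\<lambda>e. f e - g e) \<in> term_functions A \<Gamma>"
    using term_functionsI[of A \<Gamma> "Sub s t"] st by (simp add: Hen_term_def has_sort.intros)
  show "(\<lambda>e. f e * g e) \<in> term_functions A \<Gamma>"
    using term_functionsI[of A \<Gamma> "Mul s t"] st by (simp add: Hen_term_def has_sort.intros)
qed

text \<open>The smaller language has no symbol from an auxiliary sort to the field, so its field
  terms are built from constants and variables by ring operations.\<close>

lemma term_as_polynomial:
  assumes "Hen_term A (VF # \<Gamma>) t VF"
  shows "\<exists>P. fring.fpoly (term_functions A \<Gamma>) P \<and>
    (\<forall>e x. fld (trm_val ord (x # e) t) = poly (P e) (fld x))"
proof -
  interpret fring "term_functions A \<Gamma>" by (rule fring_term_functions)
  have const: "\<exists>P. fpoly P \<and> (\<forall>e x. fld (trm_val ord (x # e) t) = poly (P e) (fld x))"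
    if "Hen_term A \<Gamma> t' VF" "\<And>x e. trm_val ord (x # e) t = trm_val ord e t'" for t t'
    using fpoly_const[OF term_functionsI[OF that(1)]] that(2)
    by (intro exI[of _ "\<lambda>e. [:fld (trm_val ord e t'):]"]) auto
  show ?thesis using assms
  proof (induction t)
    case (Var i)
    show ?case
    proof (cases i)
      case 0
      have "fpoly (\<lambda>e. [:0, 1:])" using fpoly_linear[OF zero] by simp
      then show ?thesis using 0 by (intro exI[of _ "\<lambda>e. [:0, 1:]"]) auto
    next
      case (Suc j)
      then have "Hen_term A \<Gamma> (Var j) VF" using Var
        by (auto simp: Hen_term_def elim!: has_sort_VarE) (metis has_sort.intros(1))
      then show ?thesis using Suc by (intro const) auto
    qed
  next
    case (Cst c)
    then have "Hen_term A \<Gamma> (Cst c) VF"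
      by (auto simp: Hen_term_def elim!: has_sort_CstE) (metis has_sort.intros(2))
    then show ?case by (intro const) auto
  next
    case Zero
    show ?case by (intro const[of Zero]) (auto simp: Hen_term_def intro: has_sort.intros)
  next
    case One
    show ?case by (intro const[of One]) (auto simp: Hen_term_def intro: has_sort.intros)
  next
    case (Add s t)
    then obtain P Q where "fpoly P" "fpoly Q" "\<And>e x. fld (trm_val ord (x # e) s) = poly (P e) (fld x)"
      "\<And>e x. fld (trm_val ord (x # e) t) = poly (Q e) (fld x)"
      unfolding Hen_term_def by (auto elim!: has_sort_AddE)
    then show ?case by (intro exI[of _ "\<lambda>e. P e + Q e"]) (auto intro: fpoly_add)
  next
    case (Sub s t)
    then obtain P Q where "fpoly P" "fpoly Q" "\<And>e x. fld (trm_val ord (x # e) s) = poly (P e) (fld x)"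
      "\<And>e x. fld (trm_val ord (x # e) t) = poly (Q e) (fld x)"
      unfolding Hen_term_def by (auto elim!: has_sort_SubE)
    then show ?case by (intro exI[of _ "\<lambda>e. P e - Q e"]) (auto intro: fpoly_diff)
  next
    case (Mul s t)
    then obtain P Q where "fpoly P" "fpoly Q" "\<And>e x. fld (trm_val ord (x # e) s) = poly (P e) (fld x)"
      "\<And>e x. fld (trm_val ord (x # e) t) = poly (Q e) (fld x)"
      unfolding Hen_term_def by (auto elim!: has_sort_MulE)
    then show ?case by (intro exI[of _ "\<lambda>e. P e * Q e"]) (auto intro: fpoly_mult)
  next
    case (Rv n t)
    then show ?case by (auto simp: Hen_term_def elim: has_sort_RvE)
  next
    case (Hen m n ts t)
    then show ?case by (simp add: Hen_term_def)
  qed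
qed

text \<open>For the same reason a variable of auxiliary sort cannot occur in such a term.\<close>

lemma term_independent_of_RV:
  assumes "Hen_term A (RVs n # \<Gamma>) t VF"
  shows "\<exists>t'. Hen_term A \<Gamma> t' VF \<and> (\<forall>e x. trm_val ord (x # e) t = trm_val ord e t')"
  using assms
proof (induction t)
  case (Var i)
  then obtain j where "i = Suc j" "Hen_term A \<Gamma> (Var j) VF"
    by (cases i) (auto simp: Hen_term_def elim!: has_sort_VarE, metis has_sort.intros(1))
  then show ?case by (intro exI[of _ "Var j"]) auto
next
  case (Cst c)
  then have "Hen_term A \<Gamma> (Cst c) VF"
    by (auto simp: Hen_term_def elim!: has_sort_CstE) (metis has_sort.intros(2))
  then show ?case by (intro exI[of _ "Cst c"]) auto
next
  case Zero
  show ?case by (intro exI[of _ Zero]) (auto simp: Hen_term_def intro: has_sort.intros)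
next
  case One
  show ?case by (intro exI[of _ One]) (auto simp: Hen_term_def intro: has_sort.intros)
next
  case (Add s t)
  then obtain s' t' where "Hen_term A \<Gamma> s' VF" "Hen_term A \<Gamma> t' VF"
    "\<And>e x. trm_val ord (x # e) s = trm_val ord e s'" "\<And>e x. trm_val ord (x # e) t = trm_val ord e t'"
    unfolding Hen_term_def by (auto elim!: has_sort_AddE)
  then show ?case by (intro exI[of _ "Add s' t'"]) (auto simp: Hen_term_def intro: has_sort.intros)
next
  case (Sub s t)
  then obtain s' t' where "Hen_term A \<Gamma> s' VF" "Hen_term A \<Gamma> t' VF"
    "\<And>e x. trm_val ord (x # e) s = trm_val ord e s'" "\<And>e x. trm_val ord (x # e) t = trm_val ord e t'"
    unfolding Hen_term_def by (auto elim!: has_sort_SubE)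
  then show ?case by (intro exI[of _ "Sub s' t'"]) (auto simp: Hen_term_def intro: has_sort.intros)
next
  case (Mul s t)
  then obtain s' t' where "Hen_term A \<Gamma> s' VF" "Hen_term A \<Gamma> t' VF"
    "\<And>e x. trm_val ord (x # e) s = trm_val ord e s'" "\<And>e x. trm_val ord (x # e) t = trm_val ord e t'"
    unfolding Hen_term_def by (auto elim!: has_sort_MulE)
  then show ?case by (intro exI[of _ "Mul s' t'"]) (auto simp: Hen_term_def intro: has_sort.intros)
next
  case (Rv n t)
  then show ?case by (auto simp: Hen_term_def elim: has_sort_RvE)
next
  case (Hen m n ts t)
  then show ?case by (simp add: Hen_term_def)
qed

section \<open>Dependence of formulas on leading terms\<close>

definition agree :: "srt list \<Rightarrow> ('k elem list \<Rightarrow> 'k) set \<Rightarrow> nat \<Rightarrow> 'k elem list \<Rightarrow> 'k elem list \<Rightarrow> bool" where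
  "agree \<Gamma> Q N e e' \<longleftrightarrow> e \<in> dom_prod ord \<Gamma> \<and> e' \<in> dom_prod ord \<Gamma> \<and>
     (\<forall>i<length \<Gamma>. \<Gamma> ! i \<noteq> VF \<longrightarrow> e ! i = e' ! i) \<and> sim Q N e e'"

lemma agree_mono: "agree \<Gamma> Q N e e' \<Longrightarrow> Q' \<subseteq> Q \<Longrightarrow> N' dvd N \<Longrightarrow> agree \<Gamma> Q' N' e e'"
  using sim_mono[of Q N e e' Q' N'] unfolding agree_def by simp

lemma agree_sym: "agree \<Gamma> Q N e e' \<Longrightarrow> agree \<Gamma> Q N e' e"
  unfolding agree_def sim_def by auto

text \<open>How the relation depends on the auxiliary data need not be described by a formula, which makes
  quantifiers over the auxiliary sorts harmless.\<close>

definition determined :: "'k elem set \<Rightarrow> srt list \<Rightarrow> ('k elem list \<Rightarrow> 'b) \<Rightarrow> bool" where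
  "determined A \<Gamma> F \<longleftrightarrow> (\<exists>Q N. finite Q \<and> Q \<subseteq> term_functions A \<Gamma> \<and> N > 0 \<and>
     (\<forall>e e'. agree \<Gamma> Q N e e' \<longrightarrow> F e = F e'))"

lemma determinedI:
  "finite Q \<Longrightarrow> Q \<subseteq> term_functions A \<Gamma> \<Longrightarrow> N > 0 \<Longrightarrow>
    (\<And>e e'. agree \<Gamma> Q N e e' \<Longrightarrow> F e = F e') \<Longrightarrow> determined A \<Gamma> F"
  unfolding determined_def by (rule exI[of _ Q], rule exI[of _ N]) simp

lemma determined_comb:
  assumes "determined A \<Gamma> F" "determined A \<Gamma> G"
  shows "determined A \<Gamma> (\<lambda>e. H (F e) (G e))"
proof -
  obtain Q N where 1: "finite Q" "Q \<subseteq> term_functions A \<Gamma>" "N > 0" "\<And>e e'. agree \<Gamma> Q N e e' \<Longrightarrow> F e = F e'"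
    using assms(1) unfolding determined_def by blast
  obtain Q' N' where 2: "finite Q'" "Q' \<subseteq> term_functions A \<Gamma>" "N' > 0" "\<And>e e'. agree \<Gamma> Q' N' e e' \<Longrightarrow> G e = G e'"
    using assms(2) unfolding determined_def by blast
  show ?thesis
  proof (rule determinedI)
    show "finite (Q \<union> Q')" "Q \<union> Q' \<subseteq> term_functions A \<Gamma>" "N * N' > 0" using 1 2 by auto
    fix e e' assume a: "agree \<Gamma> (Q \<union> Q') (N * N') e e'"
    have "agree \<Gamma> Q N e e'" by (rule agree_mono[OF a]) auto
    moreover have "agree \<Gamma> Q' N' e e'" by (rule agree_mono[OF a]) auto
    ultimately show "H (F e) (G e) = H (F e') (G e')" using 1(4) 2(4) by metis
  qed
qed

text \<open>Such a term is a variable, a constant or the class of a field term; only the last puts a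
  function into \<open>Q\<close>.\<close>

lemma determined_RV_term:
  assumes "Hen_term A \<Gamma> t (RVs n)"
  shows "determined A \<Gamma> (\<lambda>e. trm_val ord e t)"
proof (cases t)
  case (Var i)
  then have "i < length \<Gamma>" "\<Gamma> ! i \<noteq> VF" using assms by (auto simp: Hen_term_def elim!: has_sort_VarE)
  then show ?thesis using Var by (intro determinedI[of "{}" _ _ 1]) (auto simp: agree_def)
next
  case (Cst c)
  then show ?thesis by (intro determinedI[of "{}" _ _ 1]) auto
next
  case (Rv m s)
  then have "m > 0" "Hen_term A \<Gamma> s VF" using assms by (auto simp: Hen_term_def elim!: has_sort_RvE)
  then show ?thesis using Rv
    by (intro determinedI[of "{\<lambda>e. fld (trm_val ord e s)}" _ _ m])
      (auto simp: agree_def sim_def intro: term_functionsI)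
qed (use assms in \<open>auto simp: Hen_term_def elim: has_sort_elims\<close>)

lemma determined_list:
  assumes "\<forall>t\<in>set ts. determined A \<Gamma> (\<lambda>e. trm_val ord e t)"
  shows "determined A \<Gamma> (\<lambda>e. map (trm_val ord e) ts)"
  using assms
proof (induction ts)
  case Nil
  show ?case by (intro determinedI[of "{}" _ _ 1]) auto
next
  case (Cons t ts)
  then show ?case using determined_comb[of A \<Gamma> "\<lambda>e. trm_val ord e t" _ Cons] by simp
qed

lemma determined_1: "determined A \<Gamma> F \<Longrightarrow> determined A \<Gamma> (\<lambda>e. H (F e))"
  using determined_comb[of A \<Gamma> F F "\<lambda>a _. H a"] by simp

text \<open>The members of \<open>Q\<close> are polynomials in the quantified variable, and
  \<open>point_transfer\<close> for these polynomials moves the witness. One direction suffices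
  because \<open>agree\<close> is symmetric.\<close>

lemma determined_Exi_VF:
  assumes "determined A (VF # \<Gamma>) F"
  shows "determined A \<Gamma> (\<lambda>e. \<exists>x\<in>dom_sort ord VF. F (x # e))"
proof -
  obtain Q N where Q: "finite Q" "Q \<subseteq> term_functions A (VF # \<Gamma>)" "N > 0"
    and F: "\<And>e e'. agree (VF # \<Gamma>) Q N e e' \<Longrightarrow> F e = F e'"
    using assms unfolding determined_def by blast
  have "\<exists>P. fring.fpoly (term_functions A \<Gamma>) P \<and> (\<forall>e x. q (x # e) = poly (P e) (fld x))" if "q \<in> Q" for q
    using Q that term_as_polynomial unfolding term_functions_def by fastforce
  then obtain P where P: "\<And>q. q \<in> Q \<Longrightarrow> fring.fpoly (term_functions A \<Gamma>) (P q)"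
    "\<And>q e x. q \<in> Q \<Longrightarrow> q (x # e) = poly (P q e) (fld x)" by metis
  have "transfers (term_functions A \<Gamma>) (\<lambda>_ _. True) (\<lambda>_ _. True) (P ` Q) N"
    using Q P by (intro point_transfer fring_term_functions) auto
  then obtain Q' N' where Q': "finite Q'" "Q' \<subseteq> term_functions A \<Gamma>" "N' > 0"
    and tr: "\<And>e e' c. sim Q' N' e e' \<Longrightarrow> True \<Longrightarrow>
      \<exists>c'. True \<and> (\<forall>p\<in>P ` Q. rv ord N (poly (p e) c) = rv ord N (poly (p e') c'))"
    by (rule transfersE) (rule that; assumption)
  have imp: "\<exists>x\<in>dom_sort ord VF. F (x # e')" if a: "agree \<Gamma> Q' N' e e'" and x: "\<exists>x\<in>dom_sort ord VF. F (x # e)" for e e'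
  proof -
    obtain y where y: "F (Fld y # e)" using x by auto
    have s: "sim Q' N' e e'" using a by (simp add: agree_def)
    obtain y' where y': "\<And>q. q \<in> Q \<Longrightarrow> rv ord N (poly (P q e) y) = rv ord N (poly (P q e') y')"
      using tr[OF s, of y] by blast
    have "agree (VF # \<Gamma>) Q N (Fld y # e) (Fld y' # e')"
      unfolding agree_def
    proof (intro conjI allI impI)
      show "Fld y # e \<in> dom_prod ord (VF # \<Gamma>)" "Fld y' # e' \<in> dom_prod ord (VF # \<Gamma>)"
        using a by (auto simp: agree_def dom_prod_Cons)
      show "sim Q N (Fld y # e) (Fld y' # e')" unfolding sim_def
      proof
        fix q assume "q \<in> Q"
        then show "rv ord N (q (Fld y # e)) = rv ord N (q (Fld y' # e'))" using y'[of q] by (simp add: P(2)[of q])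
      qed
      fix i assume "i < length (VF # \<Gamma>)" "(VF # \<Gamma>) ! i \<noteq> VF"
      then show "(Fld y # e) ! i = (Fld y' # e') ! i" using a by (cases i) (auto simp: agree_def)
    qed
    then show ?thesis using F y by auto
  qed
  show ?thesis
    by (rule determinedI[OF Q']) (use imp agree_sym in blast)
qed

text \<open>The same witness serves both assignments, because the members of \<open>Q\<close> do not
  involve the quantified variable.\<close>

lemma determined_Exi_RV:
  assumes "determined A (RVs n # \<Gamma>) F"
  shows "determined A \<Gamma> (\<lambda>e. \<exists>x\<in>dom_sort ord (RVs n). F (x # e))"
proof -
  obtain Q N where Q: "finite Q" "Q \<subseteq> term_functions A (RVs n # \<Gamma>)" "N > 0"
    and F: "\<And>e e'. agree (RVs n # \<Gamma>) Q N e e' \<Longrightarrow> F e = F e'"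
    using assms unfolding determined_def by blast
  have "\<exists>q'\<in>term_functions A \<Gamma>. \<forall>e x. q (x # e) = q' e" if "q \<in> Q" for q
  proof -
    have "q \<in> term_functions A (RVs n # \<Gamma>)" using Q that by blast
    then obtain t where t: "q = (\<lambda>e. fld (trm_val ord e t))" "Hen_term A (RVs n # \<Gamma>) t VF"
      unfolding term_functions_def by blast
    obtain t' where "Hen_term A \<Gamma> t' VF" "\<And>e x. trm_val ord (x # e) t = trm_val ord e t'"
      using term_independent_of_RV[OF t(2)] by blast
    then show ?thesis using t(1) by (intro bexI[of _ "\<lambda>e. fld (trm_val ord e t')"] term_functionsI) auto
  qed
  then obtain q' where q': "\<And>q. q \<in> Q \<Longrightarrow> q' q \<in> term_functions A \<Gamma>"
    "\<And>q e x. q \<in> Q \<Longrightarrow> q (x # e) = q' q e" by metis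
  show ?thesis
  proof (rule determinedI)
    show "finite (q' ` Q)" "q' ` Q \<subseteq> term_functions A \<Gamma>" "N > 0" using Q q' by auto
    fix e e' assume a: "agree \<Gamma> (q' ` Q) N e e'"
    have "F (x # e) = F (x # e')" if x: "x \<in> dom_sort ord (RVs n)" for x
    proof (rule F, unfold agree_def, intro conjI allI impI)
      show "x # e \<in> dom_prod ord (RVs n # \<Gamma>)" "x # e' \<in> dom_prod ord (RVs n # \<Gamma>)"
        using a x by (auto simp: agree_def dom_prod_Cons)
      show "sim Q N (x # e) (x # e')" unfolding sim_def
      proof
        fix q assume "q \<in> Q"
        then show "rv ord N (q (x # e)) = rv ord N (q (x # e'))"
          using a by (simp add: q'(2)[of q] sim_def agree_def)
      qed
      fix i assume "i < length (RVs n # \<Gamma>)" "(RVs n # \<Gamma>) ! i \<noteq> VF"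
      then show "(x # e) ! i = (x # e') ! i" using a by (cases i) (auto simp: agree_def)
    qed
    then show "(\<exists>x\<in>dom_sort ord (RVs n). F (x # e)) = (\<exists>x\<in>dom_sort ord (RVs n). F (x # e'))" by blast
  qed
qed

text \<open>An equation of field terms asks whether their difference vanishes, which its class
  reveals; an inclusion sees only the values of its terms, all of auxiliary sort.\<close>

lemma determined_formula:
  assumes "A \<subseteq> all_elems ord"
  shows "Hen_formula A \<Gamma> \<phi> \<Longrightarrow> determined A \<Gamma> (\<lambda>e. sat ord e \<phi>)"
proof (induction \<phi> arbitrary: \<Gamma>)
  case (Eq s t)
  then obtain \<sigma> where st: "Hen_term A \<Gamma> s \<sigma>" "Hen_term A \<Gamma> t \<sigma>" by auto
  show ?case
  proof (cases \<sigma>)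
    case VF
    interpret fring "term_functions A \<Gamma>" by (rule fring_term_functions)
    let ?q = "\<lambda>e. fld (trm_val ord e s) - fld (trm_val ord e t)"
    have iff: "sat ord e (Eq s t) \<longleftrightarrow> ?q e = 0" if "e \<in> dom_prod ord \<Gamma>" for e
      using has_sort_VF_val[OF _ assms that, of s] has_sort_VF_val[OF _ assms that, of t] st VF
      unfolding Hen_term_def by (metis eq_iff_diff_eq_0 sat.simps(1))
    show ?thesis
    proof (rule determinedI)
      show "finite {?q}" "{?q} \<subseteq> term_functions A \<Gamma>" "(1::nat) > 0"
        using st VF by (auto intro: diff term_functionsI)
      fix e e' assume a: "agree \<Gamma> {?q} 1 e e'"
      then have "rv ord 1 (?q e) = rv ord 1 (?q e')" by (simp add: agree_def sim_def)
      then have "?q e = 0 \<longleftrightarrow> ?q e' = 0" by (metis rv_eq_0_iff(1))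
      then show "sat ord e (Eq s t) = sat ord e' (Eq s t)" using a iff by (simp only: agree_def)
    qed
  next
    case (RVs n)
    then show ?thesis
      using st determined_comb[OF determined_RV_term[of A \<Gamma> s n] determined_RV_term[of A \<Gamma> t n], of "(=)"] by simp
  qed
next
  case (Incl p q ts)
  then have "determined A \<Gamma> (\<lambda>e. map (trm_val ord e) ts)"
    using determined_RV_term by (intro determined_list) auto
  from determined_1[OF this, of "\<lambda>a. pset ord p a \<subseteq> pset ord q a"] show ?case by simp
next
  case (Neg \<phi>)
  then show ?case using determined_1[of A \<Gamma> "\<lambda>e. sat ord e \<phi>" Not] by simp
next
  case (Conj \<phi> \<psi>)
  then show ?case using determined_comb[of A \<Gamma> "\<lambda>e. sat ord e \<phi>" "\<lambda>e. sat ord e \<psi>" "(\<and>)"] by simp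
next
  case (Exi \<sigma> \<phi>)
  then show ?case using determined_Exi_VF determined_Exi_RV by (cases \<sigma>) fastforce+
qed

section \<open>Local constancy of leading terms and algebraicity of definable points\<close>

lemma common_denominator: "\<exists>s\<in>\<O>. s \<noteq> 0 \<and> ipoly (smult s p)"
proof (induction p)
  case 0
  show ?case by (rule bexI[of _ 1]) auto
next
  case (pCons a p)
  then obtain s where s: "s \<in> \<O>" "s \<noteq> 0" "ipoly (smult s p)" by blast
  obtain t where t: "t \<in> \<O>" "t \<noteq> 0" "t * a \<in> \<O>"
  proof (cases "a \<in> \<O>")
    case True
    then show ?thesis using that[of 1] by simp
  next
    case False
    then show ?thesis using that[of "inverse a"] O_or_inverse[of a] M_O by (cases "a = 0") auto
  qed
  have "ipoly (smult (t * s) p)" using ipoly_smult[OF t(1) s(3)] by simp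
  then have "ipoly (smult (s * t) (pCons a p))" using O_mult[OF s(1) t(3)]
    by (simp add: ipoly_pCons mult.assoc mult.commute[of t s])
  then show ?case using s t by (intro bexI[of _ "s * t"] conjI O_mult) auto
qed

text \<open>The increment of \<open>p\<close> at \<open>b\<close> is \<open>h\<close> times a
  polynomial in \<open>h\<close>. If \<open>h\<close> absorbs a denominator of that polynomial
  divided by \<open>N * p b\<close>, and one more element of \<open>\<M>\<close>, the increment lies
  in \<open>N * p b * \<M>\<close>.\<close>

lemma rv_locally_constant:
  assumes "poly p b \<noteq> 0" "N > 0"
  shows "\<exists>\<epsilon>. \<epsilon> \<noteq> 0 \<and> (\<forall>h. \<epsilon> \<preceq> h \<longrightarrow> rv ord N (poly p b) = rv ord N (poly p (b + h)))"
proof -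
  obtain v r where r: "pcompose p [:b, 1:] = pCons v r" by (metis pCons_cases)
  have v: "v = poly p b" using taylor_coeff[of 0 p b] r by simp
  define w where "w = of_nat N * v"
  have w: "w \<noteq> 0" using assms v by (simp add: w_def)
  obtain s where s: "s \<in> \<O>" "s \<noteq> 0" "ipoly (smult s (smult (1 / w) r))" using common_denominator by blast
  obtain \<pi> where \<pi>: "\<pi> \<in> \<M>" "\<pi> \<noteq> 0" using nontrivial by blast
  have "rv ord N (poly p b) = rv ord N (poly p (b + h))" if h: "s * \<pi> \<preceq> h" for h
  proof -
    obtain u where u: "u \<in> \<O>" "h = s * \<pi> * u" using h unfolding vle_def by blast
    have hO: "h \<in> \<O>" unfolding u using s \<pi> u M_O by (intro O_mult) auto
    have "poly p (b + h) = poly (pCons v r) h" unfolding r[symmetric] by (simp add: poly_pcompose)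
    then have "poly p (b + h) - poly p b = h * poly r h" by (simp add: v)
    also have "\<dots> = w * (\<pi> * (u * poly (smult s (smult (1 / w) r)) h))" using w u by simp
    finally have "poly p (b + h) - poly p b = w * (\<pi> * (u * poly (smult s (smult (1 / w) r)) h))" .
    moreover have "\<pi> * (u * poly (smult s (smult (1 / w) r)) h) \<in> \<M>"
      using \<pi> u s hO by (intro M_mult O_mult ipoly_poly)
    ultimately show ?thesis unfolding rv_eq_iff vlt_def w_def v by blast
  qed
  then show ?thesis using s \<pi> by (intro exI[of _ "s * \<pi>"]) auto
qed

lemma rv_locally_constant_finite:
  assumes "finite S" "\<And>p. p \<in> S \<Longrightarrow> p \<noteq> 0 \<Longrightarrow> poly p b \<noteq> 0" "N > 0"
  shows "\<exists>\<epsilon>. \<epsilon> \<noteq> 0 \<and> (\<forall>p\<in>S. \<forall>h. \<epsilon> \<preceq> h \<longrightarrow> rv ord N (poly p b) = rv ord N (poly p (b + h)))"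
  using assms
proof (induction S rule: finite_induct)
  case empty
  show ?case by (intro exI[of _ 1]) auto
next
  case (insert p S)
  then obtain \<epsilon> where e: "\<epsilon> \<noteq> 0" "\<forall>p\<in>S. \<forall>h. \<epsilon> \<preceq> h \<longrightarrow> rv ord N (poly p b) = rv ord N (poly p (b + h))" by auto
  obtain \<delta> where d: "\<delta> \<noteq> 0" "\<forall>h. \<delta> \<preceq> h \<longrightarrow> rv ord N (poly p b) = rv ord N (poly p (b + h))"
  proof (cases "p = 0")
    case True
    then show ?thesis using that[of 1] by simp
  next
    case False
    then show ?thesis using that rv_locally_constant[of p b N] insert.prems by auto
  qed
  show ?case
  proof (cases "\<epsilon> \<preceq> \<delta>")
    case True
    then show ?thesis using e d vle_trans[OF True] by (intro exI[of _ \<delta>]) auto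
  next
    case False
    then have t: "\<delta> \<preceq> \<epsilon>" using vle_total vlt_vle by blast
    then show ?thesis using e d vle_trans[OF t] by (intro exI[of _ \<epsilon>]) auto
  qed
qed

text \<open>Off the roots of the polynomials involved, the fibres of a definable family are open, and no
  point is open because the valuation is not trivial.\<close>

lemma definable_point_algebraic:
  assumes A: "A \<subseteq> all_elems ord" and \<phi>: "Hen_formula A (VF # \<Gamma>) \<phi>"
  shows "\<exists>S. finite S \<and> (\<forall>p\<in>S. fring.fpoly (term_functions A \<Gamma>) p) \<and>
    (\<forall>e\<in>dom_prod ord \<Gamma>. \<forall>b. (\<forall>y. sat ord (Fld y # e) \<phi> \<longleftrightarrow> y = b) \<longrightarrow>
      (\<exists>p\<in>S. p e \<noteq> 0 \<and> poly (p e) b = 0))"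
proof -
  obtain Q N where Q: "finite Q" "Q \<subseteq> term_functions A (VF # \<Gamma>)" "N > 0"
    and F: "\<And>e e'. agree (VF # \<Gamma>) Q N e e' \<Longrightarrow> sat ord e \<phi> = sat ord e' \<phi>"
    using determined_formula[OF A \<phi>] unfolding determined_def by blast
  have "\<exists>P. fring.fpoly (term_functions A \<Gamma>) P \<and> (\<forall>e x. q (x # e) = poly (P e) (fld x))" if "q \<in> Q" for q
    using Q that term_as_polynomial unfolding term_functions_def by fastforce
  then obtain P where P: "\<And>q. q \<in> Q \<Longrightarrow> fring.fpoly (term_functions A \<Gamma>) (P q)"
    "\<And>q e x. q \<in> Q \<Longrightarrow> q (x # e) = poly (P q e) (fld x)" by metis
  have "\<exists>p\<in>P ` Q. p e \<noteq> 0 \<and> poly (p e) b = 0"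
    if e: "e \<in> dom_prod ord \<Gamma>" and b: "\<And>y. sat ord (Fld y # e) \<phi> \<longleftrightarrow> y = b" for e b
  proof (rule ccontr)
    assume "\<not> ?thesis"
    then have "\<exists>\<epsilon>. \<epsilon> \<noteq> 0 \<and> (\<forall>p\<in>(\<lambda>q. P q e) ` Q. \<forall>h. \<epsilon> \<preceq> h \<longrightarrow> rv ord N (poly p b) = rv ord N (poly p (b + h)))"
      using Q by (intro rv_locally_constant_finite) auto
    then obtain \<epsilon> where \<epsilon>: "\<epsilon> \<noteq> 0" "\<And>q. q \<in> Q \<Longrightarrow> rv ord N (poly (P q e) b) = rv ord N (poly (P q e) (b + \<epsilon>))"
      by auto
    have "rv ord N (q (Fld b # e)) = rv ord N (q (Fld (b + \<epsilon>) # e))" if "q \<in> Q" for q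
      using \<epsilon>(2)[OF that] by (simp add: P(2)[OF that])
    then have "agree (VF # \<Gamma>) Q N (Fld b # e) (Fld (b + \<epsilon>) # e)"
      using e by (simp add: agree_def dom_prod_Cons sim_def nth_Cons')
    then show False using F b \<epsilon> by (metis add_cancel_left_right)
  qed
  then show ?thesis using Q P by (intro exI[of _ "P ` Q"]) auto
qed

end

section \<open>Definable sets and functions\<close>

fun rename_term :: "(nat \<Rightarrow> nat) \<Rightarrow> 'k trm \<Rightarrow> 'k trm" where
  "rename_term \<rho> (Var i) = Var (\<rho> i)"
| "rename_term \<rho> (Cst c) = Cst c"
| "rename_term \<rho> Zero = Zero"
| "rename_term \<rho> One = One"
| "rename_term \<rho> (Add s t) = Add (rename_term \<rho> s) (rename_term \<rho> t)"
| "rename_term \<rho> (Sub s t) = Sub (rename_term \<rho> s) (rename_term \<rho> t)"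
| "rename_term \<rho> (Mul s t) = Mul (rename_term \<rho> s) (rename_term \<rho> t)"
| "rename_term \<rho> (Rv n t) = Rv n (rename_term \<rho> t)"
| "rename_term \<rho> (Hen m n ts t) = Hen m n (map (rename_term \<rho>) ts) (rename_term \<rho> t)"

definition lift_renaming :: "(nat \<Rightarrow> nat) \<Rightarrow> nat \<Rightarrow> nat" where
  "lift_renaming \<rho> i = (case i of 0 \<Rightarrow> 0 | Suc j \<Rightarrow> Suc (\<rho> j))"

primrec rename_formula :: "(nat \<Rightarrow> nat) \<Rightarrow> 'k fm \<Rightarrow> 'k fm" where
  "rename_formula \<rho> (Eq s t) = Eq (rename_term \<rho> s) (rename_term \<rho> t)"
| "rename_formula \<rho> (Incl p q ts) = Incl p q (map (rename_term \<rho>) ts)"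
| "rename_formula \<rho> (Neg \<phi>) = Neg (rename_formula \<rho> \<phi>)"
| "rename_formula \<rho> (Conj \<phi> \<psi>) = Conj (rename_formula \<rho> \<phi>) (rename_formula \<rho> \<psi>)"
| "rename_formula \<rho> (Exi \<sigma> \<phi>) = Exi \<sigma> (rename_formula (lift_renaming \<rho>) \<phi>)"

definition renaming :: "(nat \<Rightarrow> nat) \<Rightarrow> srt list \<Rightarrow> srt list \<Rightarrow> bool" where
  "renaming \<rho> \<Gamma> \<Delta> \<longleftrightarrow> (\<forall>i<length \<Gamma>. \<rho> i < length \<Delta> \<and> \<Delta> ! \<rho> i = \<Gamma> ! i)"

lemma renaming_lift: "renaming \<rho> \<Gamma> \<Delta> \<Longrightarrow> renaming (lift_renaming \<rho>) (\<sigma> # \<Gamma>) (\<sigma> # \<Delta>)"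
  by (auto simp: renaming_def lift_renaming_def less_Suc_eq_0_disj)

lemma has_sort_rename:
  "has_sort A \<Gamma> t s \<Longrightarrow> renaming \<rho> \<Gamma> \<Delta> \<Longrightarrow> has_sort A \<Delta> (rename_term \<rho> t) s"
proof (induction rule: has_sort.induct)
  case (1 i)
  then have "\<rho> i < length \<Delta>" "\<Delta> ! \<rho> i = \<Gamma> ! i" by (auto simp: renaming_def)
  then show ?case using has_sort.intros(1)[of "\<rho> i" \<Delta> A] by simp
next
  case (9 n ts m s)
  then have "has_sort A \<Delta> (Hen m n (map (rename_term \<rho>) ts) (rename_term \<rho> s)) VF"
    by (intro has_sort.intros(9)) auto
  then show ?case by simp
qed (auto intro: has_sort.intros)

lemma trm_val_rename:
  "has_sort A \<Gamma> t s \<Longrightarrow> (\<And>i. i < length \<Gamma> \<Longrightarrow> e ! \<rho> i = e' ! i) \<Longrightarrow>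
    trm_val ord e (rename_term \<rho> t) = trm_val ord e' t"
proof (induction rule: has_sort.induct)
  case (9 n ts m s)
  then have "map (\<lambda>t. fld (trm_val ord e t)) (map (rename_term \<rho>) ts) = map (\<lambda>t. fld (trm_val ord e' t)) ts"
    by auto
  moreover have "trm_val ord e (rename_term \<rho> s) = trm_val ord e' s" using 9 by simp
  ultimately show ?case by (simp only: rename_term.simps trm_val.simps)
qed auto

lemma hen_free_rename: "hen_free t \<Longrightarrow> hen_free (rename_term \<rho> t)"
  by (induction t) auto

lemma Hen_term_rename: "Hen_term A \<Gamma> t s \<Longrightarrow> renaming \<rho> \<Gamma> \<Delta> \<Longrightarrow> Hen_term A \<Delta> (rename_term \<rho> t) s"
  by (auto simp: Hen_term_def intro: has_sort_rename hen_free_rename)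

lemma Hen_formula_rename:
  "Hen_formula A \<Gamma> \<phi> \<Longrightarrow> renaming \<rho> \<Gamma> \<Delta> \<Longrightarrow> Hen_formula A \<Delta> (rename_formula \<rho> \<phi>)"
proof (induction \<phi> arbitrary: \<rho> \<Gamma> \<Delta>)
  case (Eq s t)
  then show ?case by (auto intro: Hen_term_rename)
next
  case (Incl p q ts)
  then show ?case by (fastforce intro: Hen_term_rename)
next
  case (Exi \<sigma> \<phi>)
  then show ?case using renaming_lift by auto
qed auto

lemma sat_rename:
  "Hen_formula A \<Gamma> \<phi> \<Longrightarrow> (\<And>i. i < length \<Gamma> \<Longrightarrow> e ! \<rho> i = e' ! i) \<Longrightarrow>
    sat ord e (rename_formula \<rho> \<phi>) \<longleftrightarrow> sat ord e' \<phi>"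
proof (induction \<phi> arbitrary: \<rho> \<Gamma> e e')
  case (Eq s t)
  then obtain \<sigma> where "has_sort A \<Gamma> s \<sigma>" "has_sort A \<Gamma> t \<sigma>" by (auto simp: Hen_term_def)
  then show ?case using trm_val_rename[of A \<Gamma> _ \<sigma> e \<rho> e' ord] Eq.prems by simp
next
  case (Incl p q ts)
  have "trm_val ord e (rename_term \<rho> t) = trm_val ord e' t" if "t \<in> set ts" for t
  proof -
    have "\<exists>n. has_sort A \<Gamma> t (RVs n)" using that Incl.prems(1) unfolding Hen_formula.simps Hen_term_def by meson
    then obtain n where "has_sort A \<Gamma> t (RVs n)" by blast
    then show ?thesis using Incl.prems(2) by (rule trm_val_rename)
  qed
  then have "map (trm_val ord e) (map (rename_term \<rho>) ts) = map (trm_val ord e') ts" by simp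
  then show ?case by (simp only: sat.simps rename_formula.simps)
next
  case (Exi \<sigma> \<phi>)
  have "sat ord (x # e) (rename_formula (lift_renaming \<rho>) \<phi>) \<longleftrightarrow> sat ord (x # e') \<phi>" for x
  proof (rule Exi.IH)
    show "Hen_formula A (\<sigma> # \<Gamma>) \<phi>" using Exi.prems by simp
    fix i assume "i < length (\<sigma> # \<Gamma>)"
    then show "(x # e) ! lift_renaming \<rho> i = (x # e') ! i"
      using Exi.prems(2) by (cases i) (auto simp: lift_renaming_def)
  qed
  then show ?case by simp
qed (simp_all, metis)

locale henselian_params = henselian ord for ord :: "'k::field_char_0 \<Rightarrow> 'g::linordered_ab_group_add extended" +
  fixes A :: "'k elem set"
  assumes A: "A \<subseteq> all_elems ord"
begin

section \<open>Definable relations and definable functions\<close>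

text \<open>Relations are predicates that count only on \<open>dom_prod ord \<Gamma>\<close>; they
  can be combined by logical operations and exchanged for others equal there, without any formula
  being written down.\<close>

definition dset :: "srt list \<Rightarrow> ('k elem list \<Rightarrow> bool) \<Rightarrow> bool" where
  "dset \<Gamma> R \<longleftrightarrow> (\<exists>\<phi>. Hen_formula A \<Gamma> \<phi> \<and> (\<forall>e\<in>dom_prod ord \<Gamma>. sat ord e \<phi> \<longleftrightarrow> R e))"

lemma dsetI: "Hen_formula A \<Gamma> \<phi> \<Longrightarrow> (\<And>e. e \<in> dom_prod ord \<Gamma> \<Longrightarrow> sat ord e \<phi> \<longleftrightarrow> R e) \<Longrightarrow> dset \<Gamma> R"
  unfolding dset_def by blast

lemma dset_cong: "dset \<Gamma> R \<Longrightarrow> (\<And>e. e \<in> dom_prod ord \<Gamma> \<Longrightarrow> R e \<longleftrightarrow> R' e) \<Longrightarrow> dset \<Gamma> R'"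
  unfolding dset_def by auto

lemma dset_Not: "dset \<Gamma> R \<Longrightarrow> dset \<Gamma> (\<lambda>e. \<not> R e)"
  unfolding dset_def by (metis Hen_formula.simps(3) sat.simps(3))

lemma dset_conj: "dset \<Gamma> R \<Longrightarrow> dset \<Gamma> S \<Longrightarrow> dset \<Gamma> (\<lambda>e. R e \<and> S e)"
  unfolding dset_def by (metis Hen_formula.simps(4) sat.simps(4))

lemma dset_disj: "dset \<Gamma> R \<Longrightarrow> dset \<Gamma> S \<Longrightarrow> dset \<Gamma> (\<lambda>e. R e \<or> S e)"
  using dset_Not[OF dset_conj[OF dset_Not dset_Not]] by simp

lemma dset_Eq: "Hen_term A \<Gamma> s \<sigma> \<Longrightarrow> Hen_term A \<Gamma> t \<sigma> \<Longrightarrow> dset \<Gamma> (\<lambda>e. trm_val ord e s = trm_val ord e t)"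
  by (rule dsetI[of _ "Eq s t"]) auto

lemma dset_True: "dset \<Gamma> (\<lambda>_. True)"
proof -
  have "Hen_term A \<Gamma> Zero VF" by (simp add: Hen_term_def has_sort.intros)
  from dset_Eq[OF this this] show ?thesis by simp
qed

lemma dset_ball: "finite I \<Longrightarrow> (\<And>i. i \<in> I \<Longrightarrow> dset \<Gamma> (R i)) \<Longrightarrow> dset \<Gamma> (\<lambda>e. \<forall>i\<in>I. R i e)"
  by (induction I rule: finite_induct) (auto intro: dset_True dset_conj)

lemma dset_bex: "finite I \<Longrightarrow> (\<And>i. i \<in> I \<Longrightarrow> dset \<Gamma> (R i)) \<Longrightarrow> dset \<Gamma> (\<lambda>e. \<exists>i\<in>I. R i e)"
  using dset_Not[OF dset_ball[of I \<Gamma> "\<lambda>i e. \<not> R i e"]] by (simp add: dset_Not)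

lemma dset_ex:
  assumes "dset (\<sigma> # \<Gamma>) R" "valid_sort \<sigma>"
  shows "dset \<Gamma> (\<lambda>e. \<exists>x\<in>dom_sort ord \<sigma>. R (x # e))"
proof -
  obtain \<phi> where "Hen_formula A (\<sigma> # \<Gamma>) \<phi>" "\<And>e. e \<in> dom_prod ord (\<sigma> # \<Gamma>) \<Longrightarrow> sat ord e \<phi> \<longleftrightarrow> R e"
    using assms unfolding dset_def by blast
  then show ?thesis using assms by (intro dsetI[of _ "Exi \<sigma> \<phi>"]) (auto simp: dom_prod_Cons)
qed

text \<open>\<open>h\<close> performs on assignments what \<open>\<rho>\<close> performs on
  variables. Stating it for a general \<open>h\<close> covers \<open>tl\<close>, \<open>take\<close>
  and the exchange of coordinates alike.\<close>

lemma dset_rename: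
  assumes R: "dset \<Gamma> R" and \<rho>: "renaming \<rho> \<Gamma> \<Delta>"
    and e: "\<And>e. e \<in> dom_prod ord \<Delta> \<Longrightarrow> length (h e) = length \<Gamma> \<and> (\<forall>i<length \<Gamma>. e ! \<rho> i = h e ! i)"
  shows "dset \<Delta> (\<lambda>e. R (h e))"
proof -
  obtain \<phi> where \<phi>: "Hen_formula A \<Gamma> \<phi>" "\<And>e. e \<in> dom_prod ord \<Gamma> \<Longrightarrow> sat ord e \<phi> \<longleftrightarrow> R e"
    using R unfolding dset_def by blast
  have "h d \<in> dom_prod ord \<Gamma>" if "d \<in> dom_prod ord \<Delta>" for d
    unfolding dom_prod_iff list_all2_conv_all_nth
    using e[OF that] \<rho> dom_prod_nth[OF that] by (metis renaming_def)
  then show ?thesis using \<phi> e \<rho>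
    by (intro dsetI[of _ "rename_formula \<rho> \<phi>"]) (auto simp: sat_rename intro: Hen_formula_rename)
qed

lemma dset_weaken: "dset \<Gamma> R \<Longrightarrow> dset (\<sigma> # \<Gamma>) (\<lambda>e. R (tl e))"
  by (rule dset_rename[of \<Gamma> R Suc]) (auto simp: renaming_def nth_tl dest: dom_prod_length)

text \<open>The value stands in front of the arguments because a quantifier binds the variable of
  index 0; \<open>dset_subst\<close> removes it by such a quantifier.\<close>

definition dfun :: "srt \<Rightarrow> srt list \<Rightarrow> ('k elem list \<Rightarrow> 'k elem) \<Rightarrow> bool" where
  "dfun \<sigma> \<Gamma> \<gamma> \<longleftrightarrow> valid_sort \<sigma> \<and> (\<forall>e\<in>dom_prod ord \<Gamma>. \<gamma> e \<in> dom_sort ord \<sigma>) \<and>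
     dset (\<sigma> # \<Gamma>) (\<lambda>e. hd e = \<gamma> (tl e))"

lemma dfun_weaken: "dfun \<tau> \<Gamma> \<gamma> \<Longrightarrow> dfun \<tau> (\<sigma> # \<Gamma>) (\<lambda>e. \<gamma> (tl e))"
proof -
  assume g: "dfun \<tau> \<Gamma> \<gamma>"
  have "dset (\<tau> # \<sigma> # \<Gamma>) (\<lambda>e. (\<lambda>e. hd e = \<gamma> (tl e)) (hd e # tl (tl e)))"
  proof (rule dset_rename[of "\<tau> # \<Gamma>" _ "lift_renaming Suc"])
    show "dset (\<tau> # \<Gamma>) (\<lambda>e. hd e = \<gamma> (tl e))" using g by (simp add: dfun_def)
    show "renaming (lift_renaming Suc) (\<tau> # \<Gamma>) (\<tau> # \<sigma> # \<Gamma>)"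
      by (rule renaming_lift) (auto simp: renaming_def)
    fix e assume "e \<in> dom_prod ord (\<tau> # \<sigma> # \<Gamma>)"
    then obtain x y e' where "e = x # y # e'" "length e' = length \<Gamma>"
      by (auto simp: dom_prod_iff list_all2_Cons2 dest: list_all2_lengthD)
    then show "length (hd e # tl (tl e)) = length (\<tau> # \<Gamma>) \<and>
        (\<forall>i<length (\<tau> # \<Gamma>). e ! lift_renaming Suc i = (hd e # tl (tl e)) ! i)"
      by (auto simp: lift_renaming_def split: nat.split)
  qed
  then show ?thesis using g unfolding dfun_def
    by (auto simp: dom_prod_iff list_all2_Cons2)
qed

lemma dset_subst:
  assumes "dset (\<sigma> # \<Gamma>) R" "dfun \<sigma> \<Gamma> \<gamma>"
  shows "dset \<Gamma> (\<lambda>e. R (\<gamma> e # e))"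
proof -
  have "dset \<Gamma> (\<lambda>e. \<exists>x\<in>dom_sort ord \<sigma>. hd (x # e) = \<gamma> (tl (x # e)) \<and> R (x # e))"
    using assms by (intro dset_ex dset_conj) (auto simp: dfun_def)
  then show ?thesis using assms by (elim dset_cong) (auto simp: dfun_def)
qed

definition DF :: "srt list \<Rightarrow> ('k elem list \<Rightarrow> 'k) set" where
  "DF \<Gamma> = {F. dfun VF \<Gamma> (\<lambda>e. Fld (F e))}"

lemma DF_iff: "F \<in> DF \<Gamma> \<longleftrightarrow> dset (VF # \<Gamma>) (\<lambda>e. hd e = Fld (F (tl e)))"
  by (simp add: DF_def dfun_def)

lemma DF_weaken: "F \<in> DF \<Gamma> \<Longrightarrow> (\<lambda>e. F (tl e)) \<in> DF (\<sigma> # \<Gamma>)"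
  using dfun_weaken[of VF \<Gamma> "\<lambda>e. Fld (F e)"] by (simp add: DF_def)

lemma DF_term:
  assumes "Hen_term A \<Gamma> t VF"
  shows "(\<lambda>e. fld (trm_val ord e t)) \<in> DF \<Gamma>"
proof -
  have "Hen_term A (VF # \<Gamma>) (Var 0) VF"
    unfolding Hen_term_def by (metis has_sort.intros(1) hen_free.simps(6) length_Cons nth_Cons_0 zero_less_Suc)
  moreover have "Hen_term A (VF # \<Gamma>) (rename_term Suc t) VF"
    using assms by (rule Hen_term_rename) (simp add: renaming_def)
  ultimately have "dset (VF # \<Gamma>) (\<lambda>e. trm_val ord e (Var 0) = trm_val ord e (rename_term Suc t))"
    by (rule dset_Eq)
  then show ?thesis unfolding DF_iff
  proof (rule dset_cong)
    fix e assume "e \<in> dom_prod ord (VF # \<Gamma>)"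
    then obtain x e' where e: "e = x # e'" "e' \<in> dom_prod ord \<Gamma>" by (auto simp: dom_prod_iff list_all2_Cons2)
    have "trm_val ord e (rename_term Suc t) = trm_val ord e' t"
      using assms e by (intro trm_val_rename[of A \<Gamma> t VF]) (auto simp: Hen_term_def)
    moreover have "trm_val ord e' t = Fld (fld (trm_val ord e' t))"
      using has_sort_VF_val[OF _ A e(2)] assms unfolding Hen_term_def by blast
    ultimately show "trm_val ord e (Var 0) = trm_val ord e (rename_term Suc t) \<longleftrightarrow> hd e = Fld (fld (trm_val ord (tl e) t))"
      using e by simp
  qed
qed

lemma Hen_term_Var: "i < length \<Gamma> \<Longrightarrow> \<Gamma> ! i = s \<Longrightarrow> Hen_term A \<Gamma> (Var i) s"
  using has_sort.intros(1)[of i \<Gamma> A] by (auto simp: Hen_term_def)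

lemma DF_Var: "i < length \<Gamma> \<Longrightarrow> \<Gamma> ! i = VF \<Longrightarrow> (\<lambda>e. fld (e ! i)) \<in> DF \<Gamma>"
  using DF_term[OF Hen_term_Var] by simp

lemma dset_subst2:
  assumes R: "dset (VF # VF # \<Gamma>) R" and F: "F \<in> DF \<Gamma>" "G \<in> DF \<Gamma>"
  shows "dset \<Gamma> (\<lambda>e. R (Fld (F e) # Fld (G e) # e))"
proof -
  have "dset (VF # \<Gamma>) (\<lambda>e. R (Fld (F (tl e)) # e))"
    using DF_weaken[OF F(1)] by (intro dset_subst[OF R]) (simp add: DF_def)
  from dset_subst[OF this, of "\<lambda>e. Fld (G e)"] show ?thesis using F by (simp add: DF_def)
qed

lemma DF_op:
  assumes t: "Hen_term A [VF, VF] t VF" and FG: "F \<in> DF \<Gamma>" "G \<in> DF \<Gamma>"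
    and v: "\<And>x y. trm_val ord [Fld x, Fld y] t = Fld (H x y)"
  shows "(\<lambda>e. H (F e) (G e)) \<in> DF \<Gamma>"
proof -
  have tr: "Hen_term A (VF # VF # VF # \<Gamma>) (rename_term id t) VF"
    using t by (rule Hen_term_rename) (simp add: renaming_def All_less_Suc)
  have "dset (VF # VF # VF # \<Gamma>) (\<lambda>e. trm_val ord e (Var 2) = trm_val ord e (rename_term id t))"
    by (rule dset_Eq[OF Hen_term_Var tr]) auto
  from dset_subst2[OF this DF_weaken[OF FG(1)] DF_weaken[OF FG(2)]]
  show ?thesis unfolding DF_iff
  proof (rule dset_cong)
    fix e assume "e \<in> dom_prod ord (VF # \<Gamma>)"
    then obtain x e' where e: "e = x # e'" by (auto simp: dom_prod_iff list_all2_Cons2)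
    have "trm_val ord (Fld (F e') # Fld (G e') # e) (rename_term id t) = trm_val ord [Fld (F e'), Fld (G e')] t"
      using t by (intro trm_val_rename[of A "[VF, VF]" t VF]) (auto simp: Hen_term_def less_Suc_eq)
    then show "trm_val ord (Fld (F (tl e)) # Fld (G (tl e)) # e) (Var 2) =
        trm_val ord (Fld (F (tl e)) # Fld (G (tl e)) # e) (rename_term id t) \<longleftrightarrow> hd e = Fld (H (F (tl e)) (G (tl e)))"
      using e v by simp
  qed
qed

lemma term_functions_DF: "F \<in> term_functions A \<Gamma> \<Longrightarrow> F \<in> DF \<Gamma>"
  unfolding term_functions_def using DF_term by blast

lemma fring_DF: "fring (DF \<Gamma>)"
proof -
  interpret T: fring "term_functions A \<Gamma>" by (rule fring_term_functions)
  have V: "has_sort A [VF, VF] (Var 0) VF" "has_sort A [VF, VF] (Var 1) VF"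
    using has_sort.intros(1)[of 0 "[VF, VF]" A] has_sort.intros(1)[of 1 "[VF, VF]" A] by auto
  show ?thesis
  proof
    show "(\<lambda>_. 0) \<in> DF \<Gamma>" "(\<lambda>_. 1) \<in> DF \<Gamma>" using T.zero T.one term_functions_DF by auto
    fix f g assume fg: "f \<in> DF \<Gamma>" "g \<in> DF \<Gamma>"
    show "(\<lambda>e. f e + g e) \<in> DF \<Gamma>"
      using V by (intro DF_op[of "Add (Var 0) (Var 1)", OF _ fg]) (auto simp: Hen_term_def intro: has_sort.intros)
    show "(\<lambda>e. f e - g e) \<in> DF \<Gamma>"
      using V by (intro DF_op[of "Sub (Var 0) (Var 1)", OF _ fg]) (auto simp: Hen_term_def intro: has_sort.intros)
    show "(\<lambda>e. f e * g e) \<in> DF \<Gamma>"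
      using V by (intro DF_op[of "Mul (Var 0) (Var 1)", OF _ fg]) (auto simp: Hen_term_def intro: has_sort.intros)
  qed
qed

lemma dset_eq:
  assumes "F \<in> DF \<Gamma>" "G \<in> DF \<Gamma>"
  shows "dset \<Gamma> (\<lambda>e. F e = G e)"
proof -
  have "dset (VF # VF # \<Gamma>) (\<lambda>e. trm_val ord e (Var 0) = trm_val ord e (Var 1))"
    by (rule dset_Eq[OF Hen_term_Var Hen_term_Var]) auto
  from dset_subst2[OF this assms] show ?thesis by simp
qed

lemma dset_rv_eq:
  assumes "F \<in> DF \<Gamma>" "G \<in> DF \<Gamma>" "n > 0"
  shows "dset \<Gamma> (\<lambda>e. rv ord n (F e) = rv ord n (G e))"
proof -
  have "Hen_term A (VF # VF # \<Gamma>) (Rv n (Var i)) (RVs n)" if "i < 2" for i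
    using Hen_term_Var[of i "VF # VF # \<Gamma>" VF] that assms(3)
    by (auto simp: Hen_term_def nth_Cons' intro: has_sort.intros)
  then have "dset (VF # VF # \<Gamma>) (\<lambda>e. trm_val ord e (Rv n (Var 0)) = trm_val ord e (Rv n (Var 1)))"
    by (intro dset_Eq[of _ _ "RVs n"]) auto
  from dset_subst2[OF this assms(1,2)] show ?thesis by simp
qed

text \<open>The relation says that adding \<open>G e\<close> does not change the class of
  \<open>F e\<close> for \<open>n = 1\<close>. In this way the order of values is definable from
  \<open>rv\<close>.\<close>

lemma dset_vlt: "F \<in> DF \<Gamma> \<Longrightarrow> G \<in> DF \<Gamma> \<Longrightarrow> dset \<Gamma> (\<lambda>e. F e \<prec> G e)"
  using dset_rv_eq[of F \<Gamma> "\<lambda>e. F e + G e" 1] fring.add[OF fring_DF] by (simp add: rv_eq_iff)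

lemma dset_vle:
  assumes F: "F \<in> DF \<Gamma>" and G: "G \<in> DF \<Gamma>"
  shows "dset \<Gamma> (\<lambda>e. F e \<preceq> G e)"
proof -
  have iff: "x \<preceq> y \<longleftrightarrow> y = 0 \<or> \<not> y \<prec> x" for x y
    using ord_le_iff[of x y] ord_less_iff[of y x] by (auto simp: not_le[symmetric])
  show ?thesis unfolding iff
    by (intro dset_disj dset_Not dset_vlt dset_eq F G fring.zero[OF fring_DF])
qed

lemma DF_if:
  assumes S: "dset \<Gamma> S" and F: "F \<in> DF \<Gamma>" and G: "G \<in> DF \<Gamma>"
  shows "(\<lambda>e. if S e then F e else G e) \<in> DF \<Gamma>"
proof -
  have "dset (VF # \<Gamma>) (\<lambda>e. S (tl e) \<and> hd e = Fld (F (tl e)) \<or> \<not> S (tl e) \<and> hd e = Fld (G (tl e)))"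
    using F G unfolding DF_iff by (intro dset_disj dset_conj dset_Not dset_weaken S)
  then show ?thesis unfolding DF_iff by (rule dset_cong) auto
qed

lemma dfun_rv:
  assumes F: "F \<in> DF \<Gamma>" and n: "n > 0"
  shows "dfun (RVs n) \<Gamma> (\<lambda>e. RVElem n (rv ord n (F e)))"
proof -
  have "dset (VF # RVs n # \<Gamma>) (\<lambda>e. trm_val ord e (Var 1) = trm_val ord e (Rv n (Var 0)))"
    using n Hen_term_Var[of 0 "VF # RVs n # \<Gamma>" VF]
    by (intro dset_Eq[of _ _ "RVs n"] Hen_term_Var) (auto simp: Hen_term_def intro: has_sort.intros)
  from dset_subst[OF this, of "\<lambda>e. Fld (F (tl e))"]
  have "dset (RVs n # \<Gamma>) (\<lambda>e. e ! 0 = RVElem n (rv ord n (F (tl e))))"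
    using DF_weaken[OF F] by (simp add: DF_def)
  then have "dset (RVs n # \<Gamma>) (\<lambda>e. hd e = RVElem n (rv ord n (F (tl e))))"
    by (rule dset_cong) (auto simp: dom_prod_iff list_all2_Cons2)
  then show ?thesis using n by (auto simp: dfun_def)
qed

text \<open>Beyond the degree bound all coefficients vanish, so the quantifiers over indices in
  \<open>hcond\<close> become finite and the condition a Boolean combination of definable
  ones.\<close>

lemma dset_hcond:
  assumes p: "fring.fpoly (DF \<Gamma>) p" and z: "z \<in> DF \<Gamma>"
  shows "dset \<Gamma> (\<lambda>e. hcond n (p e) (z e))"
proof -
  interpret fring "DF \<Gamma>" by (rule fring_DF)
  obtain d where d: "\<And>e. degree (p e) \<le> d" using fpoly_degree[OF p] by blast
  have "dset \<Gamma> (\<lambda>e. z e \<noteq> 0 \<and> (\<exists>i\<in>{1..d}. coeff (p e) i \<noteq> 0 \<and>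
     (\<forall>j\<in>{..d}. coeff (p e) i * z e ^ i \<preceq> coeff (p e) j * z e ^ j) \<and>
     of_nat n ^ 2 * coeff (p e) i * z e ^ i \<prec> poly (p e) (z e) \<and>
     poly (pderiv (p e)) (z e) \<preceq> of_nat n * coeff (p e) i * z e ^ (i - 1)))"
    by (intro dset_conj dset_bex dset_ball dset_Not dset_eq dset_vle dset_vlt mult power of_nat zero z
        fpoly_coeff fpoly_poly fpoly_pderiv p) auto
  then show ?thesis
  proof (rule dset_cong)
    fix e
    have c: "coeff (p e) i = 0" if "\<not> i \<le> d" for i using that d[of e] by (simp add: coeff_eq_0)
    have all: "(\<forall>j\<in>{..d}. a \<preceq> coeff (p e) j * z e ^ j) \<longleftrightarrow> (\<forall>j. a \<preceq> coeff (p e) j * z e ^ j)" for a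
    proof (intro iffI allI ballI)
      fix j assume "\<forall>j\<in>{..d}. a \<preceq> coeff (p e) j * z e ^ j"
      then show "a \<preceq> coeff (p e) j * z e ^ j" using c[of j] by (cases "j \<le> d") auto
    qed auto
    have ex: "(\<exists>i\<in>{1..d}. coeff (p e) i \<noteq> 0 \<and> P i) \<longleftrightarrow> (\<exists>i>0. coeff (p e) i \<noteq> 0 \<and> P i)" for P
    proof -
      have "i \<in> {1..d} \<and> coeff (p e) i \<noteq> 0 \<longleftrightarrow> i > 0 \<and> coeff (p e) i \<noteq> 0" for i using c[of i] by auto
      then show ?thesis unfolding Bex_def by (metis (no_types, lifting))
    qed
    show "(z e \<noteq> 0 \<and> (\<exists>i\<in>{1..d}. coeff (p e) i \<noteq> 0 \<and>
     (\<forall>j\<in>{..d}. coeff (p e) i * z e ^ i \<preceq> coeff (p e) j * z e ^ j) \<and>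
     of_nat n ^ 2 * coeff (p e) i * z e ^ i \<prec> poly (p e) (z e) \<and>
     poly (pderiv (p e)) (z e) \<preceq> of_nat n * coeff (p e) i * z e ^ (i - 1))) \<longleftrightarrow> hcond n (p e) (z e)"
      unfolding hcond_def all ex by simp
  qed
qed

end

section \<open>Definable functions given by terms\<close>

context henselian
begin

text \<open>Connects \<open>hcond\<close> with the condition on coefficient lists. The number
  \<open>d\<close> is only a bound on the degree: the list is padded with zeros, which lets one
  function symbol serve a whole family.\<close>

lemma hfun_root:
  assumes n: "n > 0" and h: "hcond n f z" and d: "degree f \<le> d"
    and b: "b = hfun ord d n (map (coeff f) [0..<Suc d]) (rv ord n z)"
  shows "poly f b = 0" "rv ord n b = rv ord n z"
proof -
  let ?as = "map (coeff f) [0..<Suc d]"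
  have nth: "?as ! i = coeff f i" if "i \<le> d" for i using that by (simp del: upt_Suc)
  have P: "Poly ?as = f"
  proof (rule poly_eqI)
    fix i show "coeff (Poly ?as) i = coeff f i"
      using d by (cases "i \<le> d") (auto simp: nth_default_def coeff_eq_0 simp del: upt_Suc)
  qed
  obtain i where z: "z \<noteq> 0" and i: "i > 0" "coeff f i \<noteq> 0"
    and mn: "\<And>j. coeff f i * z ^ i \<preceq> coeff f j * z ^ j"
    and 1: "of_nat n ^ 2 * coeff f i * z ^ i \<prec> poly f z"
    and 2: "poly (pderiv f) z \<preceq> of_nat n * coeff f i * z ^ (i - 1)"
    using h unfolding hcond_def by blast
  have id: "i \<le> d" using i d le_degree le_trans by blast
  have "hensel_condition ord d n ?as (rv ord n z)" unfolding hensel_condition_def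
  proof (intro exI[of _ i] exI[of _ z] conjI)
    have "(MIN j\<in>{0..d}. ord (?as ! j * z ^ j)) = ord (?as ! i * z ^ i)"
      using mn id nth by (intro Min_eqI) (auto simp: ord_le_iff simp del: upt_Suc)
    then show "ord (?as ! i * z ^ i) = (MIN j\<in>{0..d}. ord (?as ! j * z ^ j))" by simp
    show "ord (of_nat (n ^ 2) * ?as ! i * z ^ i) < ord (poly (Poly ?as) z)"
      unfolding P nth[OF id] ord_less_iff using 1 n i z by simp
    show "ord (poly (pderiv (Poly ?as)) z) \<le> ord (of_nat n * ?as ! i * z ^ (i - 1))"
      unfolding P nth[OF id] ord_le_iff using 2 by simp
  qed (use i id in auto)
  moreover have "rv ord n z \<noteq> rv ord n 0" using z by simp
  ultimately have "b = (THE b. poly f b = 0 \<and> rv ord n b = rv ord n z)"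
    unfolding b hfun_def P by simp
  with theI'[OF hcond_root[OF n h]] show "poly f b = 0" "rv ord n b = rv ord n z" by auto
qed

end

context henselian_params
begin

section \<open>Functions given by terms in auxiliary parameters\<close>

text \<open>The list \<open>gs\<close> represents, by components, a function into a product of
  auxiliary sorts: the sorts are collected here, the values in \<open>aux_val\<close>.\<close>

definition aux_ctx :: "(nat \<times> ('k elem list \<Rightarrow> 'k elem)) list \<Rightarrow> srt list" where
  "aux_ctx gs = map RVs (map fst gs)"

definition aux_val :: "(nat \<times> ('k elem list \<Rightarrow> 'k elem)) list \<Rightarrow> 'k elem list \<Rightarrow> 'k elem list" where
  "aux_val gs e = map (\<lambda>(n, \<gamma>). \<gamma> e) gs"

definition aux_funs :: "srt list \<Rightarrow> (nat \<times> ('k elem list \<Rightarrow> 'k elem)) list \<Rightarrow> bool" where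
  "aux_funs \<Gamma> gs \<longleftrightarrow> (\<forall>(n, \<gamma>)\<in>set gs. dfun (RVs n) \<Gamma> \<gamma>)"

text \<open>The conclusion of the theorem for a function on the whole product of the sorts.\<close>

definition liftable :: "srt list \<Rightarrow> ('k elem list \<Rightarrow> 'k) \<Rightarrow> bool" where
  "liftable \<Gamma> F \<longleftrightarrow> (\<exists>gs t. aux_funs \<Gamma> gs \<and> has_sort A (\<Gamma> @ aux_ctx gs) t VF \<and>
     (\<forall>e\<in>dom_prod ord \<Gamma>. trm_val ord (e @ aux_val gs e) t = Fld (F e)))"

lemma aux_append:
  "aux_ctx (gs @ hs) = aux_ctx gs @ aux_ctx hs" "aux_val (gs @ hs) e = aux_val gs e @ aux_val hs e"
  by (simp_all add: aux_ctx_def aux_val_def)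

lemma aux_length [simp]: "length (aux_ctx gs) = length gs" "length (aux_val gs e) = length gs"
  by (simp_all add: aux_ctx_def aux_val_def)

text \<open>The parameter lists are concatenated, and the terms for the later functions are renamed
  so as to skip the parameters of the first.\<close>

lemma liftable_list:
  assumes "\<forall>F\<in>set Fs. liftable \<Gamma> F"
  shows "\<exists>gs ts. aux_funs \<Gamma> gs \<and> (\<forall>t\<in>set ts. has_sort A (\<Gamma> @ aux_ctx gs) t VF) \<and>
    (\<forall>e\<in>dom_prod ord \<Gamma>. map (trm_val ord (e @ aux_val gs e)) ts = map (\<lambda>F. Fld (F e)) Fs)"
  using assms
proof (induction Fs)
  case Nil
  show ?case by (intro exI[of _ "[]"]) (auto simp: aux_funs_def)
next
  case (Cons F Fs)
  then obtain gs2 ts where 2: "aux_funs \<Gamma> gs2" "\<forall>t\<in>set ts. has_sort A (\<Gamma> @ aux_ctx gs2) t VF"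
    "\<And>e. e \<in> dom_prod ord \<Gamma> \<Longrightarrow> map (trm_val ord (e @ aux_val gs2 e)) ts = map (\<lambda>F. Fld (F e)) Fs"
    by auto
  obtain gs1 t where 1: "aux_funs \<Gamma> gs1" "has_sort A (\<Gamma> @ aux_ctx gs1) t VF"
    "\<And>e. e \<in> dom_prod ord \<Gamma> \<Longrightarrow> trm_val ord (e @ aux_val gs1 e) t = Fld (F e)"
    using Cons.prems unfolding liftable_def by auto
  define \<rho> where "\<rho> i = (if i < length \<Gamma> then i else i + length gs1)" for i
  have r1: "renaming id (\<Gamma> @ aux_ctx gs1) (\<Gamma> @ aux_ctx (gs1 @ gs2))"
    by (auto simp: renaming_def aux_append nth_append)
  have r2: "renaming \<rho> (\<Gamma> @ aux_ctx gs2) (\<Gamma> @ aux_ctx (gs1 @ gs2))"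
    by (auto simp: renaming_def aux_append nth_append \<rho>_def)
  let ?ts = "rename_term id t # map (rename_term \<rho>) ts"
  show ?case
  proof (intro exI[of _ "gs1 @ gs2"] exI[of _ ?ts] conjI ballI)
    show "aux_funs \<Gamma> (gs1 @ gs2)" using 1 2 by (auto simp: aux_funs_def)
    show "has_sort A (\<Gamma> @ aux_ctx (gs1 @ gs2)) u VF" if "u \<in> set ?ts" for u
      using that has_sort_rename[OF 1(2) r1] has_sort_rename[OF bspec[OF 2(2)] r2] by auto
    fix e assume e: "e \<in> dom_prod ord \<Gamma>"
    then have l: "length e = length \<Gamma>" by (rule dom_prod_length)
    let ?e = "e @ aux_val (gs1 @ gs2) e"
    have "trm_val ord ?e (rename_term id t) = trm_val ord (e @ aux_val gs1 e) t"
      using 1(2) by (rule trm_val_rename) (use l in \<open>auto simp: aux_append nth_append\<close>)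
    moreover have "trm_val ord ?e (rename_term \<rho> u) = trm_val ord (e @ aux_val gs2 e) u" if "u \<in> set ts" for u
      by (rule trm_val_rename[of A "\<Gamma> @ aux_ctx gs2" u VF])
        (use l 2(2) that in \<open>auto simp: aux_append nth_append \<rho>_def\<close>)
    ultimately show "map (trm_val ord ?e) ?ts = map (\<lambda>F. Fld (F e)) (F # Fs)"
      using 1(3)[OF e] 2(3)[OF e] by (simp add: comp_def cong: map_cong)
  qed
qed

lemma liftable_op:
  assumes F: "liftable \<Gamma> F" and G: "liftable \<Gamma> G"
    and s: "\<And>\<Delta> s t. has_sort A \<Delta> s VF \<Longrightarrow> has_sort A \<Delta> t VF \<Longrightarrow> has_sort A \<Delta> (op s t) VF"
    and v: "\<And>e s t. trm_val ord e (op s t) = Fld (H (fld (trm_val ord e s)) (fld (trm_val ord e t)))"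
  shows "liftable \<Gamma> (\<lambda>e. H (F e) (G e))"
proof -
  have "\<forall>F'\<in>set [F, G]. liftable \<Gamma> F'" using F G by simp
  from liftable_list[OF this] obtain gs ts where g: "aux_funs \<Gamma> gs" "\<forall>t\<in>set ts. has_sort A (\<Gamma> @ aux_ctx gs) t VF"
    and ts: "\<And>e. e \<in> dom_prod ord \<Gamma> \<Longrightarrow> map (trm_val ord (e @ aux_val gs e)) ts = [Fld (F e), Fld (G e)]"
    by auto
  show ?thesis
  \<comment> \<open>The number of terms in \<open>ts\<close> can be read off only at an
    assignment.\<close>
  proof (cases "dom_prod ord \<Gamma> = {}")
    case True
    then show ?thesis unfolding liftable_def
      by (intro exI[of _ "[]"] exI[of _ Zero]) (auto simp: aux_funs_def intro: has_sort.intros)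
  next
    case False
    then obtain e where "e \<in> dom_prod ord \<Gamma>" by blast
    from arg_cong[OF ts[OF this], of length] have "length ts = 2" by simp
    then obtain a b where "ts = [a, b]" by (metis One_nat_def Suc_1 length_0_conv length_Suc_conv)
    then show ?thesis using g ts s v unfolding liftable_def by (intro exI[of _ gs] exI[of _ "op a b"]) auto
  qed
qed

lemma liftable_term:
  assumes t: "Hen_term A \<Gamma> t VF"
  shows "liftable \<Gamma> (\<lambda>e. fld (trm_val ord e t))"
  unfolding liftable_def
proof (intro exI[of _ "[]"] exI[of _ t] conjI ballI)
  fix e assume "e \<in> dom_prod ord \<Gamma>"
  then show "trm_val ord (e @ aux_val [] e) t = Fld (fld (trm_val ord e t))"
    using t has_sort_VF_val[OF _ A] by (auto simp: Hen_term_def aux_val_def)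
qed (use t in \<open>auto simp: aux_funs_def aux_ctx_def Hen_term_def\<close>)

text \<open>The class argument is not computed by a term. It is appended as a further auxiliary
  parameter, the last variable, with index \<open>k\<close>.\<close>

lemma liftable_hfun:
  assumes Fs: "\<forall>F\<in>set Fs. liftable \<Gamma> F" "length Fs = m + 1" and g: "dfun (RVs n) \<Gamma> \<gamma>"
  shows "liftable \<Gamma> (\<lambda>e. hfun ord m n (map (\<lambda>F. F e) Fs) (cls (\<gamma> e)))"
proof (cases "dom_prod ord \<Gamma> = {}")
  case True
  then show ?thesis unfolding liftable_def
    by (intro exI[of _ "[]"] exI[of _ Zero]) (auto simp: aux_funs_def intro: has_sort.intros)
next
  case False
  obtain gs ts where gs: "aux_funs \<Gamma> gs" "\<forall>t\<in>set ts. has_sort A (\<Gamma> @ aux_ctx gs) t VF"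
    and ts: "\<And>e. e \<in> dom_prod ord \<Gamma> \<Longrightarrow> map (trm_val ord (e @ aux_val gs e)) ts = map (\<lambda>F. Fld (F e)) Fs"
    using liftable_list[OF Fs(1)] by auto
  from False obtain e where "e \<in> dom_prod ord \<Gamma>" by blast
  from arg_cong[OF ts[OF this], of length] have len: "length ts = m + 1" using Fs by simp
  have n: "n > 0" using g by (simp add: dfun_def)
  define hs where "hs = gs @ [(n, \<gamma>)]"
  define k where "k = length \<Gamma> + length gs"
  have r: "renaming id (\<Gamma> @ aux_ctx gs) (\<Gamma> @ aux_ctx hs)"
    by (auto simp: renaming_def aux_append nth_append hs_def)
  let ?t = "Hen m n (map (rename_term id) ts) (Var k)"
  have "has_sort A (\<Gamma> @ aux_ctx hs) ((Var k) :: 'k trm) ((\<Gamma> @ aux_ctx hs) ! k)"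
    by (rule has_sort.intros) (simp add: hs_def k_def)
  also have "(\<Gamma> @ aux_ctx hs) ! k = RVs n"
    by (simp add: hs_def k_def aux_append nth_append) (simp add: aux_ctx_def)
  finally have V: "has_sort A (\<Gamma> @ aux_ctx hs) ((Var k) :: 'k trm) (RVs n)" .
  show ?thesis unfolding liftable_def
  proof (intro exI[of _ hs] exI[of _ ?t] conjI ballI)
    show "aux_funs \<Gamma> hs" using gs g by (auto simp: hs_def aux_funs_def)
    show "has_sort A (\<Gamma> @ aux_ctx hs) ?t VF"
      using V n len gs(2) has_sort_rename[OF _ r] by (intro has_sort.intros) auto
    fix e assume e: "e \<in> dom_prod ord \<Gamma>"
    then have l: "length e = length \<Gamma>" by (rule dom_prod_length)
    let ?e = "e @ aux_val hs e"
    have "trm_val ord ?e (rename_term id u) = trm_val ord (e @ aux_val gs e) u" if "u \<in> set ts" for u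
      by (rule trm_val_rename[of A "\<Gamma> @ aux_ctx gs" u VF])
        (use l gs(2) that in \<open>auto simp: aux_append nth_append hs_def\<close>)
    then have "map (trm_val ord ?e) (map (rename_term id) ts) = map (\<lambda>F. Fld (F e)) Fs"
      using ts[OF e] by (simp cong: map_cong)
    then have "map fld (map (trm_val ord ?e) (map (rename_term id) ts)) = map fld (map (\<lambda>F. Fld (F e)) Fs)"
      by (rule arg_cong)
    then have 1: "map (\<lambda>t. fld (trm_val ord ?e t)) (map (rename_term id) ts) = map (\<lambda>F. F e) Fs"
      by (simp add: comp_def)
    have "?e ! k = \<gamma> e" using l
      by (simp add: hs_def k_def aux_append nth_append) (simp add: aux_val_def)
    then show "trm_val ord ?e ?t = Fld (hfun ord m n (map (\<lambda>F. F e) Fs) (cls (\<gamma> e)))"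
      by (simp only: trm_val.simps 1)
  qed
qed

text \<open>Definability is recorded besides the term: the classes of differences
  \<open>f e - c e\<close> are to become auxiliary parameters, and these have to be
  definable.\<close>

definition LF :: "srt list \<Rightarrow> ('k elem list \<Rightarrow> 'k) set" where
  "LF \<Gamma> = {F \<in> DF \<Gamma>. liftable \<Gamma> F}"

lemma fring_LF: "fring (LF \<Gamma>)"
proof -
  interpret D: fring "DF \<Gamma>" by (rule fring_DF)
  have "liftable \<Gamma> (\<lambda>_. 0)" "liftable \<Gamma> (\<lambda>_. 1)"
    using liftable_term[of \<Gamma> Zero] liftable_term[of \<Gamma> One] by (auto simp: Hen_term_def intro: has_sort.intros)
  then show ?thesis
    by unfold_locales
      (auto simp: LF_def intro: D.zero D.one D.add D.diff D.mult has_sort.intros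
        liftable_op[where op = Add and H = "(+)"] liftable_op[where op = Sub and H = "(-)"] liftable_op[where op = Mul and H = "(*)"])
qed

lemma term_functions_LF: "term_functions A \<Gamma> \<subseteq> LF \<Gamma>"
  using term_functions_DF liftable_term unfolding LF_def term_functions_def by blast

lemma fpoly_mono: "fring.fpoly R p \<Longrightarrow> R \<subseteq> R' \<Longrightarrow> fring R \<Longrightarrow> fring R' \<Longrightarrow> fring.fpoly R' p"
  unfolding fring.fpoly_def by blast

lemma LF_DF: "fring.fpoly (LF \<Gamma>) p \<Longrightarrow> fring.fpoly (DF \<Gamma>) p"
  using fpoly_mono[OF _ _ fring_LF fring_DF] LF_def by blast

text \<open>The case distinction over \<open>S\<close> is moved into the auxiliary argument:
  \<open>u\<close> is \<open>z\<close> on \<open>S\<close> and 0 elsewhere, and \<open>hfun\<close>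
  returns 0 at the class of 0. As formulas contain no Hensel functions, the result is shown
  definable as the unique root in the class of \<open>z\<close>.\<close>

lemma LF_root:
  assumes p: "fring.fpoly (LF \<Gamma>) p" and z: "z \<in> DF \<Gamma>" and S: "dset \<Gamma> S" and n: "n > 0"
    and h: "\<And>e. e \<in> dom_prod ord \<Gamma> \<Longrightarrow> S e \<Longrightarrow> hcond n (p e) (z e)"
  shows "\<exists>H\<in>LF \<Gamma>. \<forall>e\<in>dom_prod ord \<Gamma>.
    (S e \<longrightarrow> poly (p e) (H e) = 0 \<and> rv ord n (H e) = rv ord n (z e)) \<and> (\<not> S e \<longrightarrow> H e = 0)"
proof -
  interpret L: fring "LF \<Gamma>" by (rule fring_LF)
  interpret D: fring "DF \<Gamma>" by (rule fring_DF)
  interpret D': fring "DF (VF # \<Gamma>)" by (rule fring_DF)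
  obtain d where d: "\<And>e. degree (p e) \<le> d" using L.fpoly_degree[OF p] by blast
  define u where "u e = (if S e then z e else 0)" for e
  have u: "u \<in> DF \<Gamma>" unfolding u_def by (rule DF_if[OF S z D.zero])
  define H where "H e = hfun ord d n (map (coeff (p e)) [0..<Suc d]) (rv ord n (u e))" for e
  have root: "poly (p e) (H e) = 0" "rv ord n (H e) = rv ord n (z e)" if "e \<in> dom_prod ord \<Gamma>" "S e" for e
  proof -
    have "H e = hfun ord d n (map (coeff (p e)) [0..<Suc d]) (rv ord n (z e))"
      using that by (simp add: H_def u_def)
    from hfun_root[OF n h[OF that] d this]
    show "poly (p e) (H e) = 0" "rv ord n (H e) = rv ord n (z e)" by auto
  qed
  have zero: "H e = 0" if "\<not> S e" for e using that by (simp add: H_def u_def hfun_def)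
  have "liftable \<Gamma> H"
  proof -
    have "liftable \<Gamma> (\<lambda>e. hfun ord d n (map (\<lambda>F. F e) (map (\<lambda>i e. coeff (p e) i) [0..<Suc d])) (cls (RVElem n (rv ord n (u e)))))"
      using L.fpoly_coeff[OF p] dfun_rv[OF u n]
      by (intro liftable_hfun) (auto simp: LF_def simp del: upt_Suc)
    then show ?thesis unfolding H_def by (simp add: comp_def del: upt_Suc)
  qed
  moreover have "H \<in> DF \<Gamma>"
  proof -
    have Y: "(\<lambda>e. fld (e ! 0)) \<in> DF (VF # \<Gamma>)" by (rule DF_Var) auto
    have p': "D'.fpoly (\<lambda>e. p (tl e))"
      using D.fpoly_coeff[OF LF_DF[OF p]] DF_weaken d by (intro D'.fpolyI[where d = d]) auto
    have "dset (VF # \<Gamma>) (\<lambda>e. (S (tl e) \<and> poly (p (tl e)) (fld (e ! 0)) = 0 \<and> rv ord n (fld (e ! 0)) = rv ord n (z (tl e)))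
       \<or> (\<not> S (tl e) \<and> fld (e ! 0) = 0))"
      by (intro dset_disj dset_conj dset_Not dset_weaken S dset_eq dset_rv_eq Y D'.fpoly_poly p' D'.zero DF_weaken z n)
    then show ?thesis unfolding DF_iff
    proof (rule dset_cong)
      fix e assume "e \<in> dom_prod ord (VF # \<Gamma>)"
      then obtain y e' where e: "e = Fld y # e'" "e' \<in> dom_prod ord \<Gamma>" by (auto simp: dom_prod_iff list_all2_Cons2)
      have "y = H e'" if "S e'" "poly (p e') y = 0" "rv ord n y = rv ord n (z e')"
        using that root[OF e(2)] hcond_root[OF n h[OF e(2)]] by blast
      then show "((S (tl e) \<and> poly (p (tl e)) (fld (e ! 0)) = 0 \<and> rv ord n (fld (e ! 0)) = rv ord n (z (tl e)))
       \<or> (\<not> S (tl e) \<and> fld (e ! 0) = 0)) \<longleftrightarrow> hd e = Fld (H (tl e))"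
        using root[OF e(2)] zero[of e'] e(1) by auto
    qed
  qed
  ultimately show ?thesis using root zero by (intro bexI[of _ H]) (auto simp: LF_def)
qed

text \<open>One step of the approximation: among the derivatives satisfying the condition of Hensel's
  lemma near \<open>f - c\<close> the one of least order is chosen, so that its root, and with it the new
  centre, is definable; a choice of a closest root would not be.\<close>

lemma LF_step:
  assumes f: "f \<in> DF \<Gamma>" and q: "fring.fpoly (LF \<Gamma>) q" "\<And>e. degree (q e) \<le> d"
    and S: "dset \<Gamma> S" "\<And>e. e \<in> dom_prod ord \<Gamma> \<Longrightarrow> S e \<Longrightarrow> q e \<noteq> 0 \<and> poly (q e) (f e) = 0"
    and c: "c \<in> LF \<Gamma>"
  shows "\<exists>c'\<in>LF \<Gamma>. \<forall>e\<in>dom_prod ord \<Gamma>. (\<not> S e \<or> c e = f e \<longrightarrow> c' e = c e) \<and>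
    (S e \<and> c e \<noteq> f e \<longrightarrow> f e - c e \<prec> f e - c' e \<and>
      (\<exists>k<d. (pderiv ^^ k) (q e) \<noteq> 0 \<and> poly ((pderiv ^^ k) (q e)) (c' e) = 0))"
proof -
  interpret L: fring "LF \<Gamma>" by (rule fring_LF)
  interpret D: fring "DF \<Gamma>" by (rule fring_DF)
  have cD: "c \<in> DF \<Gamma>" using c by (simp add: LF_def)
  define z where "z = (\<lambda>e. f e - c e)"
  have z: "z \<in> DF \<Gamma>" unfolding z_def using f cD by (rule D.diff)
  define p where "p = (\<lambda>k e. pcompose ((pderiv ^^ k) (q e)) [:c e, 1:])"
  have p: "L.fpoly (p k)" for k unfolding p_def
    by (intro L.fpoly_pcompose L.fpoly_higher_pderiv q L.fpoly_linear c)
  define n where "n k = nu d (d - Suc k)" for k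
  define T where "T k e \<longleftrightarrow> S e \<and> z e \<noteq> 0 \<and> hcond (n k) (p k e) (z e) \<and>
    (\<forall>j\<in>{..<k}. \<not> hcond (n j) (p j e) (z e))" for k e
  have TT: "dset \<Gamma> (T k)" for k unfolding T_def
    by (intro dset_conj dset_ball dset_Not dset_hcond dset_eq S z D.zero LF_DF p) auto
  have "\<exists>H\<in>LF \<Gamma>. \<forall>e\<in>dom_prod ord \<Gamma>.
    (T k e \<longrightarrow> poly (p k e) (H e) = 0 \<and> rv ord (n k) (H e) = rv ord (n k) (z e)) \<and> (\<not> T k e \<longrightarrow> H e = 0)" for k
    by (intro LF_root p z TT) (auto simp: T_def n_def)
  then obtain H where H: "\<And>k. H k \<in> LF \<Gamma>"
    and root: "\<And>k e. e \<in> dom_prod ord \<Gamma> \<Longrightarrow> T k e \<Longrightarrow> poly (p k e) (H k e) = 0 \<and> rv ord (n k) (H k e) = rv ord (n k) (z e)"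
    and zero: "\<And>k e. e \<in> dom_prod ord \<Gamma> \<Longrightarrow> \<not> T k e \<Longrightarrow> H k e = 0" by metis
  \<comment> \<open>At each assignment \<open>T k\<close> holds for at most one \<open>k\<close>, so
    at most one summand is nonzero and the sum carries out the choice of the derivative.\<close>
  define c' where "c' = (\<lambda>e. c e + (\<Sum>k<d. H k e))"
  have c': "c' \<in> LF \<Gamma>" unfolding c'_def using c H by (intro L.add L.sum)
  show ?thesis
  proof (intro bexI[OF _ c'] ballI conjI impI)
    fix e assume e: "e \<in> dom_prod ord \<Gamma>"
    show "c' e = c e" if "\<not> S e \<or> c e = f e"
      using that zero[OF e] unfolding c'_def by (auto simp: T_def z_def intro!: sum.neutral)
    assume s: "S e \<and> c e \<noteq> f e"
    \<comment> \<open>Otherwise cancellation would be bounded at \<open>f e\<close>, where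
      \<open>q e\<close> vanishes, and all Taylor coefficients would be 0.\<close>
    have "\<exists>k<d. hcond (n k) (p k e) (z e)"
    proof (rule ccontr)
      assume no: "\<not> ?thesis"
      have z0: "z e \<noteq> 0" using s by (auto simp: z_def)
      have qe: "q e \<noteq> 0" "poly (q e) (c e + z e) = 0" using S(2)[OF e] s by (auto simp: z_def)
      have "poly (q e) (c e + z e) \<preceq> of_nat (nu d d) * coeff (pcompose (q e) [:c e, 1:]) i * z e ^ i" for i
        using no by (intro nc_dichotomy[OF qe(1) q(2) z0]) (auto simp: n_def p_def)
      then have "coeff (pcompose (q e) [:c e, 1:]) i = 0" for i using qe z0 nu_pos[of d d] by fastforce
      then have "pcompose (q e) [:c e, 1:] = 0" by (intro poly_eqI) simp
      then show False using qe by (simp add: pcompose_eq_0_iff)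
    qed
    then obtain k where k: "k < d" "hcond (n k) (p k e) (z e)" "\<And>j. j < k \<Longrightarrow> \<not> hcond (n j) (p j e) (z e)"
      using exists_least_iff[of "\<lambda>k. k < d \<and> hcond (n k) (p k e) (z e)"] by (metis order_less_trans)
    have Tk: "T k e" using k s by (auto simp: T_def z_def)
    have "\<not> T j e" if "j \<noteq> k" for j
      using that k(2,3) by (cases j k rule: linorder_cases) (auto simp: T_def)
    then have "(\<Sum>k<d. H k e) = H k e" using zero[OF e] k(1) by (subst sum.remove[of _ k]) (auto intro!: sum.neutral)
    then have ce: "c' e = c e + H k e" by (simp add: c'_def)
    have r: "poly (p k e) (H k e) = 0" "rv ord (n k) (H k e) = rv ord (n k) (z e)" using root[OF e Tk] by auto
    from r(2)[symmetric] have "of_nat (n k) * z e \<prec> H k e - z e" by (simp add: rv_eq_iff)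
    then have "z e \<prec> H k e - z e" using vle_O'[OF O_of_nat] vle_vlt_trans by blast
    then have "z e \<prec> - (H k e - z e)" by (rule vlt_uminus)
    then show "f e - c e \<prec> f e - c' e" by (simp add: ce z_def algebra_simps)
    have "p k e \<noteq> 0" using k(2) by (auto simp: hcond_def)
    then have "(pderiv ^^ k) (q e) \<noteq> 0" by (auto simp: p_def)
    moreover have "poly ((pderiv ^^ k) (q e)) (c' e) = 0" using r(1) by (simp add: p_def poly_pcompose ce)
    ultimately show "\<exists>k<d. (pderiv ^^ k) (q e) \<noteq> 0 \<and> poly ((pderiv ^^ k) (q e)) (c' e) = 0" using k(1) by blast
  qed
qed

text \<open>The measure is the number of roots of derivatives strictly closer to \<open>f e\<close>
  than the current centre. A step moves to such a root and lowers it. There are at most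
  \<open>d * d\<close> of them, from \<open>d\<close> derivatives with at most \<open>d\<close>
  roots each, so the number of steps does not depend on \<open>e\<close>.\<close>

lemma LF_algebraic:
  assumes f: "f \<in> DF \<Gamma>" and q: "fring.fpoly (LF \<Gamma>) q"
    and S: "dset \<Gamma> S" "\<And>e. e \<in> dom_prod ord \<Gamma> \<Longrightarrow> S e \<Longrightarrow> q e \<noteq> 0 \<and> poly (q e) (f e) = 0"
  shows "\<exists>c\<in>LF \<Gamma>. \<forall>e\<in>dom_prod ord \<Gamma>. c e = (if S e then f e else 0)"
proof -
  interpret L: fring "LF \<Gamma>" by (rule fring_LF)
  obtain d where d: "\<And>e. degree (q e) \<le> d" using L.fpoly_degree[OF q] by blast
  define Rts where "Rts e = (\<Union>k<d. {r. (pderiv ^^ k) (q e) \<noteq> 0 \<and> poly ((pderiv ^^ k) (q e)) r = 0})" for e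
  have Rk: "finite {r. (pderiv ^^ k) (q e) \<noteq> 0 \<and> poly ((pderiv ^^ k) (q e)) r = 0} \<and>
      card {r. (pderiv ^^ k) (q e) \<noteq> 0 \<and> poly ((pderiv ^^ k) (q e)) r = 0} \<le> d" for k e
  proof (cases "(pderiv ^^ k) (q e) = 0")
    case False
    then show ?thesis using card_poly_roots_bound[OF False] poly_roots_finite[OF False] d[of e]
      by (simp add: degree_higher_pderiv)
  qed simp
  have fR: "finite (Rts e)" for e unfolding Rts_def using Rk by auto
  have cR: "card (Rts e) \<le> d * d" for e
  proof -
    have "card (Rts e) \<le> (\<Sum>k<d. card {r. (pderiv ^^ k) (q e) \<noteq> 0 \<and> poly ((pderiv ^^ k) (q e)) r = 0})"
      unfolding Rts_def by (rule card_UN_le) simp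
    also have "\<dots> \<le> (\<Sum>k<d. d)" by (rule sum_mono) (use Rk in blast)
    finally show ?thesis by simp
  qed
  define B where "B e c = {r\<in>Rts e. f e - c \<prec> f e - r}" for e c
  have "\<exists>c\<in>LF \<Gamma>. \<forall>e\<in>dom_prod ord \<Gamma>. (\<not> S e \<longrightarrow> c e = 0) \<and>
      (S e \<longrightarrow> c e = f e \<or> card (B e (c e)) + j \<le> card (Rts e))" for j
  proof (induction j)
    case 0
    show ?case using L.zero fR by (intro bexI[of _ "\<lambda>_. 0"]) (auto simp: B_def intro!: card_mono)
  next
    case (Suc j)
    then obtain c where c: "c \<in> LF \<Gamma>" "\<And>e. e \<in> dom_prod ord \<Gamma> \<Longrightarrow> \<not> S e \<Longrightarrow> c e = 0"
      "\<And>e. e \<in> dom_prod ord \<Gamma> \<Longrightarrow> S e \<Longrightarrow> c e = f e \<or> card (B e (c e)) + j \<le> card (Rts e)" by blast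
    obtain c' where c': "c' \<in> LF \<Gamma>" "\<And>e. e \<in> dom_prod ord \<Gamma> \<Longrightarrow> \<not> S e \<or> c e = f e \<Longrightarrow> c' e = c e"
      and step: "\<And>e. e \<in> dom_prod ord \<Gamma> \<Longrightarrow> S e \<and> c e \<noteq> f e \<Longrightarrow> f e - c e \<prec> f e - c' e \<and>
        (\<exists>k<d. (pderiv ^^ k) (q e) \<noteq> 0 \<and> poly ((pderiv ^^ k) (q e)) (c' e) = 0)"
      using LF_step[OF f q d S c(1)] by blast
    show ?case
    proof (intro bexI[OF _ c'(1)] ballI conjI impI)
      fix e assume e: "e \<in> dom_prod ord \<Gamma>"
      show "c' e = 0" if "\<not> S e" using c'(2)[OF e] c(2)[OF e] that by simp
      assume s: "S e"
      show "c' e = f e \<or> card (B e (c' e)) + Suc j \<le> card (Rts e)"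
      proof (cases "c e = f e \<or> c' e = f e")
        case True
        then show ?thesis using c'(2)[OF e] by auto
      next
        case False
        then have n: "f e - c e \<prec> f e - c' e" "c' e \<in> Rts e" using step[OF e] s by (auto simp: Rts_def)
        have "B e (c' e) \<subset> B e (c e)"
        proof
          show "B e (c' e) \<subseteq> B e (c e)" unfolding B_def using n(1) vlt_vle vle_vlt_trans by blast
          have "c' e \<in> B e (c e)" using n by (simp add: B_def)
          moreover have "c' e \<notin> B e (c' e)" using False vlt_irrefl[of "f e - c' e"] by (auto simp: B_def)
          ultimately show "B e (c' e) \<noteq> B e (c e)" by blast
        qed
        then have "card (B e (c' e)) < card (B e (c e))" using fR by (intro psubset_card_mono) (auto simp: B_def)
        then show ?thesis using c(3)[OF e s] False by auto
      qed
    qed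
  qed
  \<comment> \<open>The induction is read at \<open>j = Suc (d * d)\<close>, where the second
    alternative contradicts the bound on \<open>card (Rts e)\<close>.\<close>
  then obtain c where c: "c \<in> LF \<Gamma>" "\<And>e. e \<in> dom_prod ord \<Gamma> \<Longrightarrow> \<not> S e \<Longrightarrow> c e = 0"
    "\<And>e. e \<in> dom_prod ord \<Gamma> \<Longrightarrow> S e \<Longrightarrow> c e = f e \<or> card (B e (c e)) + Suc (d * d) \<le> card (Rts e)" by blast
  show ?thesis
  proof (intro bexI[OF _ c(1)] ballI)
    fix e assume e: "e \<in> dom_prod ord \<Gamma>"
    show "c e = (if S e then f e else 0)" using c(2)[OF e] c(3)[OF e] cR[of e] by auto
  qed
qed

text \<open>Which polynomial has \<open>f e\<close> as a root varies with \<open>e\<close>. Each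
  assignment is handled by the earliest suitable polynomial, with \<open>W\<close> recording what
  earlier ones have left over; the resulting functions are zero off disjoint definable sets and can
  be added.\<close>

lemma LF_algebraic_list:
  assumes f: "f \<in> DF \<Gamma>" and qs: "\<forall>q\<in>set qs. fring.fpoly (LF \<Gamma>) q" and W: "dset \<Gamma> W"
  shows "\<exists>c\<in>LF \<Gamma>. \<forall>e\<in>dom_prod ord \<Gamma>.
    c e = (if W e \<and> (\<exists>q\<in>set qs. q e \<noteq> 0 \<and> poly (q e) (f e) = 0) then f e else 0)"
  using qs W
proof (induction qs arbitrary: W)
  case Nil
  show ?case using fring.zero[OF fring_LF] by (intro bexI[of _ "\<lambda>_. 0"]) auto
next
  case (Cons q qs)
  interpret L: fring "LF \<Gamma>" by (rule fring_LF)
  interpret D: fring "DF \<Gamma>" by (rule fring_DF)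
  have q: "L.fpoly q" "D.fpoly q" using Cons.prems LF_DF by auto
  obtain d where d: "\<And>e. degree (q e) \<le> d" using L.fpoly_degree[OF q(1)] by blast
  define T where "T e \<longleftrightarrow> q e \<noteq> 0 \<and> poly (q e) (f e) = 0" for e
  have "dset \<Gamma> (\<lambda>e. (\<exists>i\<in>{..d}. coeff (q e) i \<noteq> 0) \<and> poly (q e) (f e) = 0)"
    by (intro dset_conj dset_bex dset_Not dset_eq D.fpoly_coeff D.fpoly_poly q f D.zero) auto
  then have T: "dset \<Gamma> T"
  proof (rule dset_cong)
    fix e
    have "q e \<noteq> 0 \<Longrightarrow> coeff (q e) (degree (q e)) \<noteq> 0" by simp
    then show "(\<exists>i\<in>{..d}. coeff (q e) i \<noteq> 0) \<and> poly (q e) (f e) = 0 \<longleftrightarrow> T e"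
      using d[of e] unfolding T_def by (auto intro!: bexI[of _ "degree (q e)"])
  qed
  obtain c where c: "c \<in> LF \<Gamma>" "\<And>e. e \<in> dom_prod ord \<Gamma> \<Longrightarrow> c e = (if W e \<and> T e then f e else 0)"
    using LF_algebraic[OF f q(1) dset_conj[OF Cons.prems(2) T]] by (auto simp: T_def)
  have "dset \<Gamma> (\<lambda>e. W e \<and> \<not> T e)" by (intro dset_conj dset_Not T Cons.prems)
  then obtain c' where c': "c' \<in> LF \<Gamma>" "\<And>e. e \<in> dom_prod ord \<Gamma> \<Longrightarrow>
    c' e = (if (W e \<and> \<not> T e) \<and> (\<exists>q\<in>set qs. q e \<noteq> 0 \<and> poly (q e) (f e) = 0) then f e else 0)"
    using Cons by fastforce
  show ?case
    by (rule bexI[OF _ L.add[OF c(1) c'(1)]]) (use c c' in \<open>auto simp: T_def\<close>)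
qed

text \<open>The graph of \<open>f\<close> has a single point over each assignment, so
  \<open>definable_point_algebraic\<close> supplies finitely many polynomials of which, everywhere,
  some nonzero one has the root \<open>f e\<close>. For these the function from
  \<open>LF_algebraic_list\<close> is \<open>f\<close> itself.\<close>

lemma DF_liftable:
  assumes f: "f \<in> DF \<Gamma>"
  shows "liftable \<Gamma> f"
proof -
  obtain \<phi> where \<phi>: "Hen_formula A (VF # \<Gamma>) \<phi>"
    "\<And>e. e \<in> dom_prod ord (VF # \<Gamma>) \<Longrightarrow> sat ord e \<phi> \<longleftrightarrow> hd e = Fld (f (tl e))"
    using f unfolding DF_iff dset_def by blast
  obtain P where P: "finite P" "\<And>p. p \<in> P \<Longrightarrow> fring.fpoly (term_functions A \<Gamma>) p"
    and root: "\<And>e b. e \<in> dom_prod ord \<Gamma> \<Longrightarrow> (\<And>y. sat ord (Fld y # e) \<phi> \<longleftrightarrow> y = b) \<Longrightarrow>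
      \<exists>p\<in>P. p e \<noteq> 0 \<and> poly (p e) b = 0"
    using definable_point_algebraic[OF A \<phi>(1)] by metis
  obtain qs where qs: "set qs = P" using P finite_list by blast
  have "\<forall>q\<in>set qs. fring.fpoly (LF \<Gamma>) q"
    using P fpoly_mono[OF _ term_functions_LF fring_term_functions fring_LF] unfolding qs by blast
  from LF_algebraic_list[OF f this dset_True] obtain c where c: "c \<in> LF \<Gamma>" "\<And>e. e \<in> dom_prod ord \<Gamma> \<Longrightarrow>
    c e = (if \<exists>q\<in>P. q e \<noteq> 0 \<and> poly (q e) (f e) = 0 then f e else 0)" unfolding qs by auto
  have "c e = f e" if e: "e \<in> dom_prod ord \<Gamma>" for e
  proof -
    have "sat ord (Fld y # e) \<phi> \<longleftrightarrow> y = f e" for y using e \<phi>(2)[of "Fld y # e"] by (simp add: dom_prod_Cons)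
    from root[OF e this] show ?thesis using c(2)[OF e] by simp
  qed
  then show ?thesis using c(1) unfolding LF_def liftable_def by auto
qed

end

context henselian_params
begin

section \<open>Return to definable sets and to functions on a definable domain\<close>

lemma definable_dset: "definable ord A ss X \<Longrightarrow> dset ss (\<lambda>e. e \<in> X)"
  unfolding definable_def dset_def by auto

lemma dset_definable: "dset ss R \<Longrightarrow> list_all valid_sort ss \<Longrightarrow> definable ord A ss {e \<in> dom_prod ord ss. R e}"
  unfolding definable_def dset_def by auto

lemma aux_valid: "aux_funs \<Gamma> gs \<Longrightarrow> list_all valid_sort (aux_ctx gs)"
  by (auto simp: aux_funs_def aux_ctx_def dfun_def list_all_iff)

lemma aux_val_dom: "aux_funs \<Gamma> gs \<Longrightarrow> e \<in> dom_prod ord \<Gamma> \<Longrightarrow> aux_val gs e \<in> dom_prod ord (aux_ctx gs)"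
  by (fastforce simp: dom_prod_iff list_all2_conv_all_nth aux_val_def aux_ctx_def aux_funs_def dfun_def
      dest: nth_mem split: prod.splits)

lemma dset_aux_graph:
  assumes "aux_funs \<Gamma> gs"
  shows "dset (\<Gamma> @ aux_ctx gs) (\<lambda>e. drop (length \<Gamma>) e = aux_val gs (take (length \<Gamma>) e))"
proof -
  let ?k = "length \<Gamma>"
  have "dset (\<Gamma> @ aux_ctx gs) (\<lambda>e. e ! (?k + i) = snd (gs ! i) (take ?k e))" if i: "i \<in> {..<length gs}" for i
  proof -
    obtain n \<gamma> where g: "gs ! i = (n, \<gamma>)" by fastforce
    have "(n, \<gamma>) \<in> set gs" using i g nth_mem[of i gs] by simp
    then have "dset (RVs n # \<Gamma>) (\<lambda>e. hd e = \<gamma> (tl e))" using assms by (auto simp: aux_funs_def dfun_def)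
    then have "dset (\<Gamma> @ aux_ctx gs) (\<lambda>e. (\<lambda>e. hd e = \<gamma> (tl e)) (e ! (?k + i) # take ?k e))"
    proof (rule dset_rename[where \<rho> = "\<lambda>j. case j of 0 \<Rightarrow> ?k + i | Suc j \<Rightarrow> j"])
      show "renaming (\<lambda>j. case j of 0 \<Rightarrow> ?k + i | Suc j \<Rightarrow> j) (RVs n # \<Gamma>) (\<Gamma> @ aux_ctx gs)"
        using i g by (auto simp: renaming_def nth_append aux_ctx_def split: nat.split)
      fix e assume "e \<in> dom_prod ord (\<Gamma> @ aux_ctx gs)"
      then have "length e = ?k + length gs" using dom_prod_length by fastforce
      then show "length (e ! (?k + i) # take ?k e) = length (RVs n # \<Gamma>) \<and>
        (\<forall>ia<length (RVs n # \<Gamma>). e ! (case ia of 0 \<Rightarrow> ?k + i | Suc j \<Rightarrow> j) = (e ! (?k + i) # take ?k e) ! ia)"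
        using i by (auto split: nat.split)
    qed
    then show ?thesis using g by simp
  qed
  then have "dset (\<Gamma> @ aux_ctx gs) (\<lambda>e. \<forall>i\<in>{..<length gs}. e ! (?k + i) = snd (gs ! i) (take ?k e))"
    by (intro dset_ball) auto
  then show ?thesis
  proof (rule dset_cong)
    fix e assume "e \<in> dom_prod ord (\<Gamma> @ aux_ctx gs)"
    then have "length e = ?k + length gs" using dom_prod_length by fastforce
    then show "(\<forall>i\<in>{..<length gs}. e ! (?k + i) = snd (gs ! i) (take ?k e)) \<longleftrightarrow>
        drop ?k e = aux_val gs (take ?k e)"
      unfolding list_eq_iff_nth_eq[of "drop ?k e"] by (simp add: aux_val_def split_def Ball_def)
  qed
qed

lemma dom_prod_append:
  "e @ e' \<in> dom_prod ord (ss @ ts) \<longleftrightarrow> e \<in> dom_prod ord ss \<and> e' \<in> dom_prod ord ts" if "length e = length ss"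
  using that by (simp add: dom_prod_iff list_all2_append)

text \<open>The target can be taken to be the full product of the auxiliary sorts, which is
  definable.\<close>

lemma definable_fun_aux_val:
  assumes gs: "aux_funs ss gs" and X: "definable ord A ss X"
  shows "definable_fun ord A ss X (aux_ctx gs) (dom_prod ord (aux_ctx gs)) (aux_val gs)"
proof -
  have vs: "list_all valid_sort ss" and XD: "X \<subseteq> dom_prod ord ss"
    using X by (auto simp: definable_def)
  let ?k = "length ss"
  have "dset (ss @ aux_ctx gs) (\<lambda>e. take ?k e \<in> X)"
  proof (rule dset_rename[OF definable_dset[OF X], where \<rho> = id])
    fix e assume "e \<in> dom_prod ord (ss @ aux_ctx gs)"
    then have "length e = ?k + length gs" using dom_prod_length by fastforce
    then show "length (take ?k e) = ?k \<and> (\<forall>i<?k. e ! id i = take ?k e ! i)" by auto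
  qed (auto simp: renaming_def nth_append)
  from dset_definable[OF dset_conj[OF this dset_aux_graph[OF gs]]]
  have "definable ord A (ss @ aux_ctx gs) {e \<in> dom_prod ord (ss @ aux_ctx gs). take ?k e \<in> X \<and> drop ?k e = aux_val gs (take ?k e)}"
    using vs aux_valid[OF gs] by simp
  also have "{e \<in> dom_prod ord (ss @ aux_ctx gs). take ?k e \<in> X \<and> drop ?k e = aux_val gs (take ?k e)} = {x @ aux_val gs x | x. x \<in> X}"
  proof (intro set_eqI iffI)
    fix e assume "e \<in> {e \<in> dom_prod ord (ss @ aux_ctx gs). take ?k e \<in> X \<and> drop ?k e = aux_val gs (take ?k e)}"
    then have "take ?k e \<in> X" "e = take ?k e @ aux_val gs (take ?k e)" by (auto, metis append_take_drop_id)
    then show "e \<in> {x @ aux_val gs x | x. x \<in> X}" by blast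
  next
    fix e assume "e \<in> {x @ aux_val gs x | x. x \<in> X}"
    then obtain x where x: "x \<in> X" "e = x @ aux_val gs x" by blast
    then have "x \<in> dom_prod ord ss" using XD by blast
    then show "e \<in> {e \<in> dom_prod ord (ss @ aux_ctx gs). take ?k e \<in> X \<and> drop ?k e = aux_val gs (take ?k e)}"
      using x dom_prod_length[of x ord ss] aux_val_dom[OF gs] by (simp add: dom_prod_append)
  qed
  finally have "definable ord A (ss @ aux_ctx gs) {x @ aux_val gs x | x. x \<in> X}" .
  moreover have "definable ord A (aux_ctx gs) (dom_prod ord (aux_ctx gs))"
    using dset_definable[OF dset_True aux_valid[OF gs]] by simp
  ultimately show ?thesis using X XD aux_val_dom[OF gs] unfolding definable_fun_def by auto
qed

text \<open>Extension by 0 produces a function on the whole product, the setting of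
  \<open>DF\<close>; the value, last in the given graph, is moved to the front.\<close>

lemma definable_fun_DF:
  assumes f: "definable_fun ord A ss X [VF] (dom_prod ord [VF]) (\<lambda>x. [Fld (f x)])"
  shows "(\<lambda>e. if e \<in> X then f e else 0) \<in> DF ss"
proof -
  let ?k = "length ss"
  have XD: "X \<subseteq> dom_prod ord ss" and X: "dset ss (\<lambda>e. e \<in> X)"
    and G: "dset (ss @ [VF]) (\<lambda>e. e \<in> {x @ [Fld (f x)] | x. x \<in> X})"
  proof -
    have d: "definable ord A ss X" "definable ord A (ss @ [VF]) {x @ [Fld (f x)] | x. x \<in> X}"
      using f unfolding definable_fun_def by auto
    show "dset ss (\<lambda>e. e \<in> X)" "dset (ss @ [VF]) (\<lambda>e. e \<in> {x @ [Fld (f x)] | x. x \<in> X})"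
      using d by (auto dest: definable_dset)
    show "X \<subseteq> dom_prod ord ss" using d(1) by (auto simp: definable_def)
  qed
  have "dset (VF # ss) (\<lambda>e. tl e @ [hd e] \<in> {x @ [Fld (f x)] | x. x \<in> X})"
  proof (rule dset_rename[OF G, where \<rho> = "\<lambda>i. if i < ?k then Suc i else 0"])
    fix e assume "e \<in> dom_prod ord (VF # ss)"
    then obtain x e' where "e = x # e'" "length e' = ?k"
      by (auto simp: dom_prod_iff list_all2_Cons2 dest: list_all2_lengthD)
    then show "length (tl e @ [hd e]) = length (ss @ [VF]) \<and>
        (\<forall>i<length (ss @ [VF]). e ! (if i < ?k then Suc i else 0) = (tl e @ [hd e]) ! i)"
      by (auto simp: nth_append)
  qed (auto simp: renaming_def nth_append)
  moreover have "dset (VF # ss) (\<lambda>e. tl e \<notin> X \<and> fld (e ! 0) = 0)"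
    by (intro dset_conj dset_Not dset_weaken X dset_eq DF_Var fring.zero[OF fring_DF]) auto
  ultimately have "dset (VF # ss) (\<lambda>e. tl e @ [hd e] \<in> {x @ [Fld (f x)] | x. x \<in> X} \<or> tl e \<notin> X \<and> fld (e ! 0) = 0)"
    by (rule dset_disj)
  then show ?thesis unfolding DF_iff
    by (rule dset_cong) (auto simp: dom_prod_iff list_all2_Cons2)
qed

end

theorem theorem7p2p9:
  fixes ord :: "'k::field_char_0 \<Rightarrow> 'g::linordered_ab_group_add extended"
    and A :: "'k elem set"
    and ss :: "srt list"
    and X :: "'k elem list set"
    and f :: "'k elem list \<Rightarrow> 'k"
  assumes "henselian_field ord"
    and "A \<subseteq> all_elems ord"
    and "definable_fun ord A ss X [VF] (dom_prod ord [VF]) (\<lambda>x. [Fld (f x)])"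
  shows "\<exists>ns S g t.
           auxiliary ord A ns S \<and>
           definable_fun ord A ss X (map RVs ns) S g \<and>
           Hen_star_term A (ss @ map RVs ns) t VF \<and>
           (\<forall>x\<in>X. Fld (f x) = trm_val ord (x @ g x) t)"
proof -
  interpret henselian_params ord A using assms by unfold_locales
  have X: "definable ord A ss X" using assms(3) by (simp add: definable_fun_def)
  then have XD: "X \<subseteq> dom_prod ord ss" by (auto simp: definable_def)
  obtain gs t where gs: "aux_funs ss gs" and t: "has_sort A (ss @ aux_ctx gs) t VF"
    and v: "\<And>e. e \<in> dom_prod ord ss \<Longrightarrow> trm_val ord (e @ aux_val gs e) t = Fld (if e \<in> X then f e else 0)"
    using DF_liftable[OF definable_fun_DF[OF assms(3)]] unfolding liftable_def by blast
  have g: "definable_fun ord A ss X (aux_ctx gs) (dom_prod ord (aux_ctx gs)) (aux_val gs)"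
    by (rule definable_fun_aux_val[OF gs X])
  show ?thesis
  proof (intro exI conjI ballI)
    show "auxiliary ord A (map fst gs) (dom_prod ord (aux_ctx gs))"
      using g by (simp add: auxiliary_def definable_fun_def aux_ctx_def)
    show "definable_fun ord A ss X (map RVs (map fst gs)) (dom_prod ord (aux_ctx gs)) (aux_val gs)"
      using g by (simp add: aux_ctx_def)
    show "Hen_star_term A (ss @ map RVs (map fst gs)) t VF"
      using t by (simp add: Hen_star_term_def aux_ctx_def)
    fix x assume "x \<in> X"
    then show "Fld (f x) = trm_val ord (x @ aux_val gs x) t" using XD v[of x] by auto
  qed
qed

end
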